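(* Let $t$ be a positive integer and let $T_{2,t}$ be the $(2,t)$-torus knot or link. Then $$c_5(T_{2,t}) \le \begin{cases} \left\lceil \frac{t}{4} \right\rceil & \text{if } t \text{ is even},\\[4pt] \left\lfloor \frac{t+1}{3} \right\rfloor & \text{if } t \text{ is odd},\end{cases}$$ where $c_5$ denotes the $5$-crossing number.
   Context: For $n\ge 2$, an $n$-crossing projection of a link $L$ is a projection of (a representative of the isotopy class of) $L$ to a plane such that at every multiple point (called a crossing, or $n$-crossing) exactly $n$ points of $L$ are superimposed, i.e. exactly $n$ strands, at distinct heights, pass straight through that point, each pair crossing transversally. The $n$-crossing number $c_n(L)$ is the least number of $n$-crossings in any $n$-crossing projection of $L$ (every link has an $n$-crossing projection for every $n\ge 2$). $T_{2,t}$ is the closure of the two-strand braid $\sigma_1^{t}$; it is a knot if $t$ is odd and a two-component link if $t$ is even. *)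

theory Defs
  imports "HOL-Analysis.Analysis" "HOL-Library.Extended_Nat"
begin

text \<open>Links are treated as subsets of three-space; links have no orientation here.\<close>

definition ambient_isotopic :: "(real^3) set \<Rightarrow> (real^3) set \<Rightarrow> bool" where
  "ambient_isotopic L L' \<longleftrightarrow>
     (\<exists>f. homotopic_with_canon (\<lambda>h. \<exists>g. homeomorphism UNIV UNIV h g) UNIV UNIV id f
        \<and> f ` L = L')"

definition multiple_points :: "(real^3 \<Rightarrow> real^2) \<Rightarrow> (real^3) set \<Rightarrow> (real^2) set" where
  "multiple_points P L = {p. \<exists>q\<in>L. \<exists>q'\<in>L. q \<noteq> q' \<and> P q = p \<and> P q' = p}"

text \<open>Near \<open>q\<close>, the set \<open>L\<close> is a single \<open>C\<^sup>1\<close> arc with velocity \<open>v\<close> at \<open>q\<close>. Strands are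
  described locally, so that no global parametrisation of the components is needed.\<close>

definition strand_direction :: "(real^3) set \<Rightarrow> real^3 \<Rightarrow> real^3 \<Rightarrow> bool" where
  "strand_direction L q v \<longleftrightarrow>
     (\<exists>U \<alpha>. open U \<and> q \<in> U \<and> \<alpha> C1_differentiable_on {-1<..<1} \<and> inj_on \<alpha> {-1<..<1}
        \<and> \<alpha> ` {-1<..<1} = L \<inter> U \<and> \<alpha> 0 = q \<and> (\<alpha> has_vector_derivative v) (at 0))"

text \<open>A projection to a plane is a linear surjection \<open>P\<close>: up to a linear identification of
  planes, it is the orthogonal projection along its kernel. The points of \<open>L\<close> over a given point
  lie on a line parallel to that kernel, so distinct points have distinct heights. Non-collinearity
  with \<open>0\<close> says that the projected velocities are linearly independent (in particular nonzero).\<close>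

definition n_crossing_projection ::
    "nat \<Rightarrow> (real^3 \<Rightarrow> real^2) \<Rightarrow> (real^3) set \<Rightarrow> bool" where
  "n_crossing_projection n P L \<longleftrightarrow>
     linear P \<and> surj P \<and> finite (multiple_points P L) \<and>
     (\<forall>p\<in>multiple_points P L.
        finite {q\<in>L. P q = p} \<and> card {q\<in>L. P q = p} = n \<and>
        (\<exists>v. (\<forall>q\<in>{q\<in>L. P q = p}. strand_direction L q (v q)) \<and>
             (\<forall>q\<in>{q\<in>L. P q = p}. \<forall>q'\<in>{q\<in>L. P q = p}.
                q \<noteq> q' \<longrightarrow> \<not> collinear {0, P (v q), P (v q')})))"

text \<open>The value is \<open>\<infinity>\<close> if there is no \<open>n\<close>-crossing projection at all, so a finite upper bound
  includes the existence of one. A set ambient isotopic to a tame link is again a tame link, so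
  no further condition on the representative \<open>L'\<close> is needed.\<close>

definition n_crossing_number :: "nat \<Rightarrow> (real^3) set \<Rightarrow> enat" where
  "n_crossing_number n L =
     Inf {enat (card (multiple_points P L')) | P L'.
            ambient_isotopic L L' \<and> n_crossing_projection n P L'}"

text \<open>Geometric braids are subsets of \<open>\<complex> \<times> [0,1]\<close>. The generator \<open>sigma1\<close> of the two-strand braid
  group is a half twist exchanging the endpoints \<open>1\<close> and \<open>-1\<close>; powers are formed by
  stacking copies and rescaling the height to \<open>[0,1]\<close>.\<close>

definition sigma1 :: "(complex \<times> real) set" where
  "sigma1 = {(w, s). s \<in> {0..1} \<and> (w = cis (pi * s) \<or> w = - cis (pi * s))}"

definition braid_power :: "(complex \<times> real) set \<Rightarrow> nat \<Rightarrow> (complex \<times> real) set" where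
  "braid_power B t = {(w, (real k + s) / real t) | w s k. k < t \<and> (w, s) \<in> B}"

text \<open>The closure bends the cylinder \<open>{w. \<bar>w\<bar> < 2} \<times> [0,1]\<close> around the third axis and glues its
  ends, giving a standard unknotted solid torus. The sign of the last coordinate makes this
  orientation preserving, so that the closures of positive powers of \<open>sigma1\<close> are right-handed;
  multi-crossing numbers are the same for mirror images.\<close>

definition braid_closure :: "(complex \<times> real) set \<Rightarrow> (real^3) set" where
  "braid_closure B =
     (\<lambda>(w, s). vector [(2 + Re w) * cos (2 * pi * s), (2 + Re w) * sin (2 * pi * s), - Im w]) ` B"

definition torus_link2 :: "nat \<Rightarrow> (real^3) set" where
  "torus_link2 t = braid_closure (braid_power sigma1 t)"

end

theory Submission
  imports Defs
begin

text \<open>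
  Describe the torus link as a closed two-strand braid around an axis, in cylindrical coordinates.
  After rescaling, the strands turn around each other at varying distances from the axis and at
  varying heights. Rotating points about the axis by an angle that depends only on radius and height is an
  ambient isotopy; with a suitable choice it brings four consecutive passages across the circle of
  radius 2 to a single point of the plane.

  For even \<open>t\<close>, the other strand is the circle of radius 2 itself. The four passages make two full
  turns, so each crossing accounts for four half turns; the last block may do with two.

  For odd \<open>t\<close>, each crossing consists of four passages of the two strands that make three half
  turns. The fifth strand is the part of the closing arc of one strand that is flipped over the
  axis to the front, where it runs above all blocks. The piece that leads from the chain to this
  arc adds \<open>e\<close> half turns, with \<open>e\<close> one of -1, 0 and 1, which covers all odd \<open>t\<close>.
\<close>

section \<open>Ambient isotopies\<close>

text \<open>The rotation angle may depend on the height, so passages through radius 2 at different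
  heights can be turned to a common direction independently of each other. The price is a
  compatibility condition: points of the link with equal radius and height have to be turned
  equally. It concerns the places where the trace of the link in the half plane of radius and height
  meets itself, and it dictates many vertices of the blocks.

  For even t one component can be straightened to a round circle and the other winds around it. For
  odd t there is only one component: both strands of a block take part in its four passages and
  exchange places, and no strand is left to run along radius 2. The flip lays the closing arc over
  the chain as such a strand. Since the arc is higher than everything else, the flip moves nothing
  else. As t is odd, t = 3 n + e makes n odd exactly for e = 0, and this parity determines the radii
  at which the arc attaches to the chain.\<close>

definition isotopic :: "'a::topological_space set \<Rightarrow> 'a set \<Rightarrow> bool" where
  "isotopic L L' \<longleftrightarrow>
     (\<exists>f. homotopic_with_canon (\<lambda>h. \<exists>g. homeomorphism UNIV UNIV h g) UNIV UNIV id f \<and> f ` L = L')"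

text \<open>The second homotopy starts at the identity; precomposing all its stages with the
  homeomorphism \<open>f\<close> lets it start where the first one ends.\<close>

lemma isotopic_trans:
  assumes "isotopic L M" "isotopic M N"
  shows "isotopic L N"
proof -
  let ?H = "\<lambda>h::'a\<Rightarrow>'a. \<exists>g. homeomorphism UNIV UNIV h g"
  obtain f where f: "homotopic_with_canon ?H UNIV UNIV id f" "f ` L = M"
    using assms(1) by (auto simp: isotopic_def)
  obtain f' where f': "homotopic_with_canon ?H UNIV UNIV id f'" "f' ` M = N"
    using assms(2) by (auto simp: isotopic_def)
  obtain g where g: "homeomorphism UNIV UNIV f g"
    using homotopic_with_imp_property[OF f(1)] by auto
  have "homotopic_with_canon (\<lambda>h. ?H (h \<circ> f)) UNIV UNIV id f'"
  proof (rule homotopic_with_mono[OF f'(1)])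
    fix h assume "?H h"
    then obtain k where "homeomorphism UNIV UNIV h k" by blast
    from homeomorphism_compose[OF g this] show "?H (h \<circ> f)" by blast
  qed
  then have "homotopic_with_canon ?H UNIV UNIV (id \<circ> f) (f' \<circ> f)"
    by (rule homotopic_with_compose_continuous_right) (use g in \<open>auto simp: homeomorphism_def\<close>)
  then have "homotopic_with_canon ?H UNIV UNIV id (f' \<circ> f)"
    using f(1) by (auto intro: homotopic_with_trans)
  then show ?thesis
    unfolding isotopic_def using f(2) f'(2) by (intro exI[of _ "f' \<circ> f"]) (auto simp: image_comp)
qed

text \<open>Reversing time inverts each stage, so with joint continuity every stage is a
  homeomorphism. The motions below shift, turn or stretch by an amount that stays constant along the
  motion, which makes reversal easy.\<close>

lemma isotopic_flow:
  fixes F :: "real \<Rightarrow> 'a::topological_space \<Rightarrow> 'a"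
  assumes cont: "continuous_on UNIV (\<lambda>(\<tau>, x). F \<tau> x)"
    and zero: "\<And>x. F 0 x = x" and inv: "\<And>\<tau> x. F (-\<tau>) (F \<tau> x) = x"
  shows "isotopic L (F 1 ` L)"
proof -
  have 1: "continuous_on UNIV (F \<tau>)" for \<tau>
    using continuous_on_compose2[OF cont, of UNIV "Pair \<tau>"]
    by (simp add: continuous_on_Pair)
  have inv': "F \<tau> (F (-\<tau>) x) = x" for \<tau> x
    using inv[of "-\<tau>" x] by simp
  have "homeomorphism UNIV UNIV (F \<tau>) (F (-\<tau>))" for \<tau>
    by (rule homeomorphismI) (auto simp: 1 inv inv')
  moreover have "continuous_map (prod_topology (top_of_set {0..1::real}) (top_of_set UNIV))
      (top_of_set UNIV) (\<lambda>(\<tau>, x). F \<tau> x)"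
    unfolding prod_topology_subtopology_eu
    using continuous_on_subset[OF cont, of "{0..1} \<times> UNIV"] by simp
  ultimately have "homotopic_with_canon (\<lambda>h. \<exists>g. homeomorphism UNIV UNIV h g) UNIV UNIV id (F 1)"
    unfolding homotopic_with_def by (intro exI[of _ "\<lambda>(\<tau>, x). F \<tau> x"]) (auto simp: zero)
  then show ?thesis unfolding isotopic_def by blast
qed

text \<open>Conjugation by \<open>j\<close>. The motions are built on
  \<open>complex \<times> real\<close>, where turning about the axis is multiplication by
  \<open>cis\<close>, and are carried to \<open>real^3\<close> afterwards.\<close>

lemma isotopic_homeomorphic_image:
  fixes j :: "'a::topological_space \<Rightarrow> 'b::topological_space"
  assumes hom: "homeomorphism UNIV UNIV j k" and "isotopic L L'"
  shows "isotopic (j ` L) (j ` L')"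
proof -
  obtain f where f: "homotopic_with_canon (\<lambda>h. \<exists>g. homeomorphism UNIV UNIV h g) UNIV UNIV id f" "f ` L = L'"
    using assms(2) by (auto simp: isotopic_def)
  have kj: "k (j x) = x" "j (k y) = y" for x y using hom by (auto simp: homeomorphism_def)
  have cj: "continuous_on UNIV j" "continuous_on UNIV k" using hom by (auto simp: homeomorphism_def)
  have "homotopic_with_canon (\<lambda>h. \<exists>g. homeomorphism UNIV UNIV (j \<circ> h \<circ> k) g) UNIV UNIV id f"
  proof (rule homotopic_with_mono[OF f(1)])
    fix h :: "'a \<Rightarrow> 'a" assume "\<exists>g. homeomorphism UNIV UNIV h g"
    then obtain g where "homeomorphism UNIV UNIV h g" by blast
    from homeomorphism_compose[OF homeomorphism_compose[OF homeomorphism_symD[OF hom] this] hom]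
    show "\<exists>g. homeomorphism UNIV UNIV (j \<circ> h \<circ> k) g" by (auto simp: comp_assoc)
  qed
  then have "homotopic_with_canon (\<lambda>h. \<exists>g. homeomorphism UNIV UNIV (h \<circ> k) g) UNIV UNIV (j \<circ> id) (j \<circ> f)"
    by (rule homotopic_with_compose_continuous_left) (auto simp: cj)
  then have "homotopic_with_canon (\<lambda>h. \<exists>g. homeomorphism UNIV UNIV h g) UNIV UNIV (j \<circ> id \<circ> k) (j \<circ> f \<circ> k)"
    by (rule homotopic_with_compose_continuous_right) (auto simp: cj)
  moreover have "j \<circ> id \<circ> k = id" by (auto simp: kj)
  moreover have "(j \<circ> f \<circ> k) ` (j ` L) = j ` L'" using f(2) by (auto simp: image_comp kj)
  ultimately show ?thesis unfolding isotopic_def by metis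
qed

section \<open>Coordinates on three-space and motions extended from the link\<close>

definition cyl3 :: "complex \<times> real \<Rightarrow> real^3" where
  "cyl3 = (\<lambda>(w, z). vector [Re w, Im w, z])"

lemma cyl3_nth [simp]:
  "cyl3 (w, z) $ 1 = Re w" "cyl3 (w, z) $ 2 = Im w" "cyl3 (w, z) $ 3 = z"
  by (auto simp: cyl3_def)

lemma linear_cyl3: "linear cyl3"
  by (rule linearI) (auto simp: cyl3_def vec_eq_iff forall_3)

lemma homeomorphism_cyl3:
  "homeomorphism UNIV UNIV cyl3 (\<lambda>v. (Complex (v $ 1) (v $ 2), v $ 3))"
proof (rule homeomorphismI)
  show "continuous_on UNIV cyl3" by (simp add: linear_cyl3 linear_continuous_on linear_linear)
qed (auto simp: vec_eq_iff forall_3 complex_eq_iff Complex_eq intro!: continuous_intros)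

lemma ambient_isotopic_cyl3:
  assumes "isotopic L L'"
  shows "ambient_isotopic (cyl3 ` L) (cyl3 ` L')"
  using isotopic_homeomorphic_image[OF homeomorphism_cyl3 assms]
  by (simp add: isotopic_def ambient_isotopic_def)

text \<open>The index set is mapped onto the plane curve \<open>f\<close>, so a displacement \<open>d\<close> of the strands that
  agrees at the double points of \<open>f\<close> comes from a displacement of the whole plane.\<close>

lemma Tietze_factor:
  fixes f :: "'i::t2_space \<Rightarrow> 'b::{metric_space, second_countable_topology}" and d :: "'i \<Rightarrow> real"
  assumes I: "compact I" and f: "continuous_on I f" and d: "continuous_on I d"
    and wd: "\<And>i j. i \<in> I \<Longrightarrow> j \<in> I \<Longrightarrow> f i = f j \<Longrightarrow> d i = d j"
  obtains g B where "continuous_on UNIV g" "\<And>i. i \<in> I \<Longrightarrow> g (f i) = d i" "\<And>x. \<bar>g x\<bar> \<le> B"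
proof -
  define h where "h y = d (SOME i. i \<in> I \<and> f i = y)" for y
  have hf: "h (f i) = d i" if "i \<in> I" for i
  proof -
    have "(SOME j. j \<in> I \<and> f j = f i) \<in> I \<and> f (SOME j. j \<in> I \<and> f j = f i) = f i"
      by (rule someI) (use that in auto)
    then show ?thesis unfolding h_def using wd that by blast
  qed
  \<comment> \<open>On the compact \<open>I\<close> the map \<open>f\<close> is closed, so the
    preimages of closed sets under \<open>h\<close> are images of compact sets.\<close>
  have "continuous_on (f ` I) h"
  proof (rule continuous_on_closed_vimage[THEN iffD2, rule_format])
    show "closed (f ` I)" using I f by (simp add: compact_continuous_image compact_imp_closed)
    fix S :: "real set" assume "closed S"
    then have "closed (d -` S \<inter> I)"
      using continuous_on_closed_vimage[OF compact_imp_closed[OF I]] d by blast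
    then have "compact (d -` S \<inter> I)"
      by (metis compact_Int_closed I inf.left_idem inf_commute)
    moreover have "h -` S \<inter> f ` I = f ` (d -` S \<inter> I)" using hf by auto
    ultimately show "closed (h -` S \<inter> f ` I)"
      using f by (metis compact_continuous_image compact_imp_closed continuous_on_subset inf_le2)
  qed
  \<comment> \<open>The bound survives the extension; it keeps the scaling continuous at the
    axis.\<close>
  moreover obtain B where "0 \<le> B" "\<And>i. i \<in> I \<Longrightarrow> \<bar>d i\<bar> \<le> B"
    using compact_imp_bounded[OF compact_continuous_image[OF d I]]
    by (auto simp: bounded_pos intro: less_imp_le)
  moreover have "closedin (top_of_set UNIV) (f ` I)"
    using I f by (simp add: compact_continuous_image compact_imp_closed)
  ultimately obtain g where "continuous_on UNIV g" "\<And>y. y \<in> f ` I \<Longrightarrow> g y = h y" "\<And>y. norm (g y) \<le> B"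
    by (metis Tietze[of "f ` I" h UNIV B] hf imageE real_norm_def UNIV_I)
  then show thesis using hf by (intro that[of g B]) auto
qed

text \<open>Points over the same point of the plane move by the same amount, so none passes through
  another; this is what \<open>wd\<close> demands.\<close>

lemma isotopic_lift:
  fixes p :: "'i::t2_space \<Rightarrow> complex" and z z' :: "'i \<Rightarrow> real"
  assumes I: "compact I" and cont: "continuous_on I p" "continuous_on I z" "continuous_on I z'"
    and wd: "\<And>i j. i \<in> I \<Longrightarrow> j \<in> I \<Longrightarrow> p i = p j \<Longrightarrow> z' i - z i = z' j - z j"
  shows "isotopic ((\<lambda>i. (p i, z i)) ` I) ((\<lambda>i. (p i, z' i)) ` I)"
proof -
  obtain g B where g: "continuous_on UNIV g" "\<And>i. i \<in> I \<Longrightarrow> g (p i) = z' i - z i"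
    by (rule Tietze_factor[OF I, of p "\<lambda>i. z' i - z i"]) (auto intro!: continuous_intros cont wd)
  let ?F = "\<lambda>\<tau> (w, z). (w, z + \<tau> * g w)"
  have "continuous_on UNIV (\<lambda>(\<tau>, x). ?F \<tau> x)"
    by (auto simp: case_prod_unfold intro!: continuous_intros continuous_on_compose2[OF g(1)])
  then have "isotopic ((\<lambda>i. (p i, z i)) ` I) (?F 1 ` (\<lambda>i. (p i, z i)) ` I)"
    by (rule isotopic_flow) auto
  moreover have "?F 1 ` (\<lambda>i. (p i, z i)) ` I = (\<lambda>i. (p i, z' i)) ` I"
    by (auto simp: image_image g(2) intro!: image_cong)
  ultimately show ?thesis by simp
qed

text \<open>Serves the flip of the closing arc: points move parallel to the imaginary axis, at fixed
  real part and height.\<close>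

lemma isotopic_shear:
  fixes p :: "'i::t2_space \<Rightarrow> complex" and z k :: "'i \<Rightarrow> real"
  assumes I: "compact I" and cont: "continuous_on I p" "continuous_on I z" "continuous_on I k"
    and wd: "\<And>i j. i \<in> I \<Longrightarrow> j \<in> I \<Longrightarrow> Re (p i) = Re (p j) \<Longrightarrow> z i = z j \<Longrightarrow> k i = k j"
  shows "isotopic ((\<lambda>i. (p i, z i)) ` I) ((\<lambda>i. (p i + \<i> * of_real (k i), z i)) ` I)"
proof -
  obtain g B where g: "continuous_on UNIV g" "\<And>i. i \<in> I \<Longrightarrow> g (Re (p i), z i) = k i"
    by (rule Tietze_factor[OF I, of "\<lambda>i. (Re (p i), z i)" k]) (auto intro!: continuous_intros cont wd)
  let ?F = "\<lambda>\<tau> (w, z). (w + \<i> * of_real (\<tau> * g (Re w, z)), z)"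
  have "continuous_on UNIV (\<lambda>(\<tau>, x). ?F \<tau> x)"
    by (auto simp: case_prod_unfold intro!: continuous_intros continuous_on_compose2[OF g(1)])
  then have "isotopic ((\<lambda>i. (p i, z i)) ` I) (?F 1 ` (\<lambda>i. (p i, z i)) ` I)"
    by (rule isotopic_flow) auto
  moreover have "?F 1 ` (\<lambda>i. (p i, z i)) ` I = (\<lambda>i. (p i + \<i> * of_real (k i), z i)) ` I"
    by (auto simp: image_image g(2) intro!: image_cong)
  ultimately show ?thesis by simp
qed

lemma isotopic_twist:
  fixes p :: "'i::t2_space \<Rightarrow> complex" and z a :: "'i \<Rightarrow> real"
  assumes I: "compact I" and cont: "continuous_on I p" "continuous_on I z" "continuous_on I a"
    and wd: "\<And>i j. i \<in> I \<Longrightarrow> j \<in> I \<Longrightarrow> cmod (p i) = cmod (p j) \<Longrightarrow> z i = z j \<Longrightarrow> a i = a j"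
  shows "isotopic ((\<lambda>i. (p i, z i)) ` I) ((\<lambda>i. (p i * cis (a i), z i)) ` I)"
proof -
  obtain g B where g: "continuous_on UNIV g" "\<And>i. i \<in> I \<Longrightarrow> g (cmod (p i), z i) = a i"
    by (rule Tietze_factor[OF I, of "\<lambda>i. (cmod (p i), z i)" a]) (auto intro!: continuous_intros cont wd)
  let ?F = "\<lambda>\<tau> (w, z). (w * cis (\<tau> * g (cmod w, z)), z)"
  have "continuous_on UNIV (\<lambda>(\<tau>, x). ?F \<tau> x)"
    by (auto simp: case_prod_unfold intro!: continuous_intros continuous_on_compose2[OF g(1)])
  then have "isotopic ((\<lambda>i. (p i, z i)) ` I) (?F 1 ` (\<lambda>i. (p i, z i)) ` I)"
    by (rule isotopic_flow) (auto simp: norm_mult mult.assoc cis_mult)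
  moreover have "?F 1 ` (\<lambda>i. (p i, z i)) ` I = (\<lambda>i. (p i * cis (a i), z i)) ` I"
    by (auto simp: image_image g(2) intro!: image_cong)
  ultimately show ?thesis by simp
qed

text \<open>The factor \<open>exp (k (sgn w, z))\<close> is discontinuous at the axis, but it is bounded there.\<close>

lemma isotopic_scale:
  fixes p :: "'i::t2_space \<Rightarrow> complex" and z k :: "'i \<Rightarrow> real"
  assumes I: "compact I" and cont: "continuous_on I p" "continuous_on I z" "continuous_on I k"
    and p: "\<And>i. i \<in> I \<Longrightarrow> p i \<noteq> 0"
    and wd: "\<And>i j. i \<in> I \<Longrightarrow> j \<in> I \<Longrightarrow> sgn (p i) = sgn (p j) \<Longrightarrow> z i = z j \<Longrightarrow> k i = k j"
  shows "isotopic ((\<lambda>i. (p i, z i)) ` I) ((\<lambda>i. (p i * of_real (exp (k i)), z i)) ` I)"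
proof -
  have sgn_p: "continuous_on I (\<lambda>i. sgn (p i))"
    unfolding sgn_div_norm by (intro continuous_intros cont) (use p in auto)
  obtain g B where g: "continuous_on UNIV g" "\<And>i. i \<in> I \<Longrightarrow> g (sgn (p i), z i) = k i"
      "\<And>x. \<bar>g x\<bar> \<le> B"
    by (rule Tietze_factor[OF I, of "\<lambda>i. (sgn (p i), z i)" k])
       (auto intro!: continuous_intros cont wd sgn_p)
  let ?E = "\<lambda>(\<tau>, w :: complex, z). w * of_real (exp (\<tau> * g (sgn w, z)))"
  let ?F = "\<lambda>\<tau> (w, z). (?E (\<tau>, w, z), z)"
  have "isCont ?E (\<tau>, w, z)" for \<tau> w z
  proof (cases "w = 0")
    case False
    let ?U = "(UNIV :: real set) \<times> (- {0 :: complex}) \<times> (UNIV :: real set)"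
    have "continuous_on ?U (\<lambda>x. sgn (fst (snd x)))"
      unfolding sgn_div_norm by (intro continuous_intros) auto
    then have "continuous_on ?U ?E"
      by (auto simp: case_prod_unfold intro!: continuous_intros continuous_on_compose2[OF g(1)])
    moreover have "open ?U" by (intro open_Times) auto
    ultimately have "\<forall>x\<in>?U. isCont ?E x" by (simp only: continuous_on_eq_continuous_at[of ?U ?E])
    then show ?thesis using False by blast
  next
    case True
    have "(?E \<longlongrightarrow> 0) (at (\<tau>, w, z))"
    proof (rule Lim_null_comparison)
      show "\<forall>\<^sub>F x in at (\<tau>, w, z). norm (?E x) \<le> cmod (fst (snd x)) * exp (\<bar>fst x\<bar> * \<bar>B\<bar>)"
      proof (rule always_eventually, rule allI)
        fix x :: "real \<times> complex \<times> real"
        have "fst x * g y \<le> \<bar>fst x\<bar> * \<bar>B\<bar>" for y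
          by (rule order_trans[OF abs_ge_self]) (use g(3)[of y] in \<open>auto simp: abs_mult intro!: mult_left_mono\<close>)
        then show "norm (?E x) \<le> cmod (fst (snd x)) * exp (\<bar>fst x\<bar> * \<bar>B\<bar>)"
          by (auto simp: case_prod_unfold norm_mult intro!: mult_left_mono)
      qed
      show "((\<lambda>x. cmod (fst (snd x)) * exp (\<bar>fst x\<bar> * \<bar>B\<bar>)) \<longlongrightarrow> 0) (at (\<tau>, w, z))"
        by (rule tendsto_eq_rhs, (rule tendsto_intros)+) (use True in auto)
    qed
    then show ?thesis using True by (simp add: isCont_def)
  qed
  then have "continuous_on UNIV ?E" by (auto intro!: continuous_at_imp_continuous_on)
  then have "continuous_on UNIV (\<lambda>(\<tau>, x). ?F \<tau> x)"
    by (auto simp: case_prod_unfold intro!: continuous_intros)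
  then have "isotopic ((\<lambda>i. (p i, z i)) ` I) (?F 1 ` (\<lambda>i. (p i, z i)) ` I)"
    by (rule isotopic_flow)
       (auto simp: sgn_mult sgn_of_real mult.assoc simp flip: of_real_mult exp_add)
  moreover have "?F 1 ` (\<lambda>i. (p i, z i)) ` I = (\<lambda>i. (p i * of_real (exp (k i)), z i)) ` I"
    by (auto simp: image_image g(2) intro!: image_cong)
  ultimately show ?thesis by simp
qed

text \<open>The coordinate \<open>(w, u)\<close> on the solid torus around the circle of radius 2, with \<open>u\<close> on the unit
  circle and \<open>cmod w < 3/2\<close>; the rotation of the fibres fades out before it reaches the axis.\<close>

lemma isotopic_fibre_rotation:
  fixes u w :: "'i::t2_space \<Rightarrow> complex" and a :: "'i \<Rightarrow> real"
  assumes I: "compact I" and cont: "continuous_on I u" "continuous_on I a"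
    and u: "\<And>i. i \<in> I \<Longrightarrow> cmod (u i) = 1" and w: "\<And>i. i \<in> I \<Longrightarrow> cmod (w i) \<le> 1"
    and wd: "\<And>i j. i \<in> I \<Longrightarrow> j \<in> I \<Longrightarrow> u i = u j \<Longrightarrow> a i = a j"
  shows "isotopic ((\<lambda>i. (of_real (2 + Re (w i)) * u i, Im (w i))) ` I)
     ((\<lambda>i. (of_real (2 + Re (w i * cis (a i))) * u i, Im (w i * cis (a i)))) ` I)"
proof -
  obtain g B where g: "continuous_on UNIV g" "\<And>i. i \<in> I \<Longrightarrow> g (u i) = a i"
    by (rule Tietze_factor[OF I cont wd]) metis+
  \<comment> \<open>The cutoff is 1 where the link lies and 0 from 3/2 on; the core has radius 2, so
    the moving region stays at distance 1/2 from the axis.\<close>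
  define b where "b w = max 0 (min 1 (3 - 2 * cmod w))" for w :: complex
  have b: "b w = 1" if "cmod w \<le> 1" for w using that by (auto simp: b_def)
  define W where "W = (\<lambda>(p, z). Complex (cmod p - 2) z)"
  define V where "V = (\<lambda>\<tau> (p, z). W (p, z) * cis (\<tau> * (g (sgn p) * b (W (p, z)))))"
  define F where "F = (\<lambda>\<tau> (p, z). (of_real (2 + Re (V \<tau> (p, z))) * sgn p, Im (V \<tau> (p, z))))"
  \<comment> \<open>The second alternative is a point of the axis: there \<open>W\<close> has real
    part -2, outside the cutoff, so the point stays fixed.\<close>
  have pos: "(2 + Re (V \<tau> (p, z)) > 0 \<and> p \<noteq> 0) \<or> (p = 0 \<and> 2 + Re (V \<tau> (p, z)) = 0)" for \<tau> p z
  proof (cases "b (W (p, z)) = 0")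
    case True
    then show ?thesis by (auto simp: V_def W_def)
  next
    case False
    then have "cmod (W (p, z)) < 3/2" by (auto simp: b_def)
    then have "cmod (V \<tau> (p, z)) < 3/2" by (simp add: V_def norm_mult)
    moreover have "p \<noteq> 0"
      using \<open>cmod (W (p, z)) < 3/2\<close> abs_Re_le_cmod[of "W (p, z)"] by (auto simp: W_def)
    ultimately show ?thesis using abs_Re_le_cmod[of "V \<tau> (p, z)"] by linarith
  qed
  have sgnF: "sgn (fst (F \<tau> (p, z))) = sgn p" for \<tau> p z
    using pos[of \<tau> p z]
    by (auto simp: F_def sgn_mult sgn_of_real simp del: of_real_add)
  have WF: "W (F \<tau> (p, z)) = V \<tau> (p, z)" for \<tau> p z
  proof -
    have "cmod (fst (F \<tau> (p, z))) = 2 + Re (V \<tau> (p, z))"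
      using pos[of \<tau> p z] by (auto simp: F_def norm_mult norm_sgn simp del: of_real_add)
    then show ?thesis by (simp add: W_def F_def complex_eq_iff)
  qed
  \<comment> \<open>The motion preserves \<open>sgn p\<close> and \<open>cmod (W (p, z))\<close>, so
    each point turns at constant speed and \<open>F (-\<tau>)\<close> undoes
    \<open>F \<tau>\<close>.\<close>
  have bV: "b (V \<tau> x) = b (W x)" for \<tau> x by (auto simp: b_def V_def norm_mult split: prod.splits)
  have W0: "(of_real (2 + Re (W (p, z))) * sgn p, Im (W (p, z))) = (p, z)" for p z
    by (cases "p = 0") (simp_all add: W_def sgn_eq)
  have F0: "F \<tau> (p, z) = (p, z)" if "V \<tau> (p, z) = W (p, z)" for \<tau> p z
    unfolding F_def prod.case that by (rule W0)
  have VF: "V \<tau>' (F \<tau> (p, z)) = W (p, z) * cis ((\<tau> + \<tau>') * (g (sgn p) * b (W (p, z))))" for \<tau> \<tau>' p z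
  proof -
    have "V \<tau>' (F \<tau> (p, z)) = W (F \<tau> (p, z)) * cis (\<tau>' * (g (sgn (fst (F \<tau> (p, z)))) * b (W (F \<tau> (p, z)))))"
      by (simp add: V_def case_prod_unfold)
    also have "\<dots> = V \<tau> (p, z) * cis (\<tau>' * (g (sgn p) * b (W (p, z))))"
      by (simp only: WF sgnF bV)
    also have "\<dots> = W (p, z) * cis ((\<tau> + \<tau>') * (g (sgn p) * b (W (p, z))))"
      by (simp add: V_def mult.assoc cis_mult distrib_right)
    finally show ?thesis .
  qed
  have "continuous_on UNIV (\<lambda>(\<tau>, x). F \<tau> x)"
  proof -
    \<comment> \<open>Away from the axis \<open>sgn\<close> is continuous, and outside the torus
      \<open>F\<close> fixes every point; these two closed sets cover the space.\<close>
    let ?A = "{(\<tau>::real, p::complex, z::real). cmod p \<ge> 1/2}"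
      and ?B = "{(\<tau>::real, p::complex, z::real). cmod (W (p, z)) \<ge> 3/2}"
    have cW: "continuous_on S (\<lambda>x. W (f x))" if "continuous_on S f" for S and f :: "'z::topological_space \<Rightarrow> _"
      unfolding W_def case_prod_unfold Complex_eq by (intro continuous_intros that)
    have "continuous_on ?A (\<lambda>x. sgn (fst (snd x)))"
      unfolding sgn_div_norm by (intro continuous_intros) auto
    then have "continuous_on ?A (\<lambda>(\<tau>, x). F \<tau> x)"
      unfolding F_def V_def b_def case_prod_unfold
      by (intro continuous_intros cW continuous_on_compose2[OF g(1)]) auto
    moreover have "continuous_on ?B (\<lambda>(\<tau>, x). F \<tau> x) \<longleftrightarrow> continuous_on ?B snd"
      by (intro continuous_on_cong) (auto simp: V_def b_def intro!: F0)
    then have "continuous_on ?B (\<lambda>(\<tau>, x). F \<tau> x)" by (simp add: continuous_on_snd)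
    moreover have "closed ?A" "closed ?B"
      unfolding case_prod_unfold by (intro closed_Collect_le continuous_intros cW)+
    ultimately have "continuous_on (?A \<union> ?B) (\<lambda>(\<tau>, x). F \<tau> x)"
      by (intro continuous_on_closed_Un)
    moreover have "?A \<union> ?B = UNIV"
    proof -
      have "cmod (W (p, z)) \<ge> 3/2" if "\<not> cmod p \<ge> 1/2" for p z
        using that abs_Re_le_cmod[of "W (p, z)"] by (simp add: W_def)
      then show ?thesis by auto
    qed
    ultimately show ?thesis by simp
  qed
  moreover have "F 0 x = x" for x using F0[of 0 "fst x" "snd x"] by (simp add: V_def case_prod_unfold)
  moreover have "F (-\<tau>) (F \<tau> x) = x" for \<tau> x
  proof -
    obtain p z where x: "x = (p, z)" by (cases x)
    have "V (-\<tau>) (F \<tau> (p, z)) = W (p, z)" using VF[of "-\<tau>" \<tau> p z] by simp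
    then have "F (-\<tau>) (F \<tau> (p, z)) = (of_real (2 + Re (W (p, z))) * sgn p, Im (W (p, z)))"
      using sgnF[of \<tau> p z] by (subst F_def) (simp add: case_prod_unfold)
    also have "\<dots> = (p, z)" by (rule W0)
    finally show ?thesis by (simp add: x)
  qed
  ultimately have iso: "isotopic L (F 1 ` L)" for L by (intro isotopic_flow)
  have "F 1 (of_real (2 + Re (w i)) * u i, Im (w i)) =
      (of_real (2 + Re (w i * cis (a i))) * u i, Im (w i * cis (a i)))" if i: "i \<in> I" for i
  proof -
    have pos: "2 + Re (w i) > 0" using abs_Re_le_cmod[of "w i"] w[OF i] by linarith
    let ?p = "of_real (2 + Re (w i)) * u i"
    have sgn: "sgn ?p = u i"
      using pos sgn_eq[of "u i"] u[OF i] by (simp add: sgn_mult sgn_of_real del: of_real_add)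
    have "cmod ?p = 2 + Re (w i)" using pos u[OF i] by (simp add: norm_mult del: of_real_add)
    then have W: "W (?p, Im (w i)) = w i" by (simp add: W_def complex_eq_iff)
    show ?thesis
      unfolding F_def V_def prod.case W sgn g(2)[OF i] b[OF w[OF i]] mult_1 mult_1_right ..
  qed
  then have "F 1 ` (\<lambda>i. (of_real (2 + Re (w i)) * u i, Im (w i))) ` I =
     (\<lambda>i. (of_real (2 + Re (w i * cis (a i))) * u i, Im (w i * cis (a i)))) ` I"
    unfolding image_image by (intro image_cong refl)
  then show ?thesis
    using iso[of "(\<lambda>i. (of_real (2 + Re (w i)) * u i, Im (w i))) ` I"] by (simp only:)
qed

section \<open>The torus link in cylindrical coordinates\<close>

definition torus_point :: "nat \<Rightarrow> real \<Rightarrow> int \<Rightarrow> complex \<times> real" where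
  "torus_point t \<theta> j =
     (of_real (2 + cos (t * \<theta> / 2 + pi * j)) * cis \<theta>, - sin (t * \<theta> / 2 + pi * j))"

lemma cos_add_pi_int: "cos (x + pi * of_int j) = (if even j then cos x else - cos x)"
  and sin_add_pi_int: "sin (x + pi * of_int j) = (if even j then sin x else - sin x)"
proof -
  have "cos (pi * of_int j) = (if even j then 1 else - 1)" "sin (pi * of_int j) = 0"
    by (cases "even j"; auto elim!: evenE oddE simp: cos_add sin_add algebra_simps
      cos_int_2pin sin_int_2pin simp flip: mult.assoc)+
  then show "cos (x + pi * of_int j) = (if even j then cos x else - cos x)"
    "sin (x + pi * of_int j) = (if even j then sin x else - sin x)"
    by (auto simp: cos_add sin_add)
qed

lemma torus_point_cong: "even (j - j') \<Longrightarrow> torus_point t \<theta> j = torus_point t \<theta> j'"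
  by (auto simp: torus_point_def cos_add_pi_int sin_add_pi_int)

lemma cis_add_2pi_int: "cis (x + 2 * pi * of_int m) = cis x"
  using cis_multiple_2pi[of "of_int m"] by (simp add: mult.assoc flip: cis_mult)

text \<open>A full turn about the axis adds \<open>t\<close> half turns in the fibre. Strand numbers
  that are integers, read modulo 2, absorb them for both parities of \<open>t\<close>.\<close>

lemma torus_point_shift: "torus_point t (\<theta> + 2 * pi * of_int m) j = torus_point t \<theta> (j + t * m)"
proof -
  have *: "t * (\<theta> + 2 * pi * of_int m) / 2 + pi * j = t * \<theta> / 2 + pi * of_int (j + t * m)"
    by (simp add: field_simps)
  show ?thesis unfolding torus_point_def * cis_add_2pi_int ..
qed

lemma ex_in_period: "\<exists>m::int. \<theta> - 2 * pi * of_int m \<in> {\<theta>0..<\<theta>0 + 2 * pi}"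
proof
  define x where "x = (\<theta> - \<theta>0) / (2 * pi)"
  have "of_int \<lfloor>x\<rfloor> \<le> x" "x < of_int \<lfloor>x\<rfloor> + 1" by linarith+
  then have "2 * pi * of_int \<lfloor>x\<rfloor> \<le> 2 * pi * x" "2 * pi * x < 2 * pi * (of_int \<lfloor>x\<rfloor> + 1)"
    by (auto intro!: mult_left_mono mult_strict_left_mono)
  moreover have "2 * pi * x = \<theta> - \<theta>0" by (simp add: x_def)
  ultimately show "\<theta> - 2 * pi * of_int \<lfloor>(\<theta> - \<theta>0) / (2 * pi)\<rfloor> \<in> {\<theta>0..<\<theta>0 + 2 * pi}"
    unfolding x_def[symmetric] by (simp add: distrib_left)
qed

lemma torus_points_period:
  "(\<lambda>(\<theta>, i). torus_point t \<theta> (int i)) ` ({\<theta>0..\<theta>0 + 2 * pi} \<times> {..<2::nat})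
     = {torus_point t \<theta> j | \<theta> j. True}" (is "?L = ?R")
proof
  show "?R \<subseteq> ?L"
  proof
    fix x assume "x \<in> ?R"
    then obtain \<theta> j where x: "x = torus_point t \<theta> j" by blast
    obtain m where m: "\<theta> - 2 * pi * of_int m \<in> {\<theta>0..<\<theta>0 + 2 * pi}"
      using ex_in_period by blast
    have "x = torus_point t (\<theta> - 2 * pi * of_int m) (j + t * m)"
      using torus_point_shift[of t "\<theta> - 2 * pi * of_int m" m j] by (simp add: x)
    also have "\<dots> = torus_point t (\<theta> - 2 * pi * of_int m) (int (nat ((j + t * m) mod 2)))"
      by (rule torus_point_cong) (simp add: minus_mod_eq_mult_div)
    finally show "x \<in> ?L"
      using m by (intro image_eqI[of _ _ "(\<theta> - 2 * pi * of_int m, nat ((j + t * m) mod 2))"])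
        (auto simp: nat_less_iff)
  qed
qed auto

text \<open>Height \<open>h\<close> in the cylinder becomes the angle \<open>2 * pi * h\<close>, and
  the \<open>t\<close> stacked half twists form one double helix with fibre angle
  \<open>pi * t * h\<close>.\<close>

lemma torus_link2_eq:
  assumes "t > 0"
  shows "torus_link2 t = cyl3 ` {torus_point t \<theta> j | \<theta> j. True}"
proof -
  have pt: "vector [(2 + Re w) * cos (2 * pi * h), (2 + Re w) * sin (2 * pi * h), - Im w] =
      cyl3 (torus_point t (2 * pi * h) j)" if "w = cis (pi * (t * h + of_int j))" for w :: complex and h :: real and j
    using that by (auto simp: torus_point_def cyl3_def algebra_simps)
  \<comment> \<open>In copy number \<open>k\<close> the helix has already made \<open>k\<close> half
    turns, so the names of the strands persist only up to the parity of \<open>k\<close>.\<close>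
  have half: "cis (pi * s) = cis (pi * (real k + s + of_int (- int k)))"
    "- cis (pi * s) = cis (pi * (real k + s + of_int (1 - int k)))" for s k
  proof -
    have "pi * (real k + s + of_int j) = pi * s + pi * of_int (int k + j)" for j
      by (simp add: algebra_simps)
    then show "cis (pi * s) = cis (pi * (real k + s + of_int (- int k)))"
      "- cis (pi * s) = cis (pi * (real k + s + of_int (1 - int k)))"
      by (simp_all only: complex_eq_iff cos_add_pi_int sin_add_pi_int cis.sel uminus_complex.sel) simp_all
  qed
  show ?thesis
  proof (intro subset_antisym subsetI)
    fix v assume "v \<in> torus_link2 t"
    then obtain w h where wh: "(w, h) \<in> braid_power sigma1 t"
      and v: "v = vector [(2 + Re w) * cos (2 * pi * h), (2 + Re w) * sin (2 * pi * h), - Im w]"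
      unfolding torus_link2_def braid_closure_def by auto
    then obtain s k where h: "h = (real k + s) / t" and w: "w = cis (pi * s) \<or> w = - cis (pi * s)"
      unfolding braid_power_def sigma1_def by auto
    from w half[of s k] obtain j where "w = cis (pi * (real k + s + of_int j))" by metis
    then have "w = cis (pi * (t * h + of_int j))" using assms by (simp add: h)
    from v pt[OF this] have "v = cyl3 (torus_point t (2 * pi * h) j)" by (rule trans)
    then show "v \<in> cyl3 ` {torus_point t \<theta> j | \<theta> j. True}" by blast
  next
    fix v assume "v \<in> cyl3 ` {torus_point t \<theta> j | \<theta> j. True}"
    then obtain \<theta> i where v: "v = cyl3 (torus_point t \<theta> (int i))" and \<theta>: "\<theta> \<in> {0..2 * pi}" and "i < 2"
      unfolding torus_points_period[of t 0, symmetric] by auto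
    define h where "h = \<theta> / (2 * pi)"
    define x where "x = t * h"
    have h: "0 \<le> h" "h \<le> 1" "\<theta> = 2 * pi * h" using \<theta> by (auto simp: h_def field_simps)
    then have x: "0 \<le> x" "x \<le> t" by (auto simp: x_def mult_left_le)
    \<comment> \<open>The top \<open>x = t\<close> belongs to the last copy, with
      \<open>s = 1\<close>; there is no copy number \<open>t\<close>.\<close>
    define k where "k = (if x = t then t - 1 else nat \<lfloor>x\<rfloor>)"
    define s where "s = x - k"
    have ks: "k < t" "s \<in> {0..1}" "x = real k + s"
      using x assms by (auto simp: k_def s_def of_nat_diff nat_less_iff) linarith+
    define w where "w = cis (pi * (x + i))"
    have i: "i = 0 \<or> i = 1" using \<open>i < 2\<close> by auto
    have "w = cis (pi * s) \<or> w = - cis (pi * s)"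
    proof -
      have "w = cis (pi * s) * cis (pi * of_int (int k + int i))"
        by (simp add: w_def ks(3) cis_mult algebra_simps)
      moreover have "cis (pi * of_int j) = 1 \<or> cis (pi * of_int j) = - 1" for j
        using cos_add_pi_int[of 0 j] sin_add_pi_int[of 0 j] by (auto simp: complex_eq_iff split: if_splits)
      ultimately show ?thesis by (metis mult.right_neutral mult_minus_right)
    qed
    then have "(w, h) \<in> braid_power sigma1 t"
      unfolding braid_power_def sigma1_def using ks assms
      by (auto simp: x_def field_simps intro!: exI[of _ s] exI[of _ k])
    moreover have "v = vector [(2 + Re w) * cos (2 * pi * h), (2 + Re w) * sin (2 * pi * h), - Im w]"
      unfolding v h(3) by (rule pt[symmetric]) (simp add: w_def x_def)
    ultimately show "v \<in> torus_link2 t"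
      by (auto simp: torus_link2_def braid_closure_def intro!: image_eqI[of _ _ "(w, h)"])
  qed
qed

lemma continuous_on_two_strands:
  fixes f :: "nat \<Rightarrow> real \<Rightarrow> 'b::topological_space"
  assumes "\<And>i. i < 2 \<Longrightarrow> continuous_on {a..b} (f i)"
  shows "continuous_on ({a..b} \<times> {..<2}) (\<lambda>(\<theta>, i). f i \<theta>)"
proof -
  have *: "continuous_on ({a..b} \<times> {i}) (\<lambda>(\<theta>, i). f i \<theta>)" if "i < 2" for i :: nat
  proof -
    have "continuous_on ({a..b} \<times> {i}) (\<lambda>x. f i (fst x))"
      by (rule continuous_on_compose2[OF assms[OF that]]) (auto intro!: continuous_intros)
    then show ?thesis by (rule continuous_on_eq) auto
  qed
  have "closed ({a..b} \<times> {i})" for i :: nat by (intro closed_Times) auto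
  then have "continuous_on ({a..b} \<times> {0::nat} \<union> {a..b} \<times> {1}) (\<lambda>(\<theta>, i). f i \<theta>)"
    by (intro continuous_on_closed_Un *) auto
  moreover have "{a..b} \<times> {0::nat} \<union> {a..b} \<times> {1} = {a..b} \<times> {..<2}" by (auto simp: less_2_cases_iff)
  ultimately show ?thesis by simp
qed

lemma cis_eq_period:
  assumes "cis \<theta> = cis \<theta>'" "\<theta> \<in> {a..a + 2 * pi}" "\<theta>' \<in> {a..a + 2 * pi}"
  shows "\<theta> = \<theta>' \<or> (\<theta> = a \<and> \<theta>' = a + 2 * pi) \<or> (\<theta>' = a \<and> \<theta> = a + 2 * pi)"
proof -
  have "cos \<theta> = cos \<theta>'" "sin \<theta> = sin \<theta>'" using assms(1) by (auto simp: complex_eq_iff)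
  then obtain n :: int where n: "\<theta> = \<theta>' + 2 * pi * n" using sin_cos_eq_iff by metis
  then have "\<bar>2 * pi * n\<bar> \<le> 2 * pi" using assms by auto
  then have "\<bar>n\<bar> \<le> 1" by (simp add: abs_mult)
  then have "n = 0 \<or> n = 1 \<or> n = -1" by auto
  then show ?thesis using n assms(2,3) by auto
qed

text \<open>A fibre rotation first replaces the angle \<open>t \<theta> / 2\<close> by \<open>\<beta> \<theta>\<close>; a lift, a scaling and a twist then
  set the height, the radius and the angular position. A lift has to agree on both strands only where
  one lies over the other, which is when \<open>cos (\<beta> \<theta>) = 0\<close>, and a scaling only where they have the
  same height and direction.\<close>

lemma braid_closed_isotopic:
  fixes r z \<phi> :: "nat \<Rightarrow> real \<Rightarrow> real" and \<beta> :: "real \<Rightarrow> real" and \<theta>0 :: real and t :: nat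
  defines "J \<equiv> {\<theta>0..\<theta>0 + 2 * pi}"
  assumes cont: "\<And>i. i < 2 \<Longrightarrow> continuous_on J (r i)" "\<And>i. i < 2 \<Longrightarrow> continuous_on J (z i)"
      "\<And>i. i < 2 \<Longrightarrow> continuous_on J (\<phi> i)" "continuous_on J \<beta>"
    and r_pos: "\<And>i \<theta>. i < 2 \<Longrightarrow> \<theta> \<in> J \<Longrightarrow> r i \<theta> > 0"
    and \<beta>_end: "\<beta> (\<theta>0 + 2 * pi) = \<beta> \<theta>0 + t * pi"
    and r_end: "\<And>i. i < 2 \<Longrightarrow> r i (\<theta>0 + 2 * pi) = r ((i + t) mod 2) \<theta>0"
    and z_end: "\<And>i. i < 2 \<Longrightarrow> z i (\<theta>0 + 2 * pi) = z ((i + t) mod 2) \<theta>0"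
    and vertical: "\<And>\<theta>. \<theta> \<in> J \<Longrightarrow> cos (\<beta> \<theta>) = 0 \<Longrightarrow> z 0 \<theta> - z 1 \<theta> = - 2 * sin (\<beta> \<theta>)"
    and horizontal: "\<And>\<theta>. \<theta> \<in> J \<Longrightarrow> z 0 \<theta> = z 1 \<theta> \<Longrightarrow> r 0 \<theta> * (2 - cos (\<beta> \<theta>)) = r 1 \<theta> * (2 + cos (\<beta> \<theta>))"
    and twist: "\<And>i j \<theta> \<theta>'. i < 2 \<Longrightarrow> j < 2 \<Longrightarrow> \<theta> \<in> J \<Longrightarrow> \<theta>' \<in> J \<Longrightarrow> r i \<theta> = r j \<theta>' \<Longrightarrow>
        z i \<theta> = z j \<theta>' \<Longrightarrow> \<phi> i \<theta> - \<theta> = \<phi> j \<theta>' - \<theta>'"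
  shows "isotopic {torus_point t \<theta> j | \<theta> j. True}
    ((\<lambda>(\<theta>, i). (of_real (r i \<theta>) * cis (\<phi> i \<theta>), z i \<theta>)) ` (J \<times> {..<2}))"
proof -
  define I where "I = J \<times> {..<2::nat}"
  have I: "compact I" unfolding I_def J_def by (intro compact_Times) (auto intro: finite_imp_compact)
  note two = continuous_on_two_strands[of "\<theta>0" "\<theta>0 + 2 * pi", folded J_def I_def]
  define C where "C i \<theta> = cos (\<beta> \<theta> + pi * of_int (int i))" for i \<theta>
  define S where "S i \<theta> = sin (\<beta> \<theta> + pi * of_int (int i))" for i \<theta>
  have contC: "continuous_on J (C i)" "continuous_on J (S i)" for i
    unfolding C_def S_def by (intro continuous_intros cont)+
  have cI: "continuous_on I (\<lambda>(\<theta>, i). C i \<theta>)" "continuous_on I (\<lambda>(\<theta>, i). S i \<theta>)"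
    "continuous_on I (\<lambda>(\<theta>, i). r i \<theta>)" "continuous_on I (\<lambda>(\<theta>, i). z i \<theta>)" "continuous_on I (\<lambda>(\<theta>, i). \<phi> i \<theta>)"
    by (intro two cont contC; assumption)+
  have cfst: "continuous_on I (\<lambda>(\<theta>, i). \<theta>)" "continuous_on I (\<lambda>(\<theta>, i). cis \<theta>)" "continuous_on I (\<lambda>(\<theta>, i). \<beta> \<theta>)"
    by (intro two cont continuous_intros)+
  \<comment> \<open>The data of the two strands match after one turn, with the strands exchanged if
    \<open>t\<close> is odd.\<close>
  define closing :: "(nat \<Rightarrow> real \<Rightarrow> real) \<Rightarrow> bool"
    where "closing f \<longleftrightarrow> (\<forall>i<2. f i (\<theta>0 + 2 * pi) = f ((i + t) mod 2) \<theta>0)" for f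
  have CS_shift: "C i (\<theta>0 + 2 * pi) = C ((i + t) mod 2) \<theta>0" "S i (\<theta>0 + 2 * pi) = S ((i + t) mod 2) \<theta>0" for i
  proof -
    have *: "\<beta> (\<theta>0 + 2 * pi) + pi * of_int (int i) = \<beta> \<theta>0 + pi * of_int (int (i + t))"
      using \<beta>_end by (simp add: algebra_simps)
    show "C i (\<theta>0 + 2 * pi) = C ((i + t) mod 2) \<theta>0" "S i (\<theta>0 + 2 * pi) = S ((i + t) mod 2) \<theta>0"
      unfolding C_def S_def * cos_add_pi_int sin_add_pi_int by simp_all
  qed
  have closing: "closing r" "closing z" "closing C" "closing S"
    using r_end z_end CS_shift by (auto simp: closing_def)
  \<comment> \<open>Equal directions mean equal angles or the two ends of the period. In the latter
    case the closing conditions express both strands at the single angle \<theta>, so compatibility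
    has to be checked at one angle only.\<close>
  have partner: "\<exists>j'<2. \<forall>f. closing f \<longrightarrow> f j \<theta>' = f j' \<theta>"
    if "\<theta> \<in> J" "\<theta>' \<in> J" "cis \<theta> = cis \<theta>'" "j < 2" for \<theta> \<theta>' j
  proof -
    have mm: "((j + t) mod 2 + t) mod 2 = j" using \<open>j < 2\<close> by presburger
    show ?thesis
      using cis_eq_period[OF that(3) that(1,2)[unfolded J_def]]
    proof (elim disjE conjE)
      assume "\<theta> = \<theta>'" then show ?thesis using \<open>j < 2\<close> by blast
    next
      assume "\<theta> = \<theta>0" "\<theta>' = \<theta>0 + 2 * pi"
      then show ?thesis using \<open>j < 2\<close> by (intro exI[of _ "(j + t) mod 2"]) (auto simp: closing_def)
    next
      assume "\<theta>' = \<theta>0" "\<theta> = \<theta>0 + 2 * pi"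
      then show ?thesis using mm by (intro exI[of _ "(j + t) mod 2"]) (auto simp: closing_def)
    qed
  qed
  have C01: "C 0 \<theta> = cos (\<beta> \<theta>)" "C 1 \<theta> = - cos (\<beta> \<theta>)" "S 0 \<theta> = sin (\<beta> \<theta>)" "S 1 \<theta> = - sin (\<beta> \<theta>)"
    "C (Suc 0) \<theta> = - cos (\<beta> \<theta>)" "S (Suc 0) \<theta> = - sin (\<beta> \<theta>)" for \<theta>
    by (auto simp: C_def S_def)
  have C_pos: "2 + C i \<theta> > 0" for i \<theta>
    unfolding C_def using cos_ge_minus_one[of "\<beta> \<theta> + pi * of_int (int i)"] by linarith
  have polar: "sgn (of_real x * cis \<theta>) = cis \<theta>" "cmod (of_real x * cis \<theta>) = x" if "x > 0" for x \<theta>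
    using that by (simp_all add: sgn_mult sgn_of_real norm_mult sgn_cis)

  \<comment> \<open>The conjugate matches the minus sign in the height of
    \<open>torus_point\<close>.\<close>
  define w where "w = (\<lambda>(\<theta>::real, i::nat). cnj (cis (t * \<theta> / 2 + pi * of_int (int i))))"
  define a where "a = (\<lambda>(\<theta>::real, i::nat). t * \<theta> / 2 - \<beta> \<theta>)"
  have "isotopic ((\<lambda>i. (of_real (2 + Re (w i)) * cis (fst i), Im (w i))) ` I)
     ((\<lambda>i. (of_real (2 + Re (w i * cis (a i))) * cis (fst i), Im (w i * cis (a i)))) ` I)"
  proof (rule isotopic_fibre_rotation[OF I])
    show "continuous_on I a" unfolding a_def
      by (intro two continuous_intros cont) auto
    fix i j assume ij: "i \<in> I" "j \<in> I" "cis (fst i) = cis (fst j)"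
    obtain \<theta> k \<theta>' k' where e: "i = (\<theta>, k)" "j = (\<theta>', k')" by (cases i, cases j)
    \<comment> \<open>Both angles grow by \<open>t * pi\<close> in one turn, so their difference is
      a function of the direction.\<close>
    have "t * (\<theta>0 + 2 * pi) / 2 - \<beta> (\<theta>0 + 2 * pi) = t * \<theta>0 / 2 - \<beta> \<theta>0"
      using \<beta>_end by (simp add: field_simps)
    then show "a i = a j"
      using cis_eq_period[of \<theta> \<theta>' \<theta>0] ij by (auto simp: a_def e I_def J_def)
  qed (auto simp: w_def intro!: continuous_intros split: prod.splits)
  moreover have "w (\<theta>, i) * cis (a (\<theta>, i)) = cnj (cis (\<beta> \<theta> + pi * of_int (int i)))" for \<theta> i
    by (simp add: w_def a_def cis_cnj cis_mult algebra_simps)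
  then have "Re (w (\<theta>, i) * cis (a (\<theta>, i))) = C i \<theta>" "Im (w (\<theta>, i) * cis (a (\<theta>, i))) = - S i \<theta>" for \<theta> i
    by (simp_all only: C_def S_def cis.sel cnj.sel)
  then have "(\<lambda>i. (of_real (2 + Re (w i * cis (a i))) * cis (fst i), Im (w i * cis (a i)))) =
      (\<lambda>(\<theta>, i). (of_real (2 + C i \<theta>) * cis \<theta>, - S i \<theta>))"
    by (intro ext) (simp only: split_paired_all prod.case fst_conv)
  moreover have "(\<lambda>i. (of_real (2 + Re (w i)) * cis (fst i), Im (w i))) ` I = {torus_point t \<theta> j | \<theta> j. True}"
    unfolding torus_points_period[of t \<theta>0, folded J_def, folded I_def, symmetric]
    by (intro image_cong) (auto simp: w_def torus_point_def)
  ultimately have R: "isotopic {torus_point t \<theta> j | \<theta> j. True}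
      ((\<lambda>(\<theta>, i). (of_real (2 + C i \<theta>) * cis \<theta>, - S i \<theta>)) ` I)"
    by (simp only:)

  have V: "isotopic ((\<lambda>(\<theta>, i). (of_real (2 + C i \<theta>) * cis \<theta>, - S i \<theta>)) ` I)
      ((\<lambda>(\<theta>, i). (of_real (2 + C i \<theta>) * cis \<theta>, z i \<theta>)) ` I)"
    unfolding case_prod_unfold
  proof (rule isotopic_lift[OF I])
    fix i j assume ij: "i \<in> I" "j \<in> I"
      "of_real (2 + C (snd i) (fst i)) * cis (fst i) = of_real (2 + C (snd j) (fst j)) * cis (fst j)"
    obtain \<theta> k \<theta>' k' where e: "i = (\<theta>, k)" "j = (\<theta>', k')" by (cases i, cases j)
    have "cis \<theta> = cis \<theta>'" "2 + C k \<theta> = 2 + C k' \<theta>'"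
      using ij(3) polar C_pos unfolding e fst_conv snd_conv by metis+
    moreover from this obtain j' where j': "j' < 2" "\<And>f. closing f \<Longrightarrow> f k' \<theta>' = f j' \<theta>"
      using partner[of \<theta> \<theta>' k'] ij by (auto simp: e I_def)
    ultimately have "C k \<theta> = C j' \<theta>" using closing by auto
    moreover have "k < 2" "\<theta> \<in> J" using ij by (auto simp: e I_def)
    \<comment> \<open>For different strands \<open>C k \<theta> = C j' \<theta>\<close> means that a
      cosine equals its own negative; it is 0 and \<open>vertical\<close> applies.\<close>
    ultimately have "z k \<theta> + S k \<theta> = z j' \<theta> + S j' \<theta>"
      using vertical[of \<theta>] j'(1) by (auto simp: less_2_cases_iff C01)
    then show "z (snd i) (fst i) - - S (snd i) (fst i) = z (snd j) (fst j) - - S (snd j) (fst j)"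
      using j'(2)[OF closing(2)] j'(2)[OF closing(4)] by (simp add: e)
  qed (insert cI cfst, auto simp: case_prod_unfold intro!: continuous_intros)

  \<comment> \<open>Logarithm of the ratio of the new radius to the old one. For strands at equal
    height \<open>horizontal\<close> makes the two ratios equal.\<close>
  define k where "k = (\<lambda>(\<theta>, i). ln (r i \<theta> / (2 + C i \<theta>)))"
  have "isotopic ((\<lambda>i. (of_real (2 + C (snd i) (fst i)) * cis (fst i), z (snd i) (fst i))) ` I)
      ((\<lambda>i. (of_real (2 + C (snd i) (fst i)) * cis (fst i) * of_real (exp (k i)), z (snd i) (fst i))) ` I)"
  proof (rule isotopic_scale[OF I])
    show "continuous_on I k"
      unfolding k_def using cI C_pos r_pos
      by (auto simp: case_prod_unfold I_def less_imp_neq[THEN not_sym] intro!: continuous_intros)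
    fix i j assume ij: "i \<in> I" "j \<in> I" "sgn (of_real (2 + C (snd i) (fst i)) * cis (fst i))
      = sgn (of_real (2 + C (snd j) (fst j)) * cis (fst j))" "z (snd i) (fst i) = z (snd j) (fst j)"
    obtain \<theta> l \<theta>' l' where e: "i = (\<theta>, l)" "j = (\<theta>', l')" by (cases i, cases j)
    have "cis \<theta> = cis \<theta>'" using ij(3) C_pos by (simp only: e fst_conv snd_conv polar)
    then obtain j' where j': "j' < 2" "\<And>f. closing f \<Longrightarrow> f l' \<theta>' = f j' \<theta>"
      using partner[of \<theta> \<theta>' l'] ij by (auto simp: e I_def)
    have "l < 2" "\<theta> \<in> J" "z l \<theta> = z j' \<theta>" using ij j'(2)[OF closing(2)] by (auto simp: e I_def)
    then have "r l \<theta> / (2 + C l \<theta>) = r j' \<theta> / (2 + C j' \<theta>)"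
      using horizontal[of \<theta>] j'(1) C_pos[of 0 \<theta>] C_pos[of 1 \<theta>]
      by (auto simp: less_2_cases_iff C01 field_simps)
    then show "k i = k j" using j'(2)[OF closing(1)] j'(2)[OF closing(3)] by (simp add: k_def e)
  next
    show "of_real (2 + C (snd i) (fst i)) * cis (fst i) \<noteq> 0" for i
      using C_pos[of "snd i" "fst i"] by (simp del: of_real_add)
  qed (insert cI cfst, auto simp: case_prod_unfold intro!: continuous_intros)
  moreover have "of_real (2 + C i \<theta>) * cis \<theta> * of_real (exp (k (\<theta>, i))) = of_real (r i \<theta>) * cis \<theta>"
    if "(\<theta>, i) \<in> I" for \<theta> i
  proof -
    have "(2 + C i \<theta>) * exp (k (\<theta>, i)) = r i \<theta>"
      using that r_pos[of i \<theta>] C_pos[of i \<theta>] by (simp add: k_def I_def)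
    then show ?thesis by (metis mult.assoc mult.commute of_real_mult)
  qed
  then have "(\<lambda>i. (of_real (2 + C (snd i) (fst i)) * cis (fst i) * of_real (exp (k i)), z (snd i) (fst i))) ` I
      = (\<lambda>(\<theta>, i). (of_real (r i \<theta>) * cis \<theta>, z i \<theta>)) ` I"
    by (intro image_cong refl) (simp only: split_paired_all prod.case fst_conv snd_conv)
  ultimately have S: "isotopic ((\<lambda>(\<theta>, i). (of_real (2 + C i \<theta>) * cis \<theta>, z i \<theta>)) ` I)
      ((\<lambda>(\<theta>, i). (of_real (r i \<theta>) * cis \<theta>, z i \<theta>)) ` I)"
    by (simp only: case_prod_unfold)

  have "isotopic ((\<lambda>i. (of_real (r (snd i) (fst i)) * cis (fst i), z (snd i) (fst i))) ` I)
      ((\<lambda>i. (of_real (r (snd i) (fst i)) * cis (fst i) * cis (\<phi> (snd i) (fst i) - fst i), z (snd i) (fst i))) ` I)"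
  proof (rule isotopic_twist[OF I])
    fix i j assume ij: "i \<in> I" "j \<in> I" "z (snd i) (fst i) = z (snd j) (fst j)"
      "cmod (of_real (r (snd i) (fst i)) * cis (fst i)) = cmod (of_real (r (snd j) (fst j)) * cis (fst j))"
    then have "r (snd i) (fst i) = r (snd j) (fst j)"
      using r_pos by (auto simp: I_def polar)
    then show "\<phi> (snd i) (fst i) - fst i = \<phi> (snd j) (fst j) - fst j"
      using ij by (intro twist) (auto simp: I_def)
  qed (insert cI cfst, auto simp: case_prod_unfold intro!: continuous_intros)
  moreover have "of_real x * cis \<theta> * cis (y - \<theta>) = of_real x * cis y" for x y \<theta>
    by (simp add: mult.assoc cis_mult)
  ultimately have T: "isotopic ((\<lambda>(\<theta>, i). (of_real (r i \<theta>) * cis \<theta>, z i \<theta>)) ` I)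
      ((\<lambda>(\<theta>, i). (of_real (r i \<theta>) * cis (\<phi> i \<theta>), z i \<theta>)) ` I)"
    by (simp add: case_prod_unfold)
  show ?thesis
    using isotopic_trans[OF isotopic_trans[OF isotopic_trans[OF R V] S] T] by (simp only: I_def)
qed

section \<open>Piecewise linear curves\<close>

definition ramp :: "real \<Rightarrow> real \<Rightarrow> real \<Rightarrow> real" where
  "ramp a b \<tau> = max 0 (min 1 ((\<tau> - a) / (b - a)))"

text \<open>Each edge contributes its increment, faded out by a ramp, so continuity needs no gluing;
  outside the range of the times the value is constant.\<close>

fun polyline :: "(real \<times> 'v::real_normed_vector) list \<Rightarrow> real \<Rightarrow> 'v" where
  "polyline [] \<tau> = 0"
| "polyline [(a, v)] \<tau> = v"
| "polyline ((a, v) # (b, w) # ps) \<tau> = (1 - ramp a b \<tau>) *\<^sub>R (v - w) + polyline ((b, w) # ps) \<tau>"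

text \<open>Applied to vertices that begin with their times, this is the graph of the polyline.
  Membership unfolds to finitely many linear systems, which turns questions of incidence into linear
  arithmetic.\<close>

fun segments :: "'v::real_vector list \<Rightarrow> 'v set" where
  "segments [] = {}"
| "segments [p] = {p}"
| "segments (p # q # ps) = closed_segment p q \<union> segments (q # ps)"

lemma continuous_on_polyline: "continuous_on S (polyline ps)"
proof (induction ps rule: segments.induct)
  case (2 p)
  then show ?case by (cases p) simp
next
  case (3 p q ps)
  then show ?case
    by (cases p; cases q) (auto simp: ramp_def divide_inverse intro!: continuous_intros)
qed simp

lemma polyline_before:
  assumes "sorted_wrt (<) (map fst ((b, w) # ps))" "\<tau> \<le> b"
  shows "polyline ((b, w) # ps) \<tau> = w"
  using assms
proof (induction ps arbitrary: b w)
  case (Cons p ps)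
  obtain c u where p: "p = (c, u)" by (cases p)
  have "(\<tau> - b) / (c - b) \<le> 0" using Cons.prems by (intro divide_nonpos_pos) (auto simp: p)
  then have "ramp b c \<tau> = 0" by (simp add: ramp_def)
  then show ?case using Cons.IH[of c u] Cons.prems by (simp add: p)
qed simp

lemma polyline_graph:
  assumes "sorted_wrt (<) (map fst ps)" "ps \<noteq> []"
  shows "(\<lambda>\<tau>. (\<tau>, polyline ps \<tau>)) ` {fst (hd ps)..fst (last ps)} = segments ps"
  using assms
proof (induction ps rule: segments.induct)
  case (2 p)
  then show ?case by (cases p) simp
next
  case (3 p q ps)
  obtain a v b w where p: "p = (a, v)" and q: "q = (b, w)" by (cases p, cases q)
  have ab: "a < b" and sorted: "sorted_wrt (<) (map fst (q # ps))" using "3.prems" by (auto simp: p q)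
  have b_le: "b \<le> fst (last (q # ps))"
    using sorted by (cases "ps = []") (auto simp: q intro!: less_imp_le)
  have 1: "(\<tau>, polyline (p # q # ps) \<tau>) = (1 - (\<tau> - a) / (b - a)) *\<^sub>R p + ((\<tau> - a) / (b - a)) *\<^sub>R q"
    if "\<tau> \<in> {a..b}" for \<tau>
  proof -
    have "ramp a b \<tau> = (\<tau> - a) / (b - a)" using that ab by (auto simp: ramp_def max_def min_def)
    moreover have "(1 - u) * a + u * b = a + u * (b - a)" for u by (simp add: algebra_simps)
    then have "(1 - (\<tau> - a) / (b - a)) * a + (\<tau> - a) / (b - a) * b = \<tau>"
      using ab by (simp only:) simp
    ultimately show ?thesis using polyline_before[OF sorted[unfolded q]] that
      by (simp add: p q algebra_simps)
  qed
  have "(\<lambda>\<tau>. (\<tau>, polyline (p # q # ps) \<tau>)) ` {a..b} = closed_segment p q"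
  proof (intro subset_antisym subsetI)
    fix x assume "x \<in> closed_segment p q"
    then obtain u where u: "0 \<le> u" "u \<le> 1" "x = (1 - u) *\<^sub>R p + u *\<^sub>R q" by (auto simp: in_segment)
    have "u * (b - a) \<le> b - a" "0 \<le> u * (b - a)"
      using u ab mult_left_le_one_le[of "b - a" u] by auto
    then have mem: "a + u * (b - a) \<in> {a..b}" by (simp only: atLeastAtMost_iff) linarith
    have "(a + u * (b - a) - a) / (b - a) = u" using ab by simp
    with 1[OF mem] have "(a + u * (b - a), polyline (p # q # ps) (a + u * (b - a))) = x"
      by (simp only: u(3))
    then show "x \<in> (\<lambda>\<tau>. (\<tau>, polyline (p # q # ps) \<tau>)) ` {a..b}"
      using mem by (rule image_eqI[OF sym])
  next
    fix x assume "x \<in> (\<lambda>\<tau>. (\<tau>, polyline (p # q # ps) \<tau>)) ` {a..b}"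
    then obtain \<tau> where \<tau>: "\<tau> \<in> {a..b}" "x = (1 - (\<tau> - a) / (b - a)) *\<^sub>R p + ((\<tau> - a) / (b - a)) *\<^sub>R q"
      using 1 by auto
    then show "x \<in> closed_segment p q"
      using ab by (auto simp: in_segment intro!: exI[of _ "(\<tau> - a) / (b - a)"])
  qed
  moreover have "(\<lambda>\<tau>. (\<tau>, polyline (p # q # ps) \<tau>)) ` {b..fst (last (q # ps))} =
      (\<lambda>\<tau>. (\<tau>, polyline (q # ps) \<tau>)) ` {b..fst (last (q # ps))}"
  proof (intro image_cong refl)
    fix \<tau> assume "\<tau> \<in> {b..fst (last (q # ps))}"
    then have "ramp a b \<tau> = 1" using ab by (auto simp: ramp_def max_def min_def)
    then show "(\<tau>, polyline (p # q # ps) \<tau>) = (\<tau>, polyline (q # ps) \<tau>)" by (simp add: p q)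
  qed
  moreover have "(\<lambda>\<tau>. (\<tau>, polyline (q # ps) \<tau>)) ` {b..fst (last (q # ps))} = segments (q # ps)"
    using "3.IH" sorted by (simp add: q)
  moreover have "{fst (hd (p # q # ps))..fst (last (p # q # ps))} = {a..b} \<union> {b..fst (last (q # ps))}"
    using ab b_le by (auto simp: p)
  ultimately show ?case by (simp only: image_Un segments.simps)
qed simp

lemma segments_append: "segments (xs @ q # ys) = segments (xs @ [q]) \<union> segments (q # ys)"
proof (induction xs rule: segments.induct)
  case (2 p) then show ?case by (cases ys) auto
next
  case (3 p p' ps) then show ?case by auto
qed (cases ys; auto)

lemma segments_translate: "segments (map ((+) c) ps) = (+) c ` segments ps"
  by (induction ps rule: segments.induct) (auto simp: closed_segment_translation image_Un)

lemma segments_hd: "ps \<noteq> [] \<Longrightarrow> hd ps \<in> segments ps"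
  by (induction ps rule: segments.induct) auto

text \<open>Consecutive lists share a vertex; \<open>tl\<close> keeps it from occurring twice, which
  would spoil the strict order of the times.\<close>

fun join :: "(nat \<Rightarrow> 'v list) \<Rightarrow> nat \<Rightarrow> 'v list" where
  "join B 0 = [hd (B 0)]"
| "join B (Suc n) = join B n @ tl (B n)"

lemma join_props:
  fixes B :: "nat \<Rightarrow> (real \<times> 'v::real_normed_vector) list"
  assumes sorted: "\<And>k. k < n \<Longrightarrow> sorted_wrt (<) (map fst (B k))"
    and len: "\<And>k. k < n \<Longrightarrow> B k \<noteq> []" "\<And>k. k < n \<Longrightarrow> tl (B k) \<noteq> []"
    and link: "\<And>k. Suc k < n \<Longrightarrow> last (B k) = hd (B (Suc k))" and "n > 0"
  shows "sorted_wrt (<) (map fst (join B n))" "join B n \<noteq> []" "hd (join B n) = hd (B 0)"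
    "last (join B n) = last (B (n - 1))" "segments (join B n) = (\<Union>k<n. segments (B k))"
proof -
  have "sorted_wrt (<) (map fst (join B n)) \<and> join B n \<noteq> [] \<and> hd (join B n) = hd (B 0) \<and>
    last (join B n) = last (B (n - 1)) \<and> segments (join B n) = (\<Union>k<n. segments (B k))"
    using assms
  proof (induction n)
    case (Suc n)
    show ?case
    proof (cases "n = 0")
      case True
      obtain p qs where "B 0 = p # qs" using Suc.prems(2)[of 0] True by (cases "B 0") auto
      then show ?thesis using Suc.prems True by auto
    next
      case False
      then have IH: "sorted_wrt (<) (map fst (join B n))" "join B n \<noteq> []" "hd (join B n) = hd (B 0)"
        "last (join B n) = last (B (n - 1))" "segments (join B n) = (\<Union>k<n. segments (B k))"
        using Suc by auto
      obtain p q qs where Bn: "B n = p # q # qs"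
        using Suc.prems(2,3)[of n] by (cases "B n" rule: segments.cases) auto
      have p: "last (join B n) = p" using IH(4) Suc.prems(4)[of "n - 1"] False Bn by simp
      then obtain xs where xs: "join B n = xs @ [p]" using IH(2) by (metis append_butlast_last_id)
      have "segments (join B (Suc n)) = segments (join B n) \<union> segments (B n)"
        using segments_append[of xs p "q # qs"] by (simp add: xs Bn)
      moreover have "sorted_wrt (<) (map fst (join B (Suc n)))"
        using IH(1) Suc.prems(1)[of n] by (fastforce simp: xs Bn sorted_wrt_append)
      ultimately show ?thesis using IH by (auto simp: Bn lessThan_Suc)
    qed
  qed simp
  then show "sorted_wrt (<) (map fst (join B n))" "join B n \<noteq> []" "hd (join B n) = hd (B 0)"
    "last (join B n) = last (B (n - 1))" "segments (join B n) = (\<Union>k<n. segments (B k))"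
    by blast+
qed

section \<open>Crossings in cylindrical coordinates\<close>

definition proj2 :: "real^3 \<Rightarrow> real^2" where
  "proj2 v = vector [v $ 1, v $ 2]"

lemma proj2_cyl3 [simp]: "proj2 (cyl3 (w, z)) $ 1 = Re w" "proj2 (cyl3 (w, z)) $ 2 = Im w"
  by (auto simp: proj2_def)

lemma proj2_eq_iff: "proj2 (cyl3 (w, z)) = proj2 (cyl3 (w', z')) \<longleftrightarrow> w = w'"
  by (auto simp: vec_eq_iff forall_2 complex_eq_iff)

lemma inj_cyl3: "inj cyl3"
  by (auto intro!: injI simp: vec_eq_iff forall_3 complex_eq_iff)

lemma linear_proj2: "linear proj2"
  by (rule linearI) (auto simp: proj2_def vec_eq_iff forall_2)

lemma surj_proj2: "surj proj2"
proof (rule surjI)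
  show "proj2 (vector [v $ 1, v $ 2, 0]) = v" for v
    by (simp add: proj2_def vec_eq_iff forall_2)
qed

lemma not_collinear_cross:
  fixes u v :: "real^2"
  assumes "u $ 1 * v $ 2 - u $ 2 * v $ 1 \<noteq> 0"
  shows "\<not> collinear {0, u, v}"
  using assms by (auto simp: collinear_lemma)

text \<open>A relation between angular position, radius and height instead of a parametrisation:
  crossings show as pairs \<open>(y, r)\<close> with several heights \<open>z\<close>.\<close>

definition polar_link :: "real \<Rightarrow> (real \<Rightarrow> real \<Rightarrow> real \<Rightarrow> bool) \<Rightarrow> (complex \<times> real) set" where
  "polar_link \<omega> R = {(of_real r * cis (\<omega> * y), z) | r y z. R y r z}"

lemma polar_eq_iff:
  assumes "r > 0" "r' > 0" "\<omega> * Y = 2 * pi" "\<omega> > 0" "0 \<le> y" "y \<le> Y" "0 \<le> y'" "y' \<le> Y"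
    and "of_real r * cis (\<omega> * y) = of_real r' * cis (\<omega> * y')"
  shows "r = r'" "y = y' \<or> (y = 0 \<and> y' = Y) \<or> (y = Y \<and> y' = 0)"
proof -
  have "cmod (of_real r * cis (\<omega> * y)) = cmod (of_real r' * cis (\<omega> * y'))" using assms(9) by simp
  then show "r = r'" using assms(1,2) by (simp add: norm_mult)
  then have "cis (\<omega> * y) = cis (\<omega> * y')" using assms by auto
  moreover have "\<omega> * y \<le> \<omega> * Y" "\<omega> * y' \<le> \<omega> * Y" using assms(4,6,8) by (simp_all add: mult_left_mono)
  then have "\<omega> * y \<in> {0..0 + 2 * pi}" "\<omega> * y' \<in> {0..0 + 2 * pi}" using assms by auto
  ultimately have "\<omega> * y = \<omega> * y' \<or> (\<omega> * y = 0 \<and> \<omega> * y' = \<omega> * Y) \<or> (\<omega> * y' = 0 \<and> \<omega> * y = \<omega> * Y)"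
    using cis_eq_period[of "\<omega> * y" "\<omega> * y'" 0] by (auto simp: assms(3))
  then show "y = y' \<or> (y = 0 \<and> y' = Y) \<or> (y = Y \<and> y' = 0)" using assms(4) by auto
qed

text \<open>A link that is a straight segment in polar coordinates within a small box is a smooth
  arc there. The factor 2 in the velocity is the radius at which the angular motion takes
  place.\<close>

lemma strand_direction_polar:
  fixes a b h m \<omega> \<delta> \<rho> \<eta> :: real
  assumes pos: "\<delta> > 0" "\<rho> > 0" "\<eta> > 0" "\<omega> > 0" "\<omega> * \<rho> < pi"
    and small: "\<bar>a\<bar> \<le> 1" "\<delta> \<le> 1" "\<bar>b\<bar> * \<delta> \<le> \<rho>" and ab: "a \<noteq> 0 \<or> b \<noteq> 0"
    and loc: "\<And>x y z. \<bar>x\<bar> < \<delta> \<Longrightarrow> \<bar>y\<bar> < \<rho> \<Longrightarrow> \<bar>z - h\<bar> < \<eta> \<Longrightarrow>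
      (of_real (2 + x) * cis (\<omega> * (m + y)), z) \<in> L \<longleftrightarrow> (\<exists>\<tau>\<in>{-1<..<1}. x = a * \<delta> * \<tau> \<and> y = b * \<delta> * \<tau> \<and> z = h)"
  shows "strand_direction (cyl3 ` L) (cyl3 (2 * cis (\<omega> * m), h))
    (cyl3 (of_real \<delta> * Complex a (2 * \<omega> * b) * cis (\<omega> * m), 0))"
proof -
  define g where "g \<tau> = of_real (2 + a * \<delta> * \<tau>) * cis (\<omega> * (m + b * \<delta> * \<tau>))" for \<tau>
  define \<alpha> where "\<alpha> \<tau> = cyl3 (g \<tau>, h)" for \<tau>
  define dg where "dg \<tau> = of_real (a * \<delta>) * cis (\<omega> * (m + b * \<delta> * \<tau>)) +
      of_real ((2 + a * \<delta> * \<tau>) * (\<omega> * b * \<delta>)) * (\<i> * cis (\<omega> * (m + b * \<delta> * \<tau>)))" for \<tau>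
  define D where "D \<tau> = cyl3 (dg \<tau>, 0)" for \<tau>
  have x_small: "\<bar>a * \<delta> * \<tau>\<bar> < \<delta>" if "\<tau> \<in> {-1<..<1}" for \<tau>
  proof -
    have "\<bar>a * \<delta> * \<tau>\<bar> = \<bar>a\<bar> * (\<delta> * \<bar>\<tau>\<bar>)" using pos(1) by (simp add: abs_mult)
    also have "\<dots> \<le> \<delta> * \<bar>\<tau>\<bar>" using small(1) pos(1) by (intro mult_left_le_one_le) auto
    also have "\<dots> < \<delta> * 1" using that pos(1) by (intro mult_strict_left_mono) auto
    finally show ?thesis by simp
  qed
  have y_small: "\<bar>b * \<delta> * \<tau>\<bar> < \<rho>" if "\<tau> \<in> {-1<..<1}" for \<tau>
  proof (cases "b = 0")
    case False
    have "\<bar>b * \<delta> * \<tau>\<bar> = \<bar>b\<bar> * \<delta> * \<bar>\<tau>\<bar>" using pos by (simp add: abs_mult)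
    also have "\<dots> < \<bar>b\<bar> * \<delta> * 1" using False pos that by (intro mult_strict_left_mono) auto
    finally show ?thesis using small by simp
  qed (use pos in simp)
  \<comment> \<open>The box in polar coordinates. Measuring the angle from
    \<open>\<omega> * m\<close> puts the branch cut of \<open>Ln\<close> opposite to the box, so
    \<open>N\<close> is open.\<close>
  define N where "N = {(w, z). \<bar>cmod w - 2\<bar> < \<delta> \<and> w * cis (- \<omega> * m) \<notin> \<real>\<^sub>\<le>\<^sub>0 \<and>
      \<bar>Im (Ln (w * cis (- \<omega> * m)))\<bar> < \<omega> * \<rho> \<and> \<bar>z - h\<bar> < \<eta>}"
  have N_polar: "(of_real (2 + x) * cis (\<omega> * (m + y)), z) \<in> N"
    if "\<bar>x\<bar> < \<delta>" "\<bar>y\<bar> < \<rho>" "\<bar>z - h\<bar> < \<eta>" for x y z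
  proof -
    have "2 + x > 0" using that(1) small(2) by linarith
    have "\<bar>\<omega> * y\<bar> < \<omega> * \<rho>" using that(2) pos by (simp add: abs_mult)
    then have "\<bar>\<omega> * y\<bar> < pi" using pos by linarith
    have eq: "of_real (2 + x) * cis (\<omega> * (m + y)) * cis (- \<omega> * m) = of_real (2 + x) * cis (\<omega> * y)"
      by (simp add: mult.assoc cis_mult algebra_simps)
    have "exp (Complex (ln (2 + x)) (\<omega> * y)) = of_real (2 + x) * cis (\<omega> * y)"
      using \<open>2 + x > 0\<close> by (simp add: exp_eq_polar exp_of_real del: of_real_add)
    then have Ln: "Ln (of_real (2 + x) * cis (\<omega> * y)) = Complex (ln (2 + x)) (\<omega> * y)"
      using \<open>\<bar>\<omega> * y\<bar> < pi\<close> by (intro Ln_unique) auto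
    have "of_real (2 + x) * cis (\<omega> * y) \<notin> \<real>\<^sub>\<le>\<^sub>0"
    proof
      assume "of_real (2 + x) * cis (\<omega> * y) \<in> \<real>\<^sub>\<le>\<^sub>0"
      then have "sin (\<omega> * y) = 0" "cos (\<omega> * y) \<le> 0"
        using \<open>2 + x > 0\<close> by (auto simp: complex_nonpos_Reals_iff mult_le_0_iff)
      then show False
        using \<open>\<bar>\<omega> * y\<bar> < pi\<close> sin_zero_pi_iff[of "\<omega> * y"] by auto
    qed
    then show ?thesis
      using that \<open>2 + x > 0\<close> \<open>\<bar>\<omega> * y\<bar> < \<omega> * \<rho>\<close>
      unfolding N_def mem_Collect_eq prod.case eq Ln by (simp add: norm_mult del: of_real_add)
  qed
  have N_cases: "\<exists>x y. \<bar>x\<bar> < \<delta> \<and> \<bar>y\<bar> < \<rho> \<and> \<bar>z - h\<bar> < \<eta> \<and> w = of_real (2 + x) * cis (\<omega> * (m + y))"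
    if "(w, z) \<in> N" for w z
  proof -
    let ?w = "w * cis (- \<omega> * m)" and ?y = "Im (Ln (w * cis (- \<omega> * m))) / \<omega>"
    have "w \<noteq> 0" using that by (auto simp: N_def)
    then have "?w = exp (Ln ?w)" by simp
    also have "\<dots> = of_real (cmod ?w) * cis (\<omega> * ?y)"
      using \<open>w \<noteq> 0\<close> pos by (simp add: exp_eq_polar norm_mult exp_of_real)
    finally have "?w * cis (\<omega> * m) = of_real (cmod w) * cis (\<omega> * ?y) * cis (\<omega> * m)" by (simp add: norm_mult)
    then have "w = of_real (2 + (cmod w - 2)) * cis (\<omega> * (m + ?y))"
      by (simp add: mult.assoc cis_mult algebra_simps)
    moreover have "\<bar>cmod w - 2\<bar> < \<delta>" "\<bar>?y\<bar> < \<rho>" "\<bar>z - h\<bar> < \<eta>"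
      using that pos by (auto simp: N_def divide_less_eq mult.commute)
    ultimately show ?thesis by blast
  qed
  have "open N"
  proof -
    let ?A = "{x :: complex \<times> real. fst x * cis (- \<omega> * m) \<notin> \<real>\<^sub>\<le>\<^sub>0}"
    have "closed {x :: complex \<times> real. fst x * cis (- \<omega> * m) \<in> \<real>\<^sub>\<le>\<^sub>0}"
      using closed_vimage[OF closed_nonpos_Reals_complex, of "\<lambda>x::complex \<times> real. fst x * cis (- \<omega> * m)"]
        continuous_on_mult[OF continuous_on_fst[OF continuous_on_id] continuous_on_const]
      unfolding vimage_def by blast
    then have A: "open ?A" by (simp add: closed_def Compl_eq)
    have "continuous_on ?A (\<lambda>x. \<bar>Im (Ln (fst x * cis (- \<omega> * m)))\<bar>)"
      by (intro continuous_intros) auto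
    then have "open {x \<in> ?A. \<bar>Im (Ln (fst x * cis (- \<omega> * m)))\<bar> \<in> {..<\<omega> * \<rho>}}"
      using A by (rule continuous_open_preimage[unfolded Int_def vimage_def mem_Collect_eq]) auto
    moreover have "open {x :: complex \<times> real. \<bar>cmod (fst x) - 2\<bar> < \<delta>}" "open {x :: complex \<times> real. \<bar>snd x - h\<bar> < \<eta>}"
      by (intro open_Collect_less continuous_intros)+
    ultimately have "open ({x :: complex \<times> real. \<bar>cmod (fst x) - 2\<bar> < \<delta>} \<inter>
      {x \<in> ?A. \<bar>Im (Ln (fst x * cis (- \<omega> * m)))\<bar> \<in> {..<\<omega> * \<rho>}} \<inter> {x. \<bar>snd x - h\<bar> < \<eta>})" by blast
    also have "\<dots> = N" by (auto simp: N_def)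
    finally show ?thesis .
  qed
  define U where "U = cyl3 ` N"
  have "open U"
  proof -
    have "U = (\<lambda>v. (Complex (v $ 1) (v $ 2), v $ 3)) -` N"
      unfolding U_def
      by (auto simp: vec_eq_iff forall_3
          intro!: image_eqI[of v _ "(Complex (v $ 1) (v $ 2), v $ 3)" for v])
    then show ?thesis
      using open_vimage[OF \<open>open N\<close> homeomorphism_cont2[OF homeomorphism_cyl3]] by simp
  qed
  moreover have "cyl3 (2 * cis (\<omega> * m), h) \<in> U"
    using N_polar[of 0 0 h] pos by (auto simp: U_def)
  moreover have "\<alpha> ` {-1<..<1} = cyl3 ` L \<inter> U"
  proof -
    have "g ` {-1<..<1} \<times> {h} = L \<inter> N"
    proof (intro subset_antisym subsetI)
      fix x assume "x \<in> g ` {-1<..<1} \<times> {h}"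
      then obtain \<tau> where \<tau>: "\<tau> \<in> {-1<..<1}" "x = (g \<tau>, h)" by auto
      then show "x \<in> L \<inter> N"
        using loc[OF x_small[of \<tau>] y_small[of \<tau>], of h] N_polar[OF x_small[of \<tau>] y_small[of \<tau>], of h] pos
        by (auto simp: g_def)
    next
      fix x assume x: "x \<in> L \<inter> N"
      obtain w z where wz: "x = (w, z)" by (cases x)
      then obtain u y where u: "\<bar>u\<bar> < \<delta>" "\<bar>y\<bar> < \<rho>" "\<bar>z - h\<bar> < \<eta>" "w = of_real (2 + u) * cis (\<omega> * (m + y))"
        using N_cases[of w z] x by blast
      then obtain \<tau> where "\<tau> \<in> {-1<..<1}" "u = a * \<delta> * \<tau>" "y = b * \<delta> * \<tau>" "z = h"
        using loc[of u y z] x wz by blast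
      then show "x \<in> g ` {-1<..<1} \<times> {h}" by (auto simp: wz u(4) g_def)
    qed
    then have "cyl3 ` (g ` {-1<..<1} \<times> {h}) = cyl3 ` (L \<inter> N)" by simp
    also have "cyl3 ` (L \<inter> N) = cyl3 ` L \<inter> U"
      unfolding U_def by (rule image_Int[OF inj_cyl3])
    finally show ?thesis by (auto simp: \<alpha>_def image_image)
  qed
  moreover have der: "(\<alpha> has_vector_derivative D \<tau>) (at \<tau>)" for \<tau>
  proof -
    have "(g has_vector_derivative dg \<tau>) (at \<tau>)"
      unfolding g_def dg_def has_vector_derivative_def
      by (auto intro!: derivative_eq_intros simp: scaleR_conv_of_real algebra_simps)
    then have "((\<lambda>\<tau>. (g \<tau>, h)) has_vector_derivative (dg \<tau>, 0)) (at \<tau>)"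
      by (intro has_vector_derivative_Pair) auto
    then show ?thesis
      unfolding \<alpha>_def D_def
      by (rule bounded_linear.has_vector_derivative[OF linear_conv_bounded_linear[THEN iffD1, OF linear_cyl3]])
  qed
  moreover have "continuous_on {-1<..<1} D"
    unfolding D_def dg_def
    by (intro continuous_on_compose2[OF homeomorphism_cont1[OF homeomorphism_cyl3]] continuous_intros) auto
  moreover have "inj_on \<alpha> {-1<..<1}"
  proof (rule inj_onI)
    fix \<tau> \<tau>' assume \<tau>: "\<tau> \<in> {-1<..<1}" "\<tau>' \<in> {-1<..<1}" "\<alpha> \<tau> = \<alpha> \<tau>'"
    then have g: "g \<tau> = g \<tau>'" by (simp add: \<alpha>_def vec_eq_iff forall_3 complex_eq_iff)
    have p: "2 + a * \<delta> * \<tau> > 0" "2 + a * \<delta> * \<tau>' > 0"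
      using x_small[OF \<tau>(1)] x_small[OF \<tau>(2)] small(2) by linarith+
    have cm: "cmod (g \<tau>) = 2 + a * \<delta> * \<tau>" "cmod (g \<tau>') = 2 + a * \<delta> * \<tau>'"
      using p by (simp_all add: g_def norm_mult del: of_real_add)
    then have "a * \<delta> * \<tau> = a * \<delta> * \<tau>'" using g by (metis add_left_cancel)
    moreover have "b * \<delta> * \<tau> = b * \<delta> * \<tau>'"
    proof -
      have "cis (\<omega> * (m + b * \<delta> * \<tau>)) = cis (\<omega> * (m + b * \<delta> * \<tau>'))"
        using g p \<open>a * \<delta> * \<tau> = a * \<delta> * \<tau>'\<close> by (simp add: g_def del: of_real_add)
      moreover have "\<bar>\<omega> * (b * \<delta> * \<tau>)\<bar> < \<omega> * \<rho>" "\<bar>\<omega> * (b * \<delta> * \<tau>')\<bar> < \<omega> * \<rho>"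
        using y_small[OF \<tau>(1)] y_small[OF \<tau>(2)] pos(4) by (auto simp only: abs_mult abs_of_pos mult_less_cancel_left_pos)
      then have "\<bar>\<omega> * (b * \<delta> * \<tau>)\<bar> < pi" "\<bar>\<omega> * (b * \<delta> * \<tau>')\<bar> < pi" using pos(5) by linarith+
      ultimately have "\<omega> * (m + b * \<delta> * \<tau>) = \<omega> * (m + b * \<delta> * \<tau>')"
        using cis_eq_period[of "\<omega> * (m + b * \<delta> * \<tau>)" "\<omega> * (m + b * \<delta> * \<tau>')" "\<omega> * m - pi"]
        by (auto simp: distrib_left abs_less_iff)
      then show ?thesis using pos(4) by simp
    qed
    ultimately show "\<tau> = \<tau>'" using ab pos(1) by auto
  qed
  moreover have "\<alpha> 0 = cyl3 (2 * cis (\<omega> * m), h)" by (simp add: \<alpha>_def g_def)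
  moreover have "D 0 = cyl3 (of_real \<delta> * Complex a (2 * \<omega> * b) * cis (\<omega> * m), 0)"
    by (simp add: D_def dg_def Complex_eq algebra_simps)
  ultimately have "\<alpha> C1_differentiable_on {-1<..<1}"
      "(\<alpha> has_vector_derivative cyl3 (of_real \<delta> * Complex a (2 * \<omega> * b) * cis (\<omega> * m), 0)) (at 0)"
    and "open U" "cyl3 (2 * cis (\<omega> * m), h) \<in> U" "\<alpha> ` {-1<..<1} = cyl3 ` L \<inter> U"
      "inj_on \<alpha> {-1<..<1}" "\<alpha> 0 = cyl3 (2 * cis (\<omega> * m), h)"
    unfolding C1_differentiable_on_def by metis+
  then show ?thesis unfolding strand_direction_def by blast
qed

lemma ex_less_4: "(\<exists>j<4::nat. P j) \<longleftrightarrow> P 0 \<or> P 1 \<or> P 2 \<or> P 3"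
  by (auto simp: eval_nat_numeral less_Suc_eq)

lemma lessThan_4_5: "{..<4::nat} = {0, 1, 2, 3}" "{..<5::nat} = {0, 1, 2, 3, 4}"
  by auto

text \<open>Four strands cross the circle of radius 2 with slopes \<open>\<sigma> j\<close>, and the
  one numbered 4 runs along it; distinct slopes give transversality. The half planes at
  \<open>0\<close> and \<open>Y\<close> coincide, hence the assumption on the ends.\<close>

lemma polar_link_crossings:
  fixes R :: "real \<Rightarrow> real \<Rightarrow> real \<Rightarrow> bool" and \<sigma> :: "nat \<Rightarrow> real" and h :: "real \<Rightarrow> nat \<Rightarrow> real"
  assumes Y: "\<omega> * Y = 2 * pi" "\<omega> > 0"
    and range: "\<And>y r z. R y r z \<Longrightarrow> 0 \<le> y \<and> y \<le> Y \<and> 0 < r"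
    and uniq: "\<And>y r z z'. R y r z \<Longrightarrow> R y r z' \<Longrightarrow> z = z' \<or> (y \<in> M \<and> r = 2)"
    and ends: "\<And>r z z'. R 0 r z \<Longrightarrow> R Y r z' \<Longrightarrow> z = z'"
    and M: "finite M" "\<And>m. m \<in> M \<Longrightarrow> \<epsilon> \<le> m \<and> m \<le> Y - \<epsilon>" and \<epsilon>: "0 < \<epsilon>" "\<epsilon> \<le> 1"
    and loc: "\<And>m x y z. m \<in> M \<Longrightarrow> \<bar>x\<bar> < \<epsilon> \<Longrightarrow> \<bar>y\<bar> < \<epsilon> \<Longrightarrow>
      R (m + y) (2 + x) z \<longleftrightarrow> (\<exists>j<4. y = \<sigma> j * x \<and> z = h m j) \<or> (x = 0 \<and> z = h m 4)"
    and inj_h: "\<And>m. m \<in> M \<Longrightarrow> inj_on (h m) {..<5}" and inj_\<sigma>: "inj_on \<sigma> {..<4}"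
  shows "n_crossing_projection 5 proj2 (cyl3 ` polar_link \<omega> R) \<and>
    card (multiple_points proj2 (cyl3 ` polar_link \<omega> R)) \<le> card M"
proof -
  let ?L = "cyl3 ` polar_link \<omega> R"
  have polar_eq: "r = r' \<and> (y = y' \<or> (y = 0 \<and> y' = Y) \<or> (y = Y \<and> y' = 0))"
    if "R y r z" "R y' r' z'" "of_real r * cis (\<omega> * y) = of_real r' * cis (\<omega> * y')" for y y' r r' z z'
    using polar_eq_iff[OF _ _ Y _ _ _ _ that(3)] range[OF that(1)] range[OF that(2)] by blast
  have sub: "multiple_points proj2 ?L \<subseteq> (\<lambda>m. proj2 (cyl3 (2 * cis (\<omega> * m), 0))) ` M"
  proof
    fix p assume "p \<in> multiple_points proj2 ?L"
    then obtain q q' where q: "q \<in> ?L" "q' \<in> ?L" "q \<noteq> q'" "proj2 q = p" "proj2 q' = p"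
      by (auto simp: multiple_points_def)
    then obtain y r z y' r' z' where e: "R y r z" "q = cyl3 (of_real r * cis (\<omega> * y), z)"
        "R y' r' z'" "q' = cyl3 (of_real r' * cis (\<omega> * y'), z')"
      by (auto simp: polar_link_def)
    have eq: "of_real r * cis (\<omega> * y) = of_real r' * cis (\<omega> * y')"
      using q(4,5) e(2,4) proj2_eq_iff by metis
    have "z \<noteq> z'" using q(3) eq e by auto
    have "y \<in> M \<and> r = 2"
      using polar_eq[OF e(1,3) eq] uniq[of y r z z'] ends[of r z z'] ends[of r z' z] e(1,3) \<open>z \<noteq> z'\<close> by auto
    then show "p \<in> (\<lambda>m. proj2 (cyl3 (2 * cis (\<omega> * m), 0))) ` M"
      using q(4) e(2) by (auto simp: proj2_eq_iff intro!: image_eqI[of _ _ y])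
  qed
  then have card: "card (multiple_points proj2 ?L) \<le> card M"
    using M(1) by (meson card_image_le card_mono finite_imageI le_trans)
  have fibre: "{q \<in> ?L. proj2 q = proj2 (cyl3 (2 * cis (\<omega> * m), 0))} =
      (\<lambda>j. cyl3 (2 * cis (\<omega> * m), h m j)) ` {..<5}" if m: "m \<in> M" for m
  proof -
    have R_iff: "R m 2 z \<longleftrightarrow> (\<exists>j<5. z = h m j)" for z
      using loc[OF m, of 0 0 z] \<epsilon> less_Suc_eq[of _ 4] by (auto simp: eval_nat_numeral)
    show ?thesis
    proof (intro subset_antisym subsetI)
      fix q assume q: "q \<in> {q \<in> ?L. proj2 q = proj2 (cyl3 (2 * cis (\<omega> * m), 0))}"
      then obtain y r z where e: "R y r z" "q = cyl3 (of_real r * cis (\<omega> * y), z)"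
        by (auto simp: polar_link_def)
      have eq: "of_real r * cis (\<omega> * y) = of_real 2 * cis (\<omega> * m)"
        using q e by (auto simp: proj2_eq_iff)
      have "R m 2 (h m 4)" unfolding R_iff by (intro exI[of _ 4]) simp
      from polar_eq[OF e(1) this eq] M(2)[OF m] \<epsilon> have "r = 2" "y = m" by auto
      then show "q \<in> (\<lambda>j. cyl3 (2 * cis (\<omega> * m), h m j)) ` {..<5}"
        using e R_iff by auto
    next
      fix q assume "q \<in> (\<lambda>j. cyl3 (2 * cis (\<omega> * m), h m j)) ` {..<5}"
      then obtain j where j: "j < 5" "q = cyl3 (2 * cis (\<omega> * m), h m j)" by auto
      then have "R m 2 (h m j)" by (auto simp: R_iff)
      then have "(of_real 2 * cis (\<omega> * m), h m j) \<in> polar_link \<omega> R" unfolding polar_link_def by blast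
      then show "q \<in> {q \<in> ?L. proj2 q = proj2 (cyl3 (2 * cis (\<omega> * m), 0))}"
        using j by (auto simp: proj2_eq_iff)
    qed
  qed
  \<comment> \<open>The directions are \<open>(1, \<sigma> j)\<close> and, for the strand along the
    circle, \<open>(0, 1)\<close>. The determinants below are then differences of slopes, or 1 and
    -1.\<close>
  define a where "a j = (if j < 4 then 1 else 0 :: real)" for j :: nat
  define b where "b j = (if j < 4 then \<sigma> j else 1)" for j :: nat
  have dir: "\<exists>\<delta>>0. strand_direction ?L (cyl3 (2 * cis (\<omega> * m), h m j))
      (cyl3 (of_real \<delta> * Complex (a j) (2 * \<omega> * b j) * cis (\<omega> * m), 0))" if m: "m \<in> M" and j: "j < 5" for m j
  proof -
    \<comment> \<open>Distinct heights isolate the strand: a slab of half width \<eta> around it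
      misses the other four at the crossing.\<close>
    obtain \<eta> where "\<eta> > 0" "\<forall>x\<in>h m ` {..<5}. x \<noteq> h m j \<longrightarrow> \<eta> \<le> dist (h m j) x"
      using finite_set_avoid[of "h m ` {..<5}" "h m j"] by auto
    then have \<eta>: "\<eta> > 0" "\<And>i. i < 5 \<Longrightarrow> \<bar>h m i - h m j\<bar> < \<eta> \<Longrightarrow> i = j"
      using inj_h[OF m] j by (force simp: inj_on_def dist_real_def abs_minus_commute)+
    define c where "c = (if j < 4 then 1 + \<bar>\<sigma> j\<bar> else 1)"
    \<comment> \<open>\<open>c\<close> bounds the slope, so the segment of half width \<delta> fits
      into the box of angular half width \<open>c * \<delta>\<close>; the factor 2 keeps the latter
      strictly below \<epsilon> and \<open>pi / \<omega>\<close>.\<close>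
    define \<delta> where "\<delta> = min \<epsilon> (pi / \<omega>) / (2 * c)"
    have c: "c \<ge> 1" "\<bar>b j\<bar> \<le> c" by (auto simp: c_def b_def)
    have mn: "min \<epsilon> (pi / \<omega>) > 0" using \<epsilon> Y by simp
    have \<delta>: "\<delta> > 0" using mn c by (simp add: \<delta>_def)
    have c\<delta>: "c * \<delta> < \<epsilon>" "c * \<delta> < pi / \<omega>" proof -
      have "c * \<delta> = min \<epsilon> (pi / \<omega>) / 2" using c by (simp add: \<delta>_def)
      then show "c * \<delta> < \<epsilon>" "c * \<delta> < pi / \<omega>" using mn by (auto simp: min_def split: if_splits)
    qed
    then have "\<delta> < \<epsilon>" using \<delta> mult_right_mono[OF c(1), of \<delta>] by linarith
    have "strand_direction ?L (cyl3 (2 * cis (\<omega> * m), h m j))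
      (cyl3 (of_real \<delta> * Complex (a j) (2 * \<omega> * b j) * cis (\<omega> * m), 0))"
    proof (rule strand_direction_polar[where \<rho> = "c * \<delta>" and \<eta> = \<eta>])
      show "\<omega> * (c * \<delta>) < pi" using c\<delta>(2) Y(2) by (simp add: less_divide_eq mult.commute)
      show "\<bar>b j\<bar> * \<delta> \<le> c * \<delta>" using c \<delta> by (simp add: mult_right_mono)
      fix x y z assume xyz: "\<bar>x\<bar> < \<delta>" "\<bar>y\<bar> < c * \<delta>" "\<bar>z - h m j\<bar> < \<eta>"
      have "(of_real (2 + x) * cis (\<omega> * (m + y)), z) \<in> polar_link \<omega> R \<longleftrightarrow> R (m + y) (2 + x) z"
      proof
        assume "(of_real (2 + x) * cis (\<omega> * (m + y)), z) \<in> polar_link \<omega> R"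
        then obtain y' r' where e: "R y' r' z" "of_real r' * cis (\<omega> * y') = of_real (2 + x) * cis (\<omega> * (m + y))"
          unfolding polar_link_def by auto
        have int: "0 < m + y" "m + y < Y" "0 < 2 + x"
          using M(2)[OF m] xyz c\<delta> \<open>\<delta> < \<epsilon>\<close> \<epsilon>(2) by linarith+
        then have "r' = 2 + x" "y' = m + y"
          using polar_eq_iff[OF _ _ Y _ _ _ _ e(2)] range[OF e(1)] by force+
        then show "R (m + y) (2 + x) z" using e(1) by simp
      qed (unfold polar_link_def, blast)
      also have "\<dots> \<longleftrightarrow> (\<exists>i<4. y = \<sigma> i * x \<and> z = h m i) \<or> (x = 0 \<and> z = h m 4)"
        using loc[OF m] xyz c\<delta> \<open>\<delta> < \<epsilon>\<close> by simp
      also have "\<dots> \<longleftrightarrow> (if j < 4 then y = \<sigma> j * x else x = 0) \<and> z = h m j"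
      proof -
        have z: "i = j" if "i < 5" "z = h m i" for i using that \<eta>(2)[of i] xyz(3) by simp
        show ?thesis
        proof (cases "j < 4")
          case True
          have "i = j" if "i < 4" "z = h m i" for i using z[of i] that by simp
          moreover have "z \<noteq> h m 4" using z[of 4] True by auto
          ultimately show ?thesis using True by auto
        next
          case False
          then have "j = 4" using j by simp
          moreover have "z \<noteq> h m i" if "i < 4" for i using z[of i] that False by auto
          ultimately show ?thesis by auto
        qed
      qed
      also have "\<dots> \<longleftrightarrow> (\<exists>\<tau>\<in>{-1<..<1}. x = a j * \<delta> * \<tau> \<and> y = b j * \<delta> * \<tau> \<and> z = h m j)"
      proof (cases "j < 4")
        case True
        have "x / \<delta> \<in> {-1<..<1}" "\<delta> * (x / \<delta>) = x" using xyz(1) \<delta> by (auto simp: abs_less_iff field_simps)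
        then show ?thesis using True by (auto simp: a_def b_def intro!: bexI[of _ "x / \<delta>"])
      next
        case False
        then have "\<bar>y\<bar> < \<delta>" using xyz(2) by (simp add: c_def)
        then have "y / \<delta> \<in> {-1<..<1}" "\<delta> * (y / \<delta>) = y" using \<delta> by (auto simp: abs_less_iff field_simps)
        then show ?thesis using False by (auto simp: a_def b_def intro!: bexI[of _ "y / \<delta>"])
      qed
      finally show "(of_real (2 + x) * cis (\<omega> * (m + y)), z) \<in> polar_link \<omega> R \<longleftrightarrow>
        (\<exists>\<tau>\<in>{-1<..<1}. x = a j * \<delta> * \<tau> \<and> y = b j * \<delta> * \<tau> \<and> z = h m j)" .
    qed (use \<delta> c \<eta> Y \<epsilon> \<open>\<delta> < \<epsilon>\<close> in \<open>auto simp: a_def b_def\<close>)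
    then show ?thesis using \<delta> by blast
  qed
  have "finite {q \<in> ?L. proj2 q = p} \<and> card {q \<in> ?L. proj2 q = p} = 5 \<and>
      (\<exists>v. (\<forall>q\<in>{q \<in> ?L. proj2 q = p}. strand_direction ?L q (v q)) \<and>
           (\<forall>q\<in>{q \<in> ?L. proj2 q = p}. \<forall>q'\<in>{q \<in> ?L. proj2 q = p}.
              q \<noteq> q' \<longrightarrow> \<not> collinear {0, proj2 (v q), proj2 (v q')}))"
    if p: "p \<in> multiple_points proj2 ?L" for p
  proof -
    obtain m where m: "m \<in> M" "p = proj2 (cyl3 (2 * cis (\<omega> * m), 0))" using subsetD[OF sub p] by blast
    define F where "F j = cyl3 (2 * cis (\<omega> * m), h m j)" for j
    have fib: "{q \<in> ?L. proj2 q = p} = F ` {..<5}" using fibre[OF m(1)] m(2) by (simp add: F_def)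
    have injF: "inj_on F {..<5}"
    proof (rule inj_onI)
      fix i j assume ij: "i \<in> {..<5}" "j \<in> {..<5}" "F i = F j"
      then have "F i $ 3 = F j $ 3" by simp
      then show "i = j" using inj_h[OF m(1)] ij by (auto simp: F_def inj_on_def)
    qed
    obtain \<delta> where \<delta>: "\<And>j. j < 5 \<Longrightarrow> \<delta> j > 0"
      "\<And>j. j < 5 \<Longrightarrow> strand_direction ?L (F j) (cyl3 (of_real (\<delta> j) * Complex (a j) (2 * \<omega> * b j) * cis (\<omega> * m), 0))"
      using dir[OF m(1)] unfolding F_def by metis
    define V where "V j = cyl3 (of_real (\<delta> j) * Complex (a j) (2 * \<omega> * b j) * cis (\<omega> * m), 0)" for j
    define v where "v q = V (the_inv_into {..<5} F q)" for q
    have v: "v (F j) = V j" if "j < 5" for j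
      using injF that by (simp add: v_def the_inv_into_f_f)
    have "\<not> collinear {0, proj2 (V i), proj2 (V j)}" if ij: "i < 5" "j < 5" "i \<noteq> j" for i j
    proof (rule not_collinear_cross)
      have cs: "cos (\<omega> * m) * cos (\<omega> * m) + sin (\<omega> * m) * sin (\<omega> * m) = 1"
        using sin_cos_squared_add3[of "\<omega> * m"] by (simp add: mult.commute)
      \<comment> \<open>The rotation by \<open>\<omega> * m\<close> has determinant 1 and drops
        out.\<close>
      have "proj2 (V i) $ 1 * proj2 (V j) $ 2 - proj2 (V i) $ 2 * proj2 (V j) $ 1 =
        \<delta> i * \<delta> j * (2 * \<omega>) * (a i * b j - a j * b i) *
          (cos (\<omega> * m) * cos (\<omega> * m) + sin (\<omega> * m) * sin (\<omega> * m))"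
        by (simp add: V_def algebra_simps del: sin_cos_squared_add3)
      also have "\<dots> = \<delta> i * \<delta> j * (2 * \<omega>) * (a i * b j - a j * b i)" by (simp only: cs mult_1_right)
      finally have eq: "proj2 (V i) $ 1 * proj2 (V j) $ 2 - proj2 (V i) $ 2 * proj2 (V j) $ 1 =
        \<delta> i * \<delta> j * (2 * \<omega>) * (a i * b j - a j * b i)" .
      have "a i * b j - a j * b i \<noteq> 0"
        using ij inj_\<sigma> by (auto simp: a_def b_def inj_on_def)
      then show "proj2 (V i) $ 1 * proj2 (V j) $ 2 - proj2 (V i) $ 2 * proj2 (V j) $ 1 \<noteq> 0"
        unfolding eq using \<delta>(1) ij Y(2) by (simp add: less_imp_neq[THEN not_sym])
    qed
    then have "\<forall>q\<in>F ` {..<5}. \<forall>q'\<in>F ` {..<5}. q \<noteq> q' \<longrightarrow> \<not> collinear {0, proj2 (v q), proj2 (v q')}"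
      using v by auto
    moreover have "\<forall>q\<in>F ` {..<5}. strand_direction ?L q (v q)" using v \<delta>(2) by (auto simp: V_def)
    moreover have "card (F ` {..<5}) = 5" using card_image[OF injF] by simp
    ultimately show ?thesis unfolding fib by blast
  qed
  then have "n_crossing_projection 5 proj2 ?L"
    unfolding n_crossing_projection_def
    using linear_proj2 surj_proj2 finite_subset[OF sub finite_imageI[OF M(1)]] by blast
  with card show ?thesis by blast
qed

section \<open>Even t\<close>

text \<open>Applied to maps that discard coordinates, it keeps the case analysis over edges
  small.\<close>

lemma segments_linear_image:
  assumes "linear f"
  shows "segments (map f ps) = f ` segments ps"
  by (induction ps rule: segments.induct) (auto simp: closed_segment_linear_image[OF assms] image_Un)

lemma closed_segment_2:
  fixes x y :: real
  shows "(x, y) \<in> closed_segment (x0, y0) (x1, y1) \<longleftrightarrow>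
     (\<exists>u. 0 \<le> u \<and> u \<le> 1 \<and> x = x0 + u * (x1 - x0) \<and> y = y0 + u * (y1 - y0))"
  by (auto simp: in_segment algebra_simps)

lemma closed_segment_3:
  fixes x y z :: real
  shows "(x, y, z) \<in> closed_segment (x0, y0, z0) (x1, y1, z1) \<longleftrightarrow>
     (\<exists>u. 0 \<le> u \<and> u \<le> 1 \<and> x = x0 + u * (x1 - x0) \<and> y = y0 + u * (y1 - y0) \<and> z = z0 + u * (z1 - z0))"
  by (auto simp: in_segment algebra_simps)

text \<open>Degrees keep the vertex data rational. The angles of \<open>even_block\<close> and
  \<open>odd_block\<close> lie in this range, so only five vertical positions can occur.\<close>

lemma cos_degrees_zero:
  assumes "cos (b * pi / 180) = 0" "-200 \<le> b" "b \<le> 700"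
  shows "(b = -90 \<and> sin (b * pi / 180) = -1) \<or> (b = 90 \<and> sin (b * pi / 180) = 1) \<or>
    (b = 270 \<and> sin (b * pi / 180) = -1) \<or> (b = 450 \<and> sin (b * pi / 180) = 1) \<or>
    (b = 630 \<and> sin (b * pi / 180) = -1)"
proof -
  obtain i where i: "odd i" "b * pi / 180 = of_int i * (pi / 2)"
    using assms(1) cos_zero_iff_int by blast
  then have b: "b = 90 * of_int i" by (simp add: field_simps)
  have "i \<in> {-1, 1, 3, 5, 7}"
  proof -
    have "-200 \<le> 90 * real_of_int i" "90 * real_of_int i \<le> 700" using assms(2,3) by (simp_all add: b)
    then have "-200 \<le> 90 * i" "90 * i \<le> 700" by linarith+
    then have "-2 \<le> i" "i \<le> 7" by linarith+
    then show ?thesis using i(1) by simp presburger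
  qed
  moreover have "sin (3 * pi / 2) = -1" "sin (5 * pi / 2) = 1" "sin (7 * pi / 2) = -1"
    using sin_periodic[of "pi / 2"] sin_periodic[of "3 * pi / 2"] sin_3over2_pi
    by (simp_all add: field_simps)
  ultimately show ?thesis by (auto simp: b i(2)[unfolded b])
qed

text \<open>The angles at which a block passes height 0. Their cosines are rational, and so are the
  ratios of radii \<open>(2 + cos b) / (2 - cos b)\<close>: 5/3, 3/5, 3 and 1/3.\<close>

lemma cos_degrees:
  "cos (- 60 * pi / 180) = 1/2" "cos (120 * pi / 180) = -1/2" "cos (360 * pi / 180) = 1"
  "cos (540 * pi / 180) = -1" "cos (- 180 * pi / 180) = -1"
  using cos_60 cos_120 cos_periodic[of pi] by (simp_all add: algebra_simps)

text \<open>One turn of the closed braid for even \<open>t\<close>: the vertices \<open>(s, x, z, y, b)\<close> give the time, the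
  distance \<open>x\<close> from the circle of radius 2, the height, the final angular position, and the angle in
  degrees of the standard braid. All four passages over \<open>x = 0\<close> end up at \<open>y = 24\<close>. The last block
  for \<open>t = 4 n - 2\<close> is the one with \<open>e\<close>; its fourth passage is at height 5 and undoes the third.\<close>

definition even_block :: "bool \<Rightarrow> (real \<times> real \<times> real \<times> real \<times> real) list" where
  "even_block e =
     [(0, -4/3, 3, 0, -45), (8, -4/3, 3, 8, -45), (11, 4/3, 3, 40, -45),
      (25/2, 4/3, 0, 36, -60), (14, 4/3, -3, 32, 165), (17, -4/5, -3, 96/5, 165),
      (128/7, -4/5, 0, 156/7, 120), (20, -4/5, 4, 132/5, 420), (23, 4, 4, 12, 420)] @
     (if e then [(26, 4, 5, 0, 420), (29, -4/3, 5, 32, 420), (48, -4/3, 3, 48, 315)]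
      else [(49/2, 4, 0, 6, 360), (26, 4, -4, 0, 540), (29, -4/3, -4, 32, 540),
        (279/7, -4/3, 0, 288/7, 540), (48, -4/3, 3, 48, 675)])"

lemmas even_block_unfold = even_block_def append.simps if_True if_False list.map prod.case
  segments.simps Un_iff closed_segment_2 closed_segment_3 singleton_iff prod.inject

lemma even_block_zb:
  assumes "(s, x, z, y, b) \<in> segments (even_block e)"
  shows "(z, b) \<in> segments (map (\<lambda>(s, x, z, y, b). (z, b)) (even_block e))"
proof -
  have "linear (\<lambda>(s::real, x::real, z::real, y::real, b::real). (z, b))"
    by (rule linearI) auto
  from segments_linear_image[OF this] show ?thesis using assms by force
qed

lemma even_block_xzb:
  assumes "(s, x, z, y, b) \<in> segments (even_block e)"
  shows "(x, z, b) \<in> segments (map (\<lambda>(s, x, z, y, b). (x, z, b)) (even_block e))"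
proof -
  have "linear (\<lambda>(s::real, x::real, z::real, y::real, b::real). (x, z, b))"
    by (rule linearI) auto
  from segments_linear_image[OF this] show ?thesis using assms by force
qed

lemma even_block_xzo:
  assumes "(s, x, z, y, b) \<in> segments (even_block e)"
  shows "(x, z, y - s) \<in> segments (map (\<lambda>(s, x, z, y, b). (x, z, y - s)) (even_block e))"
proof -
  have "linear (\<lambda>(s::real, x::real, z::real, y::real, b::real). (x, z, y - s))"
    by (rule linearI) (auto simp: algebra_simps)
  from segments_linear_image[OF this] show ?thesis using assms by force
qed

definition even_curve :: "bool \<Rightarrow> (real \<times> real \<times> real) set" where
  "even_curve e = (\<lambda>(s, x, z, y, b). (x, z, y)) ` segments (even_block e)"

lemma even_curve_eq: "even_curve e = segments (map (\<lambda>(s, x, z, y, b). (x, z, y)) (even_block e))"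
proof -
  have "linear (\<lambda>(s::real, x::real, z::real, y::real, b::real). (x, z, y))"
    by (rule linearI) auto
  from segments_linear_image[OF this] show ?thesis by (simp add: even_curve_def)
qed

lemma even_block_vertical_aux:
  assumes "(z, b) \<in> segments (map (\<lambda>(s, x, z, y, b). (z, b)) (even_block e))"
    and "(b = -90 \<and> S = -1) \<or> (b = 90 \<and> S = 1) \<or> (b = 270 \<and> S = -1) \<or> (b = 450 \<and> S = 1) \<or> (b = 630 \<and> S = -1)"
  shows "z = - 2 * S"
  using assms
  apply (cases e)
   apply (simp_all only: even_block_unfold)
   apply (elim disjE exE conjE; (simp | (simp; linarith))?)+
  done

text \<open>On the edges that pass a vertical position the angle changes by 75 or 45 degrees per
  unit of height, so that odd multiples of 90 are met at height 2 or -2. For example, it runs from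
  -60 to 165 while the height falls from 0 to -3, and is 90 at -2.\<close>

lemma even_block_vertical:
  assumes "(s, x, z, y, b) \<in> segments (even_block e)" "cos (b * pi / 180) = 0"
  shows "z = - 2 * sin (b * pi / 180)"
proof -
  have "-200 \<le> b \<and> b \<le> 700"
    using even_block_zb[OF assms(1)]
    apply (cases e)
     apply (simp_all only: even_block_unfold)
     apply (elim disjE exE conjE; (simp | (simp; linarith))?)+
    done
  with even_block_vertical_aux[OF even_block_zb[OF assms(1)] cos_degrees_zero[OF assms(2)]]
  show ?thesis by blast
qed

text \<open>This fixes \<open>x\<close> where the block passes height 0. Against the core at radius
  2 the radius has to be \<open>2 * (2 + cos b) / (2 - cos b)\<close>, that is 10/3, 6/5, 6 and 2/3
  for -60, 120, 360 and 540 degrees.\<close>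

lemma even_block_horizontal:
  assumes "(s, x, z, y, b) \<in> segments (even_block e)" "z = 0"
  shows "(2 + x) * (2 - cos (b * pi / 180)) = 2 * (2 + cos (b * pi / 180))"
proof -
  have "(b = -60 \<and> x = 4/3) \<or> (b = 120 \<and> x = -4/5) \<or> (b = 360 \<and> x = 4) \<or> (b = 540 \<and> x = -4/3)"
    using even_block_xzb[OF assms(1)] assms(2)
    apply (cases e)
     apply (simp_all only: even_block_unfold)
     apply (elim disjE exE conjE; (simp | (simp; linarith))?)+
    done
  then show ?thesis by (elim disjE conjE) (simp_all only: cos_degrees, simp_all)
qed

text \<open>In the \<open>(x, z)\<close> plane the path of a block closes up at
  \<open>(-4/3, 3)\<close> with displacement 0 and crosses itself at \<open>(-4/5, 3)\<close>, where
  both displacements \<open>y - s\<close> are 29/5. Comparing the two types of block lets one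
  rotation serve the whole chain.\<close>

lemma even_block_twist:
  assumes "(s, x, z, y, b) \<in> segments (even_block e)" "(s', x, z, y', b') \<in> segments (even_block e')"
  shows "y - s = y' - s'"
  using even_block_xzo[OF assms(1)] even_block_xzo[OF assms(2)]
  apply (cases e; cases e')
     apply (simp_all only: even_block_unfold)
     apply (elim disjE exE conjE; (simp | (simp; linarith))?)+
  done

lemma even_curve_bounds:
  assumes "(x, z, y) \<in> even_curve e"
  shows "-4/3 \<le> x \<and> 0 \<le> y \<and> y \<le> 48 \<and> (y = 48 \<longrightarrow> x = -4/3) \<and> (y = 48 \<longrightarrow> z = 3) \<and>
    (y = 0 \<longrightarrow> x < 0 \<longrightarrow> z = 3) \<and> (x = 0 \<longrightarrow> y = 24) \<and> (x = 0 \<longrightarrow> z \<noteq> 0)"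
  using assms
  apply (cases e)
   apply (simp_all only: even_curve_eq even_block_unfold)
   apply (elim disjE exE conjE; (intro conjI impI; (simp | (simp; linarith)))?)+
  done

text \<open>The positions \<open>y\<close> of the vertices are such that projected edges of a block
  meet at different heights only over radius 2; all pairs of edges are checked.\<close>

lemma even_curve_planar:
  assumes "(x, z, y) \<in> even_curve e" "(x, z', y) \<in> even_curve e" "z \<noteq> z'"
  shows "x = 0"
  using assms
  apply (cases e)
   apply (simp_all only: even_curve_eq even_block_unfold)
   apply (elim disjE exE conjE; (simp | (simp; linarith))?)+
  done

lemma even_curve_crossing:
  assumes "\<bar>x\<bar> < 1/2"
  shows "(x, z, 24 + y) \<in> even_curve e \<longleftrightarrow>
    (y = 12 * x \<and> z = 3) \<or> (y = 6 * x \<and> z = -3) \<or> (y = -3 * x \<and> z = 4) \<or>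
    (y = -6 * x \<and> z = (if e then 5 else -4))" (is "?L \<longleftrightarrow> ?R")
proof
  assume ?L
  then show ?R
    using assms
    apply (cases e)
     apply (simp_all only: even_curve_eq even_block_unfold)
     apply (elim disjE exE conjE; (simp | (simp; linarith))?)+
    done
next
  \<comment> \<open>On the four edges across \<open>x = 0\<close>, of widths 8/3, 32/15, 24/5 and
    16/3, these values of \<open>u\<close> solve \<open>x = x0 + u * (x1 - x0)\<close>.\<close>
  have u: "\<bar>x\<bar> < 1/2 \<Longrightarrow> 0 \<le> (x + 4/3) * (3/8) \<and> (x + 4/3) * (3/8) \<le> 1"
    "\<bar>x\<bar> < 1/2 \<Longrightarrow> 0 \<le> (4/3 - x) * (15/32) \<and> (4/3 - x) * (15/32) \<le> 1"
    "\<bar>x\<bar> < 1/2 \<Longrightarrow> 0 \<le> (x + 4/5) * (5/24) \<and> (x + 4/5) * (5/24) \<le> 1"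
    "\<bar>x\<bar> < 1/2 \<Longrightarrow> 0 \<le> (4 - x) * (3/16) \<and> (4 - x) * (3/16) \<le> 1"
    by (auto simp: abs_less_iff)
  assume ?R
  then consider "y = 12 * x" "z = 3" | "y = 6 * x" "z = -3" | "y = -3 * x" "z = 4"
    | "y = -6 * x" "z = (if e then 5 else -4)" by blast
  then show ?L
  proof cases
    case 1
    have "(x, z, 24 + y) \<in> closed_segment (-4/3, 3, 8) (4/3, 3, 40)"
      unfolding closed_segment_3 using u(1)[OF assms] 1
      by (intro exI[of _ "(x + 4/3) * (3/8)"]) (simp add: field_simps)
    then show ?thesis by (simp add: even_curve_eq even_block_def)
  next
    case 2
    have "(x, z, 24 + y) \<in> closed_segment (4/3, -3, 32) (-4/5, -3, 96/5)"
      unfolding closed_segment_3 using u(2)[OF assms] 2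
      by (intro exI[of _ "(4/3 - x) * (15/32)"]) (simp add: field_simps)
    then show ?thesis by (simp add: even_curve_eq even_block_def)
  next
    case 3
    have "(x, z, 24 + y) \<in> closed_segment (-4/5, 4, 132/5) (4, 4, 12)"
      unfolding closed_segment_3 using u(3)[OF assms] 3
      by (intro exI[of _ "(x + 4/5) * (5/24)"]) (simp add: field_simps)
    then show ?thesis by (cases e) (simp_all add: even_curve_eq even_block_def)
  next
    case 4
    have "(x, z, 24 + y) \<in> closed_segment (4, if e then 5 else -4, 0) (-4/3, if e then 5 else -4, 32)"
      unfolding closed_segment_3 using u(4)[OF assms] 4
      by (intro exI[of _ "(4 - x) * (3/16)"]) (simp add: field_simps)
    then show ?thesis by (cases e) (simp_all add: even_curve_eq even_block_def)
  qed
qed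

lemma polyline_segments:
  assumes "sorted_wrt (<) (map fst ps)" "ps \<noteq> []" "(a, v) \<in> segments ps"
  shows "polyline ps a = v" "a \<in> {fst (hd ps)..fst (last ps)}"
proof -
  have "(a, v) \<in> (\<lambda>\<tau>. (\<tau>, polyline ps \<tau>)) ` {fst (hd ps)..fst (last ps)}"
    using polyline_graph[OF assms(1,2)] assms(3) by simp
  then show "polyline ps a = v" "a \<in> {fst (hd ps)..fst (last ps)}" by auto
qed

lemma even_curve_y:
  assumes "(x, z, y) \<in> even_curve e"
  shows "0 \<le> y" "y \<le> 48"
  using even_curve_bounds[OF assms] by auto

lemma segments_last: "ps \<noteq> [] \<Longrightarrow> last ps \<in> segments ps"
  by (induction ps rule: segments.induct) auto

lemma crossing_number_torus_link2_le:
  assumes "t > 0" and iso: "isotopic {torus_point t \<theta> j | \<theta> j. True} L"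
    and cross: "n_crossing_projection 5 proj2 (cyl3 ` L)"
      "card (multiple_points proj2 (cyl3 ` L)) \<le> n"
  shows "n_crossing_number 5 (torus_link2 t) \<le> enat n"
proof -
  have "ambient_isotopic (torus_link2 t) (cyl3 ` L)"
    unfolding torus_link2_eq[OF assms(1)] using iso by (rule ambient_isotopic_cyl3)
  then have "n_crossing_number 5 (torus_link2 t) \<le> enat (card (multiple_points proj2 (cyl3 ` L)))"
    unfolding n_crossing_number_def using cross(1) by (intro Inf_lower) blast
  also have "\<dots> \<le> enat n" using cross(2) by simp
  finally show ?thesis .
qed

lemma even_case:
  fixes t n :: nat
  assumes t: "t = 4 * n - (if e then 2 else 0)" and n: "n > 0"
  shows "n_crossing_number 5 (torus_link2 t) \<le> enat n"
proof -
  \<comment> \<open>Only the last block can be the special one; it ends at 315 instead of 675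
    degrees, which would not fit the start of a further block.\<close>
  define sp where "sp k \<longleftrightarrow> e \<and> k = n - 1" for k
  define c :: "nat \<Rightarrow> real \<times> real \<times> real \<times> real \<times> real"
    where "c k = (48 * real k, 0, 0, 48 * real k, 720 * real k)" for k
  define B where "B k = map ((+) (c k)) (even_block (sp k))" for k
  define ps where "ps = join B n"
  have B: "sorted_wrt (<) (map fst (B k))" "B k \<noteq> []" "tl (B k) \<noteq> []" for k
    by (cases "sp k"; simp add: B_def even_block_def c_def)+
  have hdB: "hd (B k) = (48 * real k, -4/3, 3, 48 * real k, 720 * real k - 45)" for k
    by (simp add: B_def even_block_def c_def)
  have lastB: "last (B k) = (48 * real k + 48, -4/3, 3, 48 * real k + 48, 720 * real k + (if sp k then 315 else 675))" for k
    by (simp add: B_def even_block_def c_def)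
  have link: "last (B k) = hd (B (Suc k))" if "Suc k < n" for k
    unfolding lastB hdB using that by (auto simp: sp_def algebra_simps)
  have join: "sorted_wrt (<) (map fst ps)" "ps \<noteq> []" "hd ps = hd (B 0)" "last ps = last (B (n - 1))"
    "segments ps = (\<Union>k<n. segments (B k))"
    unfolding ps_def using join_props[of n B, OF B link n] by blast+
  define q where "q = polyline ps"
  have hdps: "hd ps = (0, -4/3, 3, 0, -45)" using join(3) hdB[of 0] by simp
  have lastps: "last ps = (48 * real n, -4/3, 3, 48 * real n, 720 * real n - (if e then 405 else 45))"
    unfolding join(4) lastB using n by (simp add: sp_def of_nat_diff algebra_simps)
  have seg: "segments ps = (\<Union>k<n. (+) (c k) ` segments (even_block (sp k)))"
    unfolding join(5) B_def segments_translate ..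
  note poly = polyline_segments[OF join(1,2), folded q_def]
  have graph: "(\<lambda>\<tau>. (\<tau>, q \<tau>)) ` {0..48 * real n} = segments ps"
    using polyline_graph[OF join(1,2)] hdps lastps by (simp add: q_def)
  have q_block: "\<exists>k<n. \<exists>s' x z y b. (s', x, z, y, b) \<in> segments (even_block (sp k)) \<and>
      s = 48 * real k + s' \<and> q s = (x, z, 48 * real k + y, 720 * real k + b)" if "s \<in> {0..48 * real n}" for s
  proof -
    have "(s, q s) \<in> segments ps" using that graph by blast
    then show ?thesis unfolding seg by (force simp: c_def)
  qed
  have block_q: "48 * real k + s \<in> {0..48 * real n}" "q (48 * real k + s) = (x, z, 48 * real k + y, 720 * real k + b)"
    if "k < n" "(s, x, z, y, b) \<in> segments (even_block (sp k))" for k s x z y b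
  proof -
    have "(48 * real k + s, x, z, 48 * real k + y, 720 * real k + b) \<in> segments ps"
      unfolding seg using that by (auto simp: c_def intro!: bexI[of _ k] image_eqI[of _ _ "(s, x, z, y, b)"])
    from poly[OF this] show "48 * real k + s \<in> {0..48 * real n}"
      "q (48 * real k + s) = (x, z, 48 * real k + y, 720 * real k + b)"
      using hdps lastps by auto
  qed
  have q_ends: "q 0 = (-4/3, 3, 0, -45)"
    "q (48 * real n) = (-4/3, 3, 48 * real n, 720 * real n - (if e then 405 else 45))"
    using poly(1)[of 0] poly(1)[of "48 * real n"] segments_hd[OF join(2)] segments_last[OF join(2)]
    unfolding hdps lastps by blast+
  define X Z Yc b where "X s = fst (q s)" and "Z s = fst (snd (q s))"
    and "Yc s = fst (snd (snd (q s)))" and "b s = snd (snd (snd (q s)))" for s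
  have q_eq: "q s = (X s, Z s, Yc s, b s)" for s by (simp add: X_def Z_def Yc_def b_def)
  have contq: "continuous_on S q" for S unfolding q_def by (rule continuous_on_polyline)
  have cont: "continuous_on S X" "continuous_on S Z" "continuous_on S Yc" "continuous_on S b" for S
    unfolding X_def Z_def Yc_def b_def by (intro continuous_intros contq)+
  define Y \<omega> where "Y = 48 * real n" and "\<omega> = 2 * pi / Y"
  have Y: "Y > 0" and \<omega>: "\<omega> > 0" "\<omega> * Y = 2 * pi" using n by (simp_all add: Y_def \<omega>_def)
  have block: "\<exists>k<n. \<exists>s' y b'. (s', X s, Z s, y, b') \<in> segments (even_block (sp k)) \<and>
      s = 48 * real k + s' \<and> Yc s = 48 * real k + y \<and> b s = 720 * real k + b'" if "s \<in> {0..Y}" for s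
    using q_block[of s] that unfolding Y_def q_eq by force
  have ends: "X 0 = -4/3" "Z 0 = 3" "X Y = -4/3" "Z Y = 3" "b 0 = -45"
    "b Y = 720 * real n - (if e then 405 else 45)"
    using q_ends unfolding q_eq Y_def by auto
  have shift: "cos ((720 * real k + b') * pi / 180) = cos (b' * pi / 180)"
    "sin ((720 * real k + b') * pi / 180) = sin (b' * pi / 180)" for k b'
  proof -
    have "(720 * real k + b') * pi / 180 = b' * pi / 180 + 2 * pi * of_int (int (2 * k))"
      by (simp add: field_simps)
    then show "cos ((720 * real k + b') * pi / 180) = cos (b' * pi / 180)"
      "sin ((720 * real k + b') * pi / 180) = sin (b' * pi / 180)"
      using cis_add_2pi_int[of "b' * pi / 180" "int (2 * k)"] by (simp_all only: complex_eq_iff cis.sel)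
  qed
  have curve: "(X s, Z s, y) \<in> even_curve (sp k)" if "(s', X s, Z s, y, b') \<in> segments (even_block (sp k))" for s s' y b' k
    using that unfolding even_curve_def by force
  \<comment> \<open>Strand 0 follows the blocks; strand 1 is the core circle, which is not
    displaced.\<close>
  define r z \<phi> where "r i \<theta> = (if i = 0 then 2 + X (\<theta> / \<omega>) else 2)"
    and "z i \<theta> = (if i = 0 then Z (\<theta> / \<omega>) else 0)"
    and "\<phi> i \<theta> = (if i = 0 then \<omega> * Yc (\<theta> / \<omega>) else \<theta>)" for i :: nat and \<theta> :: real
  define \<beta> where "\<beta> \<theta> = b (\<theta> / \<omega>) * pi / 180" for \<theta>
  have time: "\<theta> / \<omega> \<in> {0..Y}" if "\<theta> \<in> {0..0 + 2 * pi}" for \<theta>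
    using that \<omega> by (simp add: divide_le_eq mult.commute)
  have end_time: "(0 + 2 * pi) / \<omega> = Y" using \<omega> by (simp add: field_simps)
  have iso: "isotopic {torus_point t \<theta> j | \<theta> j. True}
    ((\<lambda>(\<theta>, i). (of_real (r i \<theta>) * cis (\<phi> i \<theta>), z i \<theta>)) ` ({0..0 + 2 * pi} \<times> {..<2}))"
  proof (rule braid_closed_isotopic[where \<beta> = \<beta>])
    show "continuous_on {0..0 + 2 * pi} (r i)" "continuous_on {0..0 + 2 * pi} (z i)"
      "continuous_on {0..0 + 2 * pi} (\<phi> i)" for i
      unfolding r_def[abs_def] z_def[abs_def] \<phi>_def[abs_def] using \<omega>(1)
      by (cases "i = 0"; auto intro!: continuous_intros continuous_on_compose2[OF cont(1)]
          continuous_on_compose2[OF cont(2)] continuous_on_compose2[OF cont(3)])+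
    show "continuous_on {0..0 + 2 * pi} \<beta>"
      unfolding \<beta>_def[abs_def] using \<omega>(1)
      by (auto intro!: continuous_intros continuous_on_compose2[OF cont(4)])
    show "r i \<theta> > 0" if \<theta>: "\<theta> \<in> {0..0 + 2 * pi}" for i \<theta>
      using block[OF time[OF \<theta>]] even_curve_bounds[OF curve] by (fastforce simp: r_def)
    \<comment> \<open>The angle runs from -45 to \<open>720 * n - 45\<close> or
      \<open>720 * n - 405\<close> degrees, in total \<open>4 * n\<close> or
      \<open>4 * n - 2\<close> half turns.\<close>
    show "\<beta> (0 + 2 * pi) = \<beta> 0 + t * pi"
      unfolding \<beta>_def end_time using t n by (simp add: ends of_nat_diff field_simps)
    have "even t" using t n by auto
    then have m: "(i + t) mod 2 = i" if "i < 2" for i using that by (auto elim!: evenE)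
    show "r i (0 + 2 * pi) = r ((i + t) mod 2) 0" "z i (0 + 2 * pi) = z ((i + t) mod 2) 0" if "i < 2" for i
      unfolding r_def z_def end_time m[OF that] by (simp_all add: ends)
  next
    fix \<theta> assume \<theta>: "\<theta> \<in> {0..0 + 2 * pi}"
    obtain k s' y b' where blk: "(s', X (\<theta> / \<omega>), Z (\<theta> / \<omega>), y, b') \<in> segments (even_block (sp k))"
        "b (\<theta> / \<omega>) = 720 * real k + b'"
      using block[OF time[OF \<theta>]] by blast
    have cs: "cos (\<beta> \<theta>) = cos (b' * pi / 180)" "sin (\<beta> \<theta>) = sin (b' * pi / 180)"
      unfolding \<beta>_def blk(2) shift by simp_all
    show "z 0 \<theta> - z 1 \<theta> = - 2 * sin (\<beta> \<theta>)" if "cos (\<beta> \<theta>) = 0"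
      using even_block_vertical[OF blk(1)] that unfolding cs by (simp add: z_def)
    show "r 0 \<theta> * (2 - cos (\<beta> \<theta>)) = r 1 \<theta> * (2 + cos (\<beta> \<theta>))" if "z 0 \<theta> = z 1 \<theta>"
      using even_block_horizontal[OF blk(1)] that unfolding cs by (simp add: z_def r_def)
  next
    fix i j :: nat and \<theta> \<theta>' :: real
    assume ij: "i < 2" "j < 2" and \<theta>: "\<theta> \<in> {0..0 + 2 * pi}" "\<theta>' \<in> {0..0 + 2 * pi}"
      and eq: "r i \<theta> = r j \<theta>'" "z i \<theta> = z j \<theta>'"
    \<comment> \<open>Strand 0 avoids radius 2 at height 0, so its displacements never conflict with
      the undisplaced core.\<close>
    have ne: "\<not> (X (\<theta> / \<omega>) = 0 \<and> Z (\<theta> / \<omega>) = 0)" if \<theta>: "\<theta> \<in> {0..0 + 2 * pi}" for \<theta>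
      using block[OF time[OF \<theta>]] even_curve_bounds[OF curve] by blast
    have shift_eq: "\<phi> 0 \<theta> - \<theta> = \<omega> * (Yc (\<theta> / \<omega>) - \<theta> / \<omega>)" for \<theta> using \<omega>(1) by (simp add: \<phi>_def algebra_simps)
    show "\<phi> i \<theta> - \<theta> = \<phi> j \<theta>' - \<theta>'"
    proof (cases "i = 0 \<and> j = 0")
      case True
      then have XZ: "X (\<theta> / \<omega>) = X (\<theta>' / \<omega>)" "Z (\<theta> / \<omega>) = Z (\<theta>' / \<omega>)" using eq by (simp_all add: r_def z_def)
      obtain k s' y b' where blk: "(s', X (\<theta> / \<omega>), Z (\<theta> / \<omega>), y, b') \<in> segments (even_block (sp k))"
        "\<theta> / \<omega> = 48 * real k + s'" "Yc (\<theta> / \<omega>) = 48 * real k + y"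
        using block[OF time[OF \<theta>(1)]] by blast
      obtain k' s'' y' b'' where blk': "(s'', X (\<theta> / \<omega>), Z (\<theta> / \<omega>), y', b'') \<in> segments (even_block (sp k'))"
        "\<theta>' / \<omega> = 48 * real k' + s''" "Yc (\<theta>' / \<omega>) = 48 * real k' + y'"
        using block[OF time[OF \<theta>(2)]] unfolding XZ by blast
      have "Yc (\<theta> / \<omega>) - \<theta> / \<omega> = Yc (\<theta>' / \<omega>) - \<theta>' / \<omega>"
        using even_block_twist[OF blk(1) blk'(1)] blk(2,3) blk'(2,3) by simp
      then show ?thesis using True shift_eq by simp
    next
      case False
      then have "i = 1 \<and> j = 1" using ij eq ne[OF \<theta>(1)] ne[OF \<theta>(2)] by (auto simp: r_def z_def less_2_cases_iff)
      then show ?thesis by (simp add: \<phi>_def)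
    qed
  qed
  define R where "R y r z \<longleftrightarrow> (\<exists>k<n. (r - 2, z, y - 48 * real k) \<in> even_curve (sp k)) \<or>
      (r = 2 \<and> z = 0 \<and> 0 \<le> y \<and> y \<le> Y)" for y r z :: real
  have link_eq: "(\<lambda>(\<theta>, i). (of_real (r i \<theta>) * cis (\<phi> i \<theta>), z i \<theta>)) ` ({0..0 + 2 * pi} \<times> {..<2}) = polar_link \<omega> R"
  proof (intro subset_antisym subsetI)
    fix p assume "p \<in> (\<lambda>(\<theta>, i). (of_real (r i \<theta>) * cis (\<phi> i \<theta>), z i \<theta>)) ` ({0..0 + 2 * pi} \<times> {..<2})"
    then obtain \<theta> i where i: "\<theta> \<in> {0..0 + 2 * pi}" "i < 2" "p = (of_real (r i \<theta>) * cis (\<phi> i \<theta>), z i \<theta>)" by auto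
    have "\<exists>y. R y (r i \<theta>) (z i \<theta>) \<and> \<phi> i \<theta> = \<omega> * y"
    proof (cases "i = 0")
      case True
      obtain k s' y b' where blk: "k < n" "(s', X (\<theta> / \<omega>), Z (\<theta> / \<omega>), y, b') \<in> segments (even_block (sp k))"
        "Yc (\<theta> / \<omega>) = 48 * real k + y"
        using block[OF time[OF i(1)]] by blast
      then show ?thesis
        using curve[OF blk(2)] True
        by (intro exI[of _ "48 * real k + y"]) (auto simp: R_def r_def z_def \<phi>_def intro!: exI[of _ k])
    next
      case False
      then show ?thesis using time[OF i(1)] \<omega>(1)
        by (intro exI[of _ "\<theta> / \<omega>"]) (auto simp: R_def r_def z_def \<phi>_def)
    qed
    then obtain y where "R y (r i \<theta>) (z i \<theta>)" "p = (of_real (r i \<theta>) * cis (\<omega> * y), z i \<theta>)"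
      unfolding i(3) by metis
    then show "p \<in> polar_link \<omega> R" unfolding polar_link_def by blast
  next
    fix p assume "p \<in> polar_link \<omega> R"
    then obtain y r' z' where p: "p = (of_real r' * cis (\<omega> * y), z')" "R y r' z'" by (auto simp: polar_link_def)
    have th: "\<omega> * s \<in> {0..0 + 2 * pi}" if "s \<in> {0..Y}" for s
      using that \<omega> mult_left_mono[of s Y \<omega>] by auto
    from p(2) consider k where "k < n" "(r' - 2, z', y - 48 * real k) \<in> even_curve (sp k)"
      | "r' = 2" "z' = 0" "y \<in> {0..Y}" by (auto simp: R_def)
    then show "p \<in> (\<lambda>(\<theta>, i). (of_real (r i \<theta>) * cis (\<phi> i \<theta>), z i \<theta>)) ` ({0..0 + 2 * pi} \<times> {..<2})"
    proof cases
      case 1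
      then obtain s b' where "(s, r' - 2, z', y - 48 * real k, b') \<in> segments (even_block (sp k))"
        by (auto simp: even_curve_def)
      from block_q[OF 1(1) this] have s: "48 * real k + s \<in> {0..Y}" "X (48 * real k + s) = r' - 2"
        "Z (48 * real k + s) = z'" "Yc (48 * real k + s) = y"
        unfolding Y_def q_eq by auto
      show ?thesis
        using th[OF s(1)] \<omega>(1) s(2-4)
        by (intro image_eqI[of _ _ "(\<omega> * (48 * real k + s), 0)"]) (auto simp: p(1) r_def z_def \<phi>_def)
    next
      case 2
      then show ?thesis using th[OF 2(3)]
        by (intro image_eqI[of _ _ "(\<omega> * y, 1)"]) (auto simp: p(1) r_def z_def \<phi>_def)
    qed
  qed
  define M where "M = (\<lambda>k. 48 * real k + 24) ` {..<n}"
  define \<sigma> where "\<sigma> j = ([12, 6, -3, -6] :: real list) ! j" for j :: nat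
  \<comment> \<open>Entry 4 is the core; in the special block the fourth passage lies at height 5
    instead of -4.\<close>
  define h where "h m j = ([3, -3, 4, if e \<and> m = 48 * real (n - 1) + 24 then 5 else -4, 0] :: real list) ! j" for m :: real and j :: nat
  \<comment> \<open>Different blocks share a position only at a common end, which the earlier one
    reaches at a single point.\<close>
  have z_end: "z = 3 \<and> x = -4/3" if "(x, z, y - 48 * real k) \<in> even_curve e1" "(x, z', y - 48 * real k') \<in> even_curve e2" "k < k'"
    for x z z' y k k' e1 e2
  proof -
    have "real k + 1 \<le> real k'" using that(3) by linarith
    then have "y - 48 * real k = 48"
      using even_curve_y[OF that(1)] even_curve_y[OF that(2)] by linarith
    then show ?thesis using even_curve_bounds[OF that(1)] by blast
  qed
  have z_start: "z' = 3" if "(x, z, y - 48 * real k) \<in> even_curve e1" "(x, z', y - 48 * real k') \<in> even_curve e2" "k < k'"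
    for x z z' y k k' e1 e2
  proof -
    have "real k + 1 \<le> real k'" using that(3) by linarith
    then have "y - 48 * real k' = 0"
      using even_curve_y[OF that(1)] even_curve_y[OF that(2)] by linarith
    then show ?thesis using even_curve_bounds[OF that(2)] z_end[OF that] by auto
  qed
  have cross: "n_crossing_projection 5 proj2 (cyl3 ` polar_link \<omega> R) \<and>
    card (multiple_points proj2 (cyl3 ` polar_link \<omega> R)) \<le> card M"
  proof (rule polar_link_crossings[where Y = Y and \<epsilon> = "1/100" and \<sigma> = \<sigma> and h = h and M = M])
    fix y r z z' assume R: "R y r z" "R y r z'"
    have AA: "z = z' \<or> y \<in> M \<and> r = 2" if k: "k < n" "(r - 2, z, y - 48 * real k) \<in> even_curve (sp k)"
      "k' < n" "(r - 2, z', y - 48 * real k') \<in> even_curve (sp k')" for k k'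
    proof (cases k k' rule: linorder_cases)
      case equal
      show ?thesis
      proof (rule ccontr)
        assume "\<not> ?thesis"
        then have "r - 2 = 0" using even_curve_planar[OF k(2) k(4)[folded equal]] by auto
        then have "y - 48 * real k = 24" using even_curve_bounds[OF k(2)] by simp
        then have "y = 48 * real k + 24" by simp
        with \<open>\<not> ?thesis\<close> \<open>r - 2 = 0\<close> k(1) show False by (auto simp: M_def)
      qed
    next
      case less
      then show ?thesis using z_end[OF k(2) k(4) less] z_start[OF k(2) k(4) less] by simp
    next
      case greater
      then show ?thesis using z_end[OF k(4) k(2) greater] z_start[OF k(4) k(2) greater] by simp
    qed
    have AC: "y \<in> M" if "k < n" "(2 - 2, z, y - 48 * real k) \<in> even_curve (sp k)" for k z
    proof -
      have "y - 48 * real k = 24" using even_curve_bounds[OF that(2)] by simp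
      then have "y = 48 * real k + 24" by simp
      then show ?thesis using that(1) by (auto simp: M_def)
    qed
    show "z = z' \<or> y \<in> M \<and> r = 2" using R AA AC unfolding R_def by blast
  next
    fix r z z' assume R: "R 0 r z" "R Y r z'"
    \<comment> \<open>Position 0 of a block is also reached at \<open>x = 4\<close>, hence the
      restriction to negative \<open>x\<close>; position 48 is reached only at
      \<open>x = -4/3\<close>.\<close>
    have start: "(x = 0 \<longrightarrow> False) \<and> (x < 0 \<longrightarrow> z = 3)" if "(x, z, 0 - 48 * real k) \<in> even_curve e1" for x z k e1
      using even_curve_bounds[OF that] by auto
    have stop: "x = -4/3 \<and> z = 3" if "k < n" "(x, z, Y - 48 * real k) \<in> even_curve e1" for x z k e1
    proof -
      have "real k + 1 \<le> real n" using that(1) by linarith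
      then have "Y - 48 * real k = 48" using even_curve_y[OF that(2)] unfolding Y_def by linarith
      then show ?thesis using even_curve_bounds[OF that(2)] by blast
    qed
    show "z = z'"
      using R unfolding R_def
    proof (elim disjE exE conjE)
      fix k k' assume "(r - 2, z, 0 - 48 * real k) \<in> even_curve (sp k)" "k' < n" "(r - 2, z', Y - 48 * real k') \<in> even_curve (sp k')"
      then show "z = z'" using start stop by fastforce
    next
      fix k assume "(r - 2, z, 0 - 48 * real k) \<in> even_curve (sp k)" "r = 2"
      then show "z = z'" using start by fastforce
    next
      fix k assume k: "r = 2" "k < n" "(r - 2, z', Y - 48 * real k) \<in> even_curve (sp k)"
      from stop[OF k(2,3)] k(1) show "z = z'" by simp
    qed simp
  next
    fix m x y z :: real assume "m \<in> M" and small: "\<bar>x\<bar> < 1/100" "\<bar>y\<bar> < 1/100"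
    then obtain k where k: "k < n" "m = 48 * real k + 24" by (auto simp: M_def)
    have R_A: "(\<exists>k'<n. (2 + x - 2, z, m + y - 48 * real k') \<in> even_curve (sp k')) \<longleftrightarrow> (x, z, 24 + y) \<in> even_curve (sp k)"
    proof
      assume "\<exists>k'<n. (2 + x - 2, z, m + y - 48 * real k') \<in> even_curve (sp k')"
      then obtain k' where k': "(x, z, m + y - 48 * real k') \<in> even_curve (sp k')" by auto
      then have "\<bar>real k - real k'\<bar> < 1" using even_curve_y[OF k'] small unfolding k(2) by linarith
      then have "k' = k" by linarith
      then show "(x, z, 24 + y) \<in> even_curve (sp k)" using k' k(2) by simp
    qed (use k in \<open>auto intro!: exI[of _ k]\<close>)
    have "sp k \<longleftrightarrow> e \<and> m = 48 * real (n - 1) + 24" by (simp add: sp_def k(2))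
    moreover have "0 \<le> m + y \<and> m + y \<le> Y"
    proof -
      have "real k + 1 \<le> real n" using k(1) by linarith
      then show ?thesis using small unfolding k(2) Y_def by linarith
    qed
    moreover have "\<bar>x\<bar> < 1/2" using small by simp
    ultimately show "R (m + y) (2 + x) z \<longleftrightarrow> (\<exists>j<4. y = \<sigma> j * x \<and> z = h m j) \<or> (x = 0 \<and> z = h m 4)"
      unfolding R_def R_A ex_less_4 by (simp add: even_curve_crossing \<sigma>_def h_def)
  next
    show "0 \<le> y \<and> y \<le> Y \<and> 0 < r" if "R y r z" for y r z
    proof -
      have "0 \<le> y \<and> y \<le> Y \<and> 0 < r" if k: "k < n" "(r - 2, z, y - 48 * real k) \<in> even_curve (sp k)" for k
      proof -
        have "real k + 1 \<le> real n" using k(1) by linarith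
        then show ?thesis using even_curve_bounds[OF k(2)] unfolding Y_def by auto
      qed
      then show ?thesis using that unfolding R_def by auto
    qed
  next
    show "1/100 \<le> m \<and> m \<le> Y - 1/100" if m: "m \<in> M" for m
    proof -
      obtain k where k: "k < n" "m = 48 * real k + 24" using m by (auto simp: M_def)
      then have "real k + 1 \<le> real n" by linarith
      then show ?thesis unfolding k(2) Y_def by linarith
    qed
    show "finite M" by (simp add: M_def)
    show "inj_on (h m) {..<5}" for m by (simp add: lessThan_4_5 h_def)
    show "inj_on \<sigma> {..<4}" by (simp add: lessThan_4_5 \<sigma>_def)
  qed (simp_all add: \<omega>)
  have "inj_on (\<lambda>k. 48 * real k + 24) {..<n}" by (auto simp: inj_on_def)
  then have "card M = n" unfolding M_def by (simp add: card_image)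
  moreover have "t > 0" using t n by auto
  ultimately show ?thesis
    using crossing_number_torus_link2_le[OF _ iso[unfolded link_eq]] cross by simp
qed

section \<open>Odd t\<close>

text \<open>Three half turns of the closed braid for odd \<open>t\<close>: the vertices \<open>(s, r, z, y, b)\<close> describe the
  strand that passes from \<open>r = 1\<close> to \<open>r = 3\<close>. Its partner moves along \<open>r = 3 - s / 100\<close>,
  \<open>z = 0\<close>, \<open>y = s\<close>. All four passages over \<open>r = 2\<close> end up at \<open>y = 100\<close>.\<close>

definition odd_block :: "(real \<times> real \<times> real \<times> real \<times> real) list" where
  "odd_block =
     [(0, 1, 0, 0, -180), (100, 1, 3, 24, -45), (122, 14/5, 3, 804/5, -45), (132, 14/5, 0, 132, -60),
      (142, 14/5, -3, 516/5, 165), (169, 3/4, -3, 95, 165), (175, 3/4, 0, 140, 120),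
      (181, 3/4, 3, 181, 345), (183, 3/4, 4, 185, 420), (190, 3, 4, 32, 420), (200, 3, 0, 200, 360)]"

lemmas odd_block_unfold = odd_block_def list.map prod.case
  segments.simps Un_iff closed_segment_2 closed_segment_3 singleton_iff prod.inject

lemma odd_block_zb:
  assumes "(s, r, z, y, b) \<in> segments odd_block"
  shows "(z, b) \<in> segments (map (\<lambda>(s, r, z, y, b). (z, b)) odd_block)"
proof -
  have "linear (\<lambda>(s::real, r::real, z::real, y::real, b::real). (z, b))"
    by (rule linearI) auto
  from segments_linear_image[OF this] show ?thesis using assms by force
qed

lemma odd_block_szb:
  assumes "(s, r, z, y, b) \<in> segments odd_block"
  shows "(s, z, b) \<in> segments (map (\<lambda>(s, r, z, y, b). (s, z, b)) odd_block)"
proof -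
  have "linear (\<lambda>(s::real, r::real, z::real, y::real, b::real). (s, z, b))"
    by (rule linearI) auto
  from segments_linear_image[OF this] show ?thesis using assms by force
qed

lemma odd_block_szr:
  assumes "(s, r, z, y, b) \<in> segments odd_block"
  shows "(s, z, r) \<in> segments (map (\<lambda>(s, r, z, y, b). (s, z, r)) odd_block)"
proof -
  have "linear (\<lambda>(s::real, r::real, z::real, y::real, b::real). (s, z, r))"
    by (rule linearI) auto
  from segments_linear_image[OF this] show ?thesis using assms by force
qed

lemma odd_block_rzo:
  assumes "(s, r, z, y, b) \<in> segments odd_block"
  shows "(r, z, y - s) \<in> segments (map (\<lambda>(s, r, z, y, b). (r, z, y - s)) odd_block)"
proof -
  have "linear (\<lambda>(s::real, r::real, z::real, y::real, b::real). (r, z, y - s))"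
    by (rule linearI) (auto simp: algebra_simps)
  from segments_linear_image[OF this] show ?thesis using assms by force
qed

definition odd_curve :: "(real \<times> real \<times> real) set" where
  "odd_curve = (\<lambda>(s, r, z, y, b). (r, z, y)) ` segments odd_block"

text \<open>Both strands of one block. They exchange the radii 1 and 3, so the same set serves
  whichever strand follows \<open>odd_block\<close>.\<close>

definition odd_cell :: "(real \<times> real \<times> real) set" where
  "odd_cell = odd_curve \<union> closed_segment (3, 0, 0) (1, 0, 200)"

lemma odd_curve_eq: "odd_curve = segments (map (\<lambda>(s, r, z, y, b). (r, z, y)) odd_block)"
proof -
  have "linear (\<lambda>(s::real, r::real, z::real, y::real, b::real). (r, z, y))"
    by (rule linearI) auto
  from segments_linear_image[OF this] show ?thesis by (simp add: odd_curve_def)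
qed

lemma odd_block_vertical_aux:
  assumes "(z, b) \<in> segments (map (\<lambda>(s, r, z, y, b). (z, b)) odd_block)"
    and "(b = -90 \<and> S = -1) \<or> (b = 90 \<and> S = 1) \<or> (b = 270 \<and> S = -1) \<or> (b = 450 \<and> S = 1) \<or> (b = 630 \<and> S = -1)"
  shows "z = - 2 * S"
  using assms
  apply (simp_all only: odd_block_unfold)
  apply (elim disjE exE conjE; (simp | (simp; linarith))?)+
  done

lemma odd_block_vertical:
  assumes "(s, r, z, y, b) \<in> segments odd_block" "cos (b * pi / 180) = 0"
  shows "z = - 2 * sin (b * pi / 180)"
proof -
  have "-200 \<le> b \<and> b \<le> 700"
    using odd_block_zb[OF assms(1)]
    apply (simp_all only: odd_block_unfold)
    apply (elim disjE exE conjE; (simp | (simp; linarith))?)+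
    done
  with odd_block_vertical_aux[OF odd_block_zb[OF assms(1)] cos_degrees_zero[OF assms(2)]]
  show ?thesis by blast
qed

text \<open>The partner has radius 42/25 at \<open>s = 132\<close> and 5/4 at
  \<open>s = 175\<close>; the ratios 5/3 and 3/5 forced by the angles give the radii 14/5 and 3/4.
  At the two ends the ratios are 1/3 and 3.\<close>

lemma odd_block_horizontal:
  assumes "(s, r, z, y, b) \<in> segments odd_block" "z = 0"
  shows "r * (2 - cos (b * pi / 180)) = (3 - s / 100) * (2 + cos (b * pi / 180))"
proof -
  have "(s = 0 \<and> b = -180) \<or> (s = 132 \<and> b = -60) \<or> (s = 175 \<and> b = 120) \<or> (s = 200 \<and> b = 360)"
    using odd_block_szb[OF assms(1)] assms(2)
    apply (simp_all only: odd_block_unfold)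
    apply (elim disjE exE conjE; (simp | (simp; linarith))?)+
    done
  moreover have "(s = 0 \<and> r = 1) \<or> (s = 132 \<and> r = 14/5) \<or> (s = 175 \<and> r = 3/4) \<or> (s = 200 \<and> r = 3)"
    using odd_block_szr[OF assms(1)] assms(2)
    apply (simp_all only: odd_block_unfold)
    apply (elim disjE exE conjE; (simp | (simp; linarith))?)+
    done
  ultimately consider "s = 0" "b = -180" "r = 1" | "s = 132" "b = -60" "r = 14/5"
    | "s = 175" "b = 120" "r = 3/4" | "s = 200" "b = 360" "r = 3" by auto
  then show ?thesis by cases (simp_all only: cos_degrees, simp_all)
qed

lemma odd_block_twist:
  assumes "(s, r, z, y, b) \<in> segments odd_block" "(s', r, z, y', b') \<in> segments odd_block"
  shows "y - s = y' - s'"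
  using odd_block_rzo[OF assms(1)] odd_block_rzo[OF assms(2)]
  apply (simp_all only: odd_block_unfold)
  apply (elim disjE exE conjE; (simp | (simp; linarith))?)+
  done

text \<open>The partner is not displaced. In the half plane of radius and height the block meets its
  path at \<open>(1, 0)\<close>, \<open>(14/5, 0)\<close> and \<open>(3, 0)\<close>, with
  \<open>y = s\<close>; the remaining zero of the height, at radius 3/4, lies off that path.\<close>

lemma odd_block_twist_partner:
  assumes "(s, r, z, y, b) \<in> segments odd_block" "z = 0" "1 \<le> r" "r \<le> 3"
  shows "y = s"
proof -
  have "y - s = 0"
    using odd_block_rzo[OF assms(1)] assms(2-4)
    apply (simp_all only: odd_block_unfold)
    apply (elim disjE exE conjE; (simp | (simp; linarith))?)+
    done
  then show ?thesis by simp
qed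

text \<open>The strand that crosses over all blocks attaches to the chain at radius \<open>q\<close>, either 1 or 3. In
  the first case its path has to leave the inner loop of \<open>odd_block\<close> at \<open>r = 3/4\<close>, \<open>z = 3\<close>, a point
  that is not displaced.\<close>

definition zone :: "real \<Rightarrow> (real \<times> real \<times> real) list" where
  "zone q = [(0, 2, 5), (1/2, if q = 1 then 7/12 else 4, 5), (1, q, 0)]"

lemmas zone_unfold = zone_def if_True if_False segments.simps Un_iff closed_segment_3 singleton_iff prod.inject

text \<open>For \<open>q = 1\<close> the value 7/12 makes the descent to \<open>(1, 0)\<close> cross
  radius 3/4 at height 3, where \<open>odd_block\<close> has a vertex with
  \<open>s = y = 181\<close>. For \<open>q = 3\<close> the arc meets the block only at
  \<open>(3, 0)\<close>.\<close>

lemma odd_block_twist_zone: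
  assumes "(s, r, z, y, b) \<in> segments odd_block" "(v, r, z) \<in> segments (zone q)" "q = 1 \<or> q = 3"
  shows "y = s"
proof -
  have "(3::real) = 1 \<longleftrightarrow> False" "(1::real) = 1 \<longleftrightarrow> True" by auto
  note * = this
  have "y - s = 0"
    using odd_block_rzo[OF assms(1)] assms(2,3)
    apply (elim disjE; hypsubst)
     apply (simp_all only: odd_block_unfold zone_unfold *)
     apply (elim disjE exE conjE; (simp | (simp; linarith))?)+
    done
  then show ?thesis by simp
qed

lemma odd_block_height:
  assumes "(s, r, z, y, b) \<in> segments odd_block"
  shows "z \<le> 4 \<and> 0 \<le> s \<and> s \<le> 200"
  using odd_block_szb[OF assms]
  apply (simp_all only: odd_block_unfold)
  apply (elim disjE exE conjE; (intro conjI impI; (simp | (simp; linarith)))?)+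
  done

lemma zone_props:
  assumes "(v, r, z) \<in> segments (zone q)" "q = 1 \<or> q = 3"
  shows "0 \<le> v \<and> v \<le> 1 \<and> 0 < r \<and> 0 \<le> z \<and> z \<le> 5 \<and> (v = 0 \<longrightarrow> r = 2) \<and> (v = 0 \<longrightarrow> z = 5) \<and> (v = 1 \<longrightarrow> r = q) \<and> (v = 1 \<longrightarrow> z = 0) \<and>
    (r = 2 \<longrightarrow> v = 0) \<and> (r = 4 - q \<longrightarrow> False) \<and> (z = 0 \<longrightarrow> v = 1)"
proof -
  have *: "(3::real) = 1 \<longleftrightarrow> False" "(1::real) = 1 \<longleftrightarrow> True" by auto
  show ?thesis
    using assms
    apply (elim disjE; hypsubst)
     apply (simp_all only: zone_unfold *)
     apply (elim disjE exE conjE; (intro conjI impI; (simp | (simp; linarith)))?)+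
    done
qed

lemma zone_unique:
  assumes "(v, r, z) \<in> segments (zone q)" "(v, r, z') \<in> segments (zone q)" "q = 1 \<or> q = 3"
  shows "z = z'"
proof -
  have *: "(3::real) = 1 \<longleftrightarrow> False" "(1::real) = 1 \<longleftrightarrow> True" by auto
  show ?thesis
    using assms
    apply (elim disjE; hypsubst)
     apply (simp_all only: zone_unfold *)
     apply (elim disjE exE conjE; (simp | (simp; linarith))?)+
    done
qed

lemma odd_cell_bounds:
  assumes "(r, z, y) \<in> odd_cell"
  shows "3/4 \<le> r \<and> 0 \<le> y \<and> y \<le> 200 \<and> z \<le> 4 \<and> (y = 200 \<longrightarrow> r = 1 \<or> r = 3) \<and> (y = 200 \<longrightarrow> z = 0) \<and>
    (y = 0 \<longrightarrow> r = 1 \<or> r = 3) \<and> (y = 0 \<longrightarrow> z = 0) \<and> (r = 2 \<longrightarrow> y = 100)"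
  using assms
  apply (simp_all only: odd_cell_def odd_curve_eq odd_block_unfold)
  apply (elim disjE exE conjE; (intro conjI impI; (simp | (simp; linarith)))?)+
  done

lemma odd_cell_planar:
  assumes "(r, z, y) \<in> odd_cell" "(r, z', y) \<in> odd_cell" "z \<noteq> z'"
  shows "r = 2"
  using assms
  apply (simp_all only: odd_cell_def odd_curve_eq odd_block_unfold)
  apply (elim disjE exE conjE; (simp | (simp; linarith))?)+
  done

text \<open>The passage of slope -100 at height 0 is the partner; the other three belong to the
  strand on \<open>odd_block\<close>.\<close>

lemma odd_cell_crossing:
  assumes "\<bar>x\<bar> < 1/2"
  shows "(2 + x, z, 100 + y) \<in> odd_cell \<longleftrightarrow>
    (y = 76 * x \<and> z = 3) \<or> (y = 4 * x \<and> z = -3) \<or> (y = -68 * x \<and> z = 4) \<or> (y = -100 * x \<and> z = 0)"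
    (is "?L \<longleftrightarrow> ?R")
proof
  assume ?L
  then show ?R
    using assms
    apply (simp_all only: odd_cell_def odd_curve_eq odd_block_unfold)
    apply (elim disjE exE conjE; (simp | (simp; linarith))?)+
    done
next
  have u: "\<bar>x\<bar> < 1/2 \<Longrightarrow> 0 \<le> (x + 1) * (5/9) \<and> (x + 1) * (5/9) \<le> 1"
    "\<bar>x\<bar> < 1/2 \<Longrightarrow> 0 \<le> (4/5 - x) * (20/41) \<and> (4/5 - x) * (20/41) \<le> 1"
    "\<bar>x\<bar> < 1/2 \<Longrightarrow> 0 \<le> (x + 5/4) * (4/9) \<and> (x + 5/4) * (4/9) \<le> 1"
    "\<bar>x\<bar> < 1/2 \<Longrightarrow> 0 \<le> (1 - x) * (1/2) \<and> (1 - x) * (1/2) \<le> 1"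
    by (auto simp: abs_less_iff)
  assume ?R
  then consider "y = 76 * x" "z = 3" | "y = 4 * x" "z = -3" | "y = -68 * x" "z = 4" | "y = -100 * x" "z = 0"
    by blast
  then show ?L
  proof cases
    case 1
    have "(2 + x, z, 100 + y) \<in> closed_segment (1, 3, 24) (14/5, 3, 804/5)"
      unfolding closed_segment_3 using u(1)[OF assms] 1
      by (intro exI[of _ "(x + 1) * (5/9)"]) (simp add: field_simps)
    then show ?thesis by (simp add: odd_cell_def odd_curve_eq odd_block_def)
  next
    case 2
    have "(2 + x, z, 100 + y) \<in> closed_segment (14/5, -3, 516/5) (3/4, -3, 95)"
      unfolding closed_segment_3 using u(2)[OF assms] 2
      by (intro exI[of _ "(4/5 - x) * (20/41)"]) (simp add: field_simps)
    then show ?thesis by (simp add: odd_cell_def odd_curve_eq odd_block_def)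
  next
    case 3
    have "(2 + x, z, 100 + y) \<in> closed_segment (3/4, 4, 185) (3, 4, 32)"
      unfolding closed_segment_3 using u(3)[OF assms] 3
      by (intro exI[of _ "(x + 5/4) * (4/9)"]) (simp add: field_simps)
    then show ?thesis by (simp add: odd_cell_def odd_curve_eq odd_block_def)
  next
    case 4
    have "(2 + x, z, 100 + y) \<in> closed_segment (3, 0, 0) (1, 0, 200)"
      unfolding closed_segment_3 using u(4)[OF assms] 4
      by (intro exI[of _ "(1 - x) * (1/2)"]) (simp add: field_simps)
    then show ?thesis by (simp add: odd_cell_def)
  qed
qed

lemma segments_affine_image:
  assumes f: "\<And>x y u. f ((1 - u) *\<^sub>R x + u *\<^sub>R y) = (1 - u) *\<^sub>R f x + u *\<^sub>R f y"
  shows "segments (map f ps) = f ` segments ps"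
proof -
  have "closed_segment (f x) (f y) = f ` closed_segment x y" for x y
    by (simp add: closed_segment_image_interval image_image f)
  then show ?thesis by (induction ps rule: segments.induct) (auto simp: image_Un)
qed

lemma closed_segment_5:
  fixes s x z y b :: real
  shows "(s, x, z, y, b) \<in> closed_segment (s0, x0, z0, y0, b0) (s1, x1, z1, y1, b1) \<longleftrightarrow>
     (\<exists>u. 0 \<le> u \<and> u \<le> 1 \<and> s = s0 + u * (s1 - s0) \<and> x = x0 + u * (x1 - x0) \<and>
        z = z0 + u * (z1 - z0) \<and> y = y0 + u * (y1 - y0) \<and> b = b0 + u * (b1 - b0))"
  by (auto simp: in_segment algebra_simps)

text \<open>The part of the closed braid after the chain, with vertices \<open>(v, ra, rb, zb, b)\<close>: the strand
  with index \<open>b\<close> rises above everything and stays at radius 2 for \<open>v \<ge> 4\<close>, while the other one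
  passes below it. \<open>qs\<close> and \<open>qe\<close> are the radii at which the upper strand attaches to the chain.\<close>

definition gap :: "real \<Rightarrow> real \<Rightarrow> real \<Rightarrow> (real \<times> real \<times> real \<times> real \<times> real) list" where
  "gap qs qe e =
     [(3, 4 - qe, qe, 0, 0), (7/2, 4 - qe, if qe = 1 then 7/12 else 4, 5, 225 * e), (4, 4 - qe, 2, 5, 180 * e),
      (5, 4 - qe, 2, 6, 180 * e), (7, 4 - qs, 2, 6, 180 * e), (8, 4 - qs, 2, 5, 180 * e)]"

text \<open>Each block exchanges the radii 1 and 3, and \<open>4 - q\<close> is the other radius. In
  this order the cases serve \<open>t\<close> congruent to 3, 5 and 1 modulo 6.\<close>

definition gap_type :: "real \<Rightarrow> real \<Rightarrow> real \<Rightarrow> bool" where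
  "gap_type qs qe e \<longleftrightarrow> (qs = 3 \<and> qe = 3 \<and> e = 0) \<or> (qs = 1 \<and> qe = 3 \<and> e = -1) \<or> (qs = 3 \<and> qe = 1 \<and> e = 1)"

lemma one_three: "(3::real) = 1 \<longleftrightarrow> False" "(1::real) = 1 \<longleftrightarrow> True"
  by auto

lemmas gap_unfold = gap_def if_True if_False one_three segments.simps Un_iff closed_segment_5 singleton_iff prod.inject

lemma gap_props_aux:
  assumes "gap_type qs qe e" "(v, ra, rb, zb, b) \<in> segments (gap qs qe e)"
  shows "(3 \<le> v \<and> v \<le> 8 \<and> 1 \<le> ra \<and> ra \<le> 3 \<and> 0 < rb \<and> (v \<le> 4 \<longrightarrow> ra = 4 - qe) \<and> (v = 8 \<longrightarrow> ra = 4 - qs) \<and>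
    (4 \<le> v \<longrightarrow> rb = 2) \<and> (4 \<le> v \<longrightarrow> 5 \<le> zb) \<and> (zb = 5 \<longrightarrow> 4 < v \<longrightarrow> v = 8) \<and> (5 \<le> v \<longrightarrow> v \<le> 7 \<longrightarrow> zb = 6)) \<and>
    ((zb = 0 \<longrightarrow> v = 3) \<and> (zb = 0 \<longrightarrow> b = 0) \<and> (zb = 0 \<longrightarrow> rb = qe) \<and> (v = 4 \<longrightarrow> zb = 5) \<and> (v = 8 \<longrightarrow> zb = 5) \<and>
    -225 \<le> b \<and> b \<le> 225 \<and> (v \<le> 4 \<longrightarrow> zb \<le> 5) \<and> (b = 90 \<longrightarrow> zb = 2) \<and> (b = -90 \<longrightarrow> zb = 2) \<and>
    (b > 0 \<longrightarrow> e = 1) \<and> (b < 0 \<longrightarrow> e = -1))"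
  using assms unfolding gap_type_def
  apply (elim disjE conjE; hypsubst)
    apply (simp_all only: gap_unfold)
    apply (elim disjE exE conjE; (intro conjI impI; (simp | (simp; linarith)))?)+
  done

lemma gap_props:
  assumes "gap_type qs qe e" "(v, ra, rb, zb, b) \<in> segments (gap qs qe e)"
  shows "3 \<le> v" "v \<le> 8" "1 \<le> ra" "ra \<le> 3" "0 < rb" "v \<le> 4 \<Longrightarrow> ra = 4 - qe" "v = 8 \<Longrightarrow> ra = 4 - qs"
    and "4 \<le> v \<Longrightarrow> rb = 2" "4 \<le> v \<Longrightarrow> 5 \<le> zb" "zb = 5 \<Longrightarrow> 4 < v \<Longrightarrow> v = 8" "5 \<le> v \<Longrightarrow> v \<le> 7 \<Longrightarrow> zb = 6"
    and "zb = 0 \<Longrightarrow> v = 3" "zb = 0 \<Longrightarrow> b = 0" "zb = 0 \<Longrightarrow> rb = qe" "v = 4 \<Longrightarrow> zb = 5" "v = 8 \<Longrightarrow> zb = 5"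
    and "-225 \<le> b" "b \<le> 225" "v \<le> 4 \<Longrightarrow> zb \<le> 5" "b = 90 \<Longrightarrow> zb = 2" "b = -90 \<Longrightarrow> zb = 2"
    and "b > 0 \<Longrightarrow> e = 1" "b < 0 \<Longrightarrow> e = -1"
  using gap_props_aux[OF assms, THEN conjunct1] apply blast+
  using gap_props_aux[OF assms, THEN conjunct2] apply blast+
  done

lemma zone_facts:
  assumes "(v, r, z) \<in> segments (zone q)" "q = 1 \<or> q = 3"
  shows "0 \<le> v" "v \<le> 1" "0 < r" "0 \<le> z" "z \<le> 5" "v = 0 \<Longrightarrow> r = 2" "v = 0 \<Longrightarrow> z = 5"
    and "v = 1 \<Longrightarrow> r = q" "v = 1 \<Longrightarrow> z = 0" "r = 2 \<Longrightarrow> v = 0" "r \<noteq> 4 - q" "z = 0 \<Longrightarrow> v = 1"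
  using zone_props[OF assms] by blast+

lemma zone_eq: "q = 1 \<or> q = 3 \<Longrightarrow> (v, r, z) \<in> segments (zone q) \<longleftrightarrow>
    (v, r, z) \<in> closed_segment (0, 2, 5) (1/2, if q = 1 then 7/12 else 4, 5) \<or>
    (v, r, z) \<in> closed_segment (1/2, if q = 1 then 7/12 else 4, 5) (1, q, 0)"
  by (simp add: zone_def) auto

text \<open>Read backwards, the rise of the upper strand is the arc \<open>zone qe\<close>, so the
  facts on \<open>zone\<close> cover both ends of the chain.\<close>

lemma gap_zone:
  assumes "gap_type qs qe e" "(v, ra, rb, zb, b) \<in> segments (gap qs qe e)" "v \<le> 4"
  shows "(4 - v, rb, zb) \<in> segments (zone qe)"
proof -
  have qe: "qe = 1 \<or> qe = 3" using assms(1) by (auto simp: gap_type_def)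
  let ?\<rho> = "if qe = 1 then 7/12 else 4 :: real"
  consider "(v, ra, rb, zb, b) \<in> closed_segment (3, 4 - qe, qe, 0, 0) (7/2, 4 - qe, ?\<rho>, 5, 225 * e)"
    | "(v, ra, rb, zb, b) \<in> closed_segment (7/2, 4 - qe, ?\<rho>, 5, 225 * e) (4, 4 - qe, 2, 5, 180 * e)"
    | "v = 4"
  proof -
    have "v \<ge> 4" if "(v, ra, rb, zb, b) \<in> segments [(4, 4 - qe, 2, 5, 180 * e),
      (5, 4 - qe, 2, 6, 180 * e), (7, 4 - qs, 2, 6, 180 * e), (8, 4 - qs, 2, 5, 180 * e)]"
      using that unfolding segments.simps Un_iff closed_segment_5 singleton_iff prod.inject by auto
    then show thesis using assms(2,3) that unfolding gap_def segments.simps Un_iff by force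
  qed
  then show ?thesis
  proof cases
    case 1
    then obtain u where "0 \<le> u" "u \<le> 1" "v = 3 + u * (7/2 - 3)" "rb = qe + u * (?\<rho> - qe)" "zb = 0 + u * (5 - 0)"
      unfolding closed_segment_5 by blast
    then show ?thesis unfolding zone_eq[OF qe] closed_segment_3
      by (intro disjI2 exI[of _ "1 - u"]) (simp add: field_simps)
  next
    case 2
    then obtain u where "0 \<le> u" "u \<le> 1" "v = 7/2 + u * (4 - 7/2)" "rb = ?\<rho> + u * (2 - ?\<rho>)" "zb = 5 + u * (5 - 5)"
      unfolding closed_segment_5 by blast
    then show ?thesis unfolding zone_eq[OF qe] closed_segment_3
      by (intro disjI1 exI[of _ "1 - u"]) (simp add: field_simps)
  next
    case 3
    then have "rb = 2" "zb = 5" using gap_props(8,15)[OF assms(1,2)] by simp_all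
    then show ?thesis using 3 by (simp add: zone_def)
  qed
qed

lemma gap_sorted: "sorted_wrt (<) (map fst (gap qs qe e))" "gap qs qe e \<noteq> []"
  by (simp_all add: gap_def)

lemma gap_unique:
  assumes "(v, w) \<in> segments (gap qs qe e)" "(v, w') \<in> segments (gap qs qe e)"
  shows "w = w'"
  using polyline_segments(1)[OF gap_sorted assms(1)] polyline_segments(1)[OF gap_sorted assms(2)] by simp

lemma gap_exists: "3 \<le> v \<Longrightarrow> v \<le> 8 \<Longrightarrow> \<exists>ra rb zb b. (v, ra, rb, zb, b) \<in> segments (gap qs qe e)"
proof -
  assume "3 \<le> v" "v \<le> 8"
  then have "v \<in> {fst (hd (gap qs qe e))..fst (last (gap qs qe e))}" by (simp add: gap_def)
  then have "(v, polyline (gap qs qe e) v) \<in> segments (gap qs qe e)"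
    using polyline_graph[OF gap_sorted, of qs qe e] by blast
  then show ?thesis by (metis prod.collapse)
qed

lemma zone_gap:
  assumes "gap_type qs qe e" "(v, r, z) \<in> segments (zone qe)"
  shows "\<exists>ra b. (4 - v, ra, r, z, b) \<in> segments (gap qs qe e)"
proof -
  have qe: "qe = 1 \<or> qe = 3" using assms(1) by (auto simp: gap_type_def)
  have v: "0 \<le> v" "v \<le> 1" using zone_facts(1,2)[OF assms(2) qe] by simp_all
  then obtain ra rb zb b where g: "(4 - v, ra, rb, zb, b) \<in> segments (gap qs qe e)"
    using gap_exists[of "4 - v" qs qe e] by auto
  have "(v, rb, zb) \<in> segments (zone qe)" using gap_zone[OF assms(1) g] v by simp
  moreover have "sorted_wrt (<) (map fst (zone qe))" "zone qe \<noteq> []" by (simp_all add: zone_def)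
  ultimately have "(rb, zb) = (r, z)"
    using polyline_segments(1)[of "zone qe" v] assms(2) by metis
  then show ?thesis using g by auto
qed

text \<open>Up to height 5 the angle changes by 45 degrees per unit, hence the overshoot to 225: a
  quarter turn is reached exactly at height 2. For a half turn, the sign of \<open>e\<close> is
  forced by the rising strand being the upper one.\<close>

lemma gap_vertical:
  assumes "gap_type qs qe e" "(v, ra, rb, zb, b) \<in> segments (gap qs qe e)" "cos (b * pi / 180) = 0"
  shows "zb = 2 * (if e = 1 then sin (b * pi / 180) else - sin (b * pi / 180))"
proof -
  note props = gap_props[OF assms(1,2)]
  consider "b = 0" | "b > 0" "e = 1" | "b < 0" "e = -1" using props(22,23) by linarith
  then show ?thesis
  proof cases
    case 1 then show ?thesis using assms(3) by simp
  next
    case 2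
    have "b = 90 \<and> sin (b * pi / 180) = 1"
      using cos_degrees_zero[OF assms(3)] props(17,18) 2 by force
    then show ?thesis using props(20) 2 by simp
  next
    case 3
    have "cos (- b * pi / 180) = 0" using assms(3) by simp
    from cos_degrees_zero[OF this] have "- b = 90 \<and> sin (- b * pi / 180) = 1"
      using 3 props(17,18) by force
    then have "b = -90" "sin (b * pi / 180) = -1" by auto
    then show ?thesis using props(21) 3 by simp
  qed
qed

lemma graph_exists:
  fixes ps :: "(real \<times> 'v::real_normed_vector) list"
  assumes "sorted_wrt (<) (map fst ps)" "ps \<noteq> []" "fst (hd ps) \<le> v" "v \<le> fst (last ps)"
  shows "\<exists>w. (v, w) \<in> segments ps"
proof -
  have "(v, polyline ps v) \<in> (\<lambda>\<tau>. (\<tau>, polyline ps \<tau>)) ` {fst (hd ps)..fst (last ps)}"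
    using assms(3,4) by simp
  then show ?thesis unfolding polyline_graph[OF assms(1,2)] by blast
qed

text \<open>Time runs over \<open>{0..8 * D}\<close>: the arc \<open>zone qs\<close> in \<open>{0..D}\<close>, the chain of \<open>n\<close> blocks, which ends at
  \<open>D + 200 * real n\<close>, a constant part up to \<open>3 * D\<close>, and the arc \<open>gap\<close>, which adds \<open>e\<close> half turns. The
  strands swap roles after each block; \<open>aL k\<close> says that strand 0 follows \<open>odd_block\<close> in block \<open>k\<close>.\<close>

locale odd_braid =
  fixes qs qe e D :: real and n t j0 :: nat
  assumes ty: "gap_type qs qe e" and t: "real t = 3 * real n + e" and par: "odd n \<longleftrightarrow> e = 0"
    and j0: "j0 = (if qs = 1 then 0 else 1)" and D: "D = 200 * (real n + 1)"
begin

definition aL :: "nat \<Rightarrow> bool" where "aL k \<longleftrightarrow> even (k + j0)"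

definition fZ :: "real \<times> real \<times> real \<Rightarrow> real \<times> real \<times> real \<times> real \<times> real \<times> real \<times> real \<times> real" where
  "fZ = (\<lambda>(v, r, z). (D * v, r, z, D * v, 4 - qs, 0, D * v, 180 * real j0 - 180))"

definition fB :: "nat \<Rightarrow> real \<times> real \<times> real \<times> real \<times> real \<Rightarrow> real \<times> real \<times> real \<times> real \<times> real \<times> real \<times> real \<times> real" where
  "fB k = (\<lambda>(s, r, z, y, b). if aL k
      then (D + 200 * real k + s, r, z, D + 200 * real k + y, 3 - s / 100, 0, D + 200 * real k + s, 540 * real k + 180 * real j0 + b)
      else (D + 200 * real k + s, 3 - s / 100, 0, D + 200 * real k + s, r, z, D + 200 * real k + y, 540 * real k + 180 * real j0 + b))"

definition \<beta>e :: real where "\<beta>e = 540 * real n + 180 * real j0 - 180"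

definition rest :: "(real \<times> real \<times> real \<times> real \<times> real \<times> real \<times> real \<times> real) list" where
  "rest = [(D + 200 * real n, 4 - qe, 0, D + 200 * real n, qe, 0, D + 200 * real n, \<beta>e),
    (3 * D, 4 - qe, 0, 3 * D, qe, 0, 3 * D, \<beta>e)]"

definition fG :: "real \<times> real \<times> real \<times> real \<times> real \<Rightarrow> real \<times> real \<times> real \<times> real \<times> real \<times> real \<times> real \<times> real" where
  "fG = (\<lambda>(v, ra, rb, zb, b). (D * v, ra, 0, D * v, rb, zb, D * v, \<beta>e + b))"

definition B :: "nat \<Rightarrow> (real \<times> real \<times> real \<times> real \<times> real \<times> real \<times> real \<times> real) list" where
  "B j = (if j = 0 then map fZ (zone qs) else if j \<le> n then map (fB (j - 1)) odd_block
     else if j = n + 1 then rest else map fG (gap qs qe e))"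

definition ps where "ps = join B (n + 3)"

text \<open>\<open>D\<close> exceeds the length of the chain, so the chain lies in the front half
  \<open>{0..4 * D}\<close>, under the flipped arc.\<close>

lemma D_pos: "D > 0" "D + 200 * real n < 3 * D" using D by auto

text \<open>Strand 0 enters the chain at radius \<open>qs\<close> and leaves it at
  \<open>4 - qe\<close>, which fits the exchange of radii in each block for the stated parities of
  \<open>n\<close>.\<close>

lemma types: "(qs = 3 \<and> qe = 3 \<and> e = 0 \<and> j0 = 1 \<and> odd n) \<or> (qs = 1 \<and> qe = 3 \<and> e = -1 \<and> j0 = 0 \<and> even n) \<or>
    (qs = 3 \<and> qe = 1 \<and> e = 1 \<and> j0 = 1 \<and> even n)"
  using ty par j0 by (auto simp: gap_type_def)

lemma q13: "qs = 1 \<or> qs = 3" "qe = 1 \<or> qe = 3" using ty by (auto simp: gap_type_def)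

lemma zero_less_n3: "0 < n + 3" by simp

lemma aL_Suc: "aL (Suc k) \<longleftrightarrow> \<not> aL k" by (simp add: aL_def)

lemma B_list: "sorted_wrt (<) (map fst (B j))" "B j \<noteq> []" "tl (B j) \<noteq> []"
proof -
  let ?ok = "\<lambda>ps. sorted_wrt (<) (map fst ps) \<and> ps \<noteq> [] \<and> tl ps \<noteq> []"
  have "?ok (map fZ (zone qs))" using D_pos by (simp add: zone_def fZ_def)
  moreover have "?ok (map (fB k) odd_block)" for k
    by (cases "aL k") (simp_all add: odd_block_def fB_def)
  moreover have "?ok rest" using D_pos by (simp add: rest_def)
  moreover have "?ok (map fG (gap qs qe e))" using D_pos by (simp add: gap_def fG_def)
  ultimately have "?ok (B j)" by (simp add: B_def)
  then show "sorted_wrt (<) (map fst (B j))" "B j \<noteq> []" "tl (B j) \<noteq> []" by blast+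
qed

lemma hd_block: "hd (map (fB k) odd_block) = (if aL k
      then (D + 200 * real k, 1, 0, D + 200 * real k, 3, 0, D + 200 * real k, 540 * real k + 180 * real j0 - 180)
      else (D + 200 * real k, 3, 0, D + 200 * real k, 1, 0, D + 200 * real k, 540 * real k + 180 * real j0 - 180))"
  by (simp add: odd_block_def fB_def)

lemma last_block: "last (map (fB k) odd_block) = (if aL k
      then (D + 200 * real k + 200, 3, 0, D + 200 * real k + 200, 1, 0, D + 200 * real k + 200, 540 * real k + 180 * real j0 + 360)
      else (D + 200 * real k + 200, 1, 0, D + 200 * real k + 200, 3, 0, D + 200 * real k + 200, 540 * real k + 180 * real j0 + 360))"
  by (simp add: odd_block_def fB_def)

lemma B_link: "last (B j) = hd (B (Suc j))" if j: "Suc j < n + 3"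
proof -
  consider "j = 0" "n = 0" | "j = 0" "n > 0" | "0 < j" "j < n" | "j = n" "n > 0" | "j = n + 1" using j by linarith
  then show ?thesis
  proof cases
    \<comment> \<open>An empty chain, as for \<open>t = 1\<close>: the arc is followed directly by
      the constant part.\<close>
    case 1
    then have qs: "qs = 4 - qe" using types by auto
    have B: "B j = map fZ (zone qs)" "B (Suc j) = rest" unfolding B_def using 1 by simp_all
    have "last (map fZ (zone qs)) = (D, qs, 0, D, 4 - qs, 0, D, 180 * real j0 - 180)"
      by (simp add: zone_def fZ_def)
    moreover have "hd rest = (D, 4 - qe, 0, D, qe, 0, D, 180 * real j0 - 180)"
      unfolding rest_def \<beta>e_def using 1(2) by simp
    ultimately show ?thesis unfolding B using qs by simp
  next
    case 2
    then have "hd (B (Suc j)) = hd (map (fB 0) odd_block)" by (simp add: B_def)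
    then show ?thesis unfolding hd_block using 2 types by (auto simp: B_def zone_def fZ_def aL_def)
  next
    case 3
    then have B: "B j = map (fB (j - 1)) odd_block" "B (Suc j) = map (fB (Suc (j - 1))) odd_block"
      by (auto simp: B_def)
    show ?thesis unfolding B hd_block last_block aL_Suc by (simp add: algebra_simps)
  next
    case 4
    then have B: "B j = map (fB (n - 1)) odd_block" "B (Suc j) = rest" by (auto simp: B_def)
    \<comment> \<open>The strand on the last \<open>odd_block\<close> ends at radius 3, and strand 0
      has to end at \<open>4 - qe\<close>.\<close>
    have "aL (n - 1) \<longleftrightarrow> qe = 1" using types 4(2) by (cases n) (auto simp: aL_def)
    moreover have "real (n - 1) = real n - 1" using 4(2) by simp
    ultimately show ?thesis unfolding B last_block using q13 by (auto simp: rest_def \<beta>e_def algebra_simps)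
  next
    case 5
    then show ?thesis by (simp add: B_def rest_def gap_def fG_def)
  qed
qed

lemma ps_props: "sorted_wrt (<) (map fst ps)" "ps \<noteq> []"
    "hd ps = (0, 2, 5, 0, 4 - qs, 0, 0, 180 * real j0 - 180)"
    "last ps = (8 * D, 4 - qs, 0, 8 * D, 2, 5, 8 * D, \<beta>e + 180 * e)"
    "segments ps = (\<Union>j<n + 3. segments (B j))"
proof -
  have *: "sorted_wrt (<) (map fst ps)" "ps \<noteq> []" "hd ps = hd (B 0)" "last ps = last (B (n + 3 - 1))"
    "segments ps = (\<Union>j<n + 3. segments (B j))"
    unfolding ps_def using join_props[of "n + 3" B, OF B_list B_link zero_less_n3] by blast+
  show "sorted_wrt (<) (map fst ps)" "ps \<noteq> []" "segments ps = (\<Union>j<n + 3. segments (B j))"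
    by (rule *)+
  show "hd ps = (0, 2, 5, 0, 4 - qs, 0, 0, 180 * real j0 - 180)"
    unfolding *(3) by (simp add: B_def zone_def fZ_def)
  show "last ps = (8 * D, 4 - qs, 0, 8 * D, 2, 5, 8 * D, \<beta>e + 180 * e)"
    unfolding *(4) by (simp add: B_def gap_def fG_def)
qed

text \<open>The graph of the polyline through \<open>ps\<close> as a relation, one disjunct for each
  phase; properties of the braid are read off it without evaluating \<open>polyline\<close>.\<close>

definition St where "St s ra za ya rb zb yb b \<longleftrightarrow>
    (\<exists>v. (v, ra, za) \<in> segments (zone qs) \<and> s = D * v \<and> ya = s \<and> rb = 4 - qs \<and> zb = 0 \<and> yb = s \<and> b = 180 * real j0 - 180) \<or>
    (\<exists>k<n. \<exists>s' r z y b'. (s', r, z, y, b') \<in> segments odd_block \<and> s = D + 200 * real k + s' \<and> b = 540 * real k + 180 * real j0 + b' \<and>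
      (if aL k then ra = r \<and> za = z \<and> ya = D + 200 * real k + y \<and> rb = 3 - s' / 100 \<and> zb = 0 \<and> yb = s
       else ra = 3 - s' / 100 \<and> za = 0 \<and> ya = s \<and> rb = r \<and> zb = z \<and> yb = D + 200 * real k + y)) \<or>
    (D + 200 * real n \<le> s \<and> s \<le> 3 * D \<and> ra = 4 - qe \<and> za = 0 \<and> ya = s \<and> rb = qe \<and> zb = 0 \<and> yb = s \<and> b = \<beta>e) \<or>
    (\<exists>v b'. (v, ra, rb, zb, b') \<in> segments (gap qs qe e) \<and> s = D * v \<and> za = 0 \<and> ya = s \<and> yb = s \<and> b = \<beta>e + b')"

lemma segments_St: "(s, ra, za, ya, rb, zb, yb, b) \<in> segments ps \<longleftrightarrow> St s ra za ya rb zb yb b"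
proof -
  have Z: "segments (map fZ (zone qs)) = fZ ` segments (zone qs)"
    by (rule segments_affine_image) (auto simp: fZ_def algebra_simps)
  have Bk: "segments (map (fB k) odd_block) = fB k ` segments odd_block" for k
    by (rule segments_affine_image) (auto simp: fB_def algebra_simps add_divide_distrib diff_divide_distrib)
  have G: "segments (map fG (gap qs qe e)) = fG ` segments (gap qs qe e)"
    by (rule segments_affine_image) (auto simp: fG_def algebra_simps)
  have P: "(s, ra, za, ya, rb, zb, yb, b) \<in> segments rest \<longleftrightarrow>
    D + 200 * real n \<le> s \<and> s \<le> 3 * D \<and> ra = 4 - qe \<and> za = 0 \<and> ya = s \<and> rb = qe \<and> zb = 0 \<and> yb = s \<and> b = \<beta>e" (is "_ \<longleftrightarrow> ?R")
  proof -
    let ?p = "D + 200 * real n"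
    have "segments rest = closed_segment (?p, 4 - qe, 0, ?p, qe, 0, ?p, \<beta>e) (3 * D, 4 - qe, 0, 3 * D, qe, 0, 3 * D, \<beta>e)"
      unfolding rest_def segments.simps using ends_in_segment(2) by blast
    also have "(s, ra, za, ya, rb, zb, yb, b) \<in> \<dots> \<longleftrightarrow> (\<exists>u. 0 \<le> u \<and> u \<le> 1 \<and> s = ?p + u * (3 * D - ?p)) \<and>
        ra = 4 - qe \<and> za = 0 \<and> ya = s \<and> rb = qe \<and> zb = 0 \<and> yb = s \<and> b = \<beta>e"
      by (auto simp: in_segment algebra_simps)
    also have "(\<exists>u. 0 \<le> u \<and> u \<le> 1 \<and> s = ?p + u * (3 * D - ?p)) \<longleftrightarrow> s \<in> closed_segment ?p (3 * D)"
      by (auto simp: in_segment algebra_simps)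
    also have "\<dots> \<longleftrightarrow> ?p \<le> s \<and> s \<le> 3 * D" using D_pos by (simp add: closed_segment_eq_real_ivl)
    finally show ?thesis by blast
  qed
  have "(\<Union>j<n + 3. segments (B j)) = segments (map fZ (zone qs)) \<union> (\<Union>k<n. segments (map (fB k) odd_block)) \<union>
      segments rest \<union> segments (map fG (gap qs qe e))"
  proof -
    have "{..<n + 3} = {0} \<union> Suc ` {..<n} \<union> {n + 1} \<union> {n + 2}"
    proof (intro subset_antisym subsetI)
      fix j assume "j \<in> {..<n + 3}"
      then show "j \<in> {0} \<union> Suc ` {..<n} \<union> {n + 1} \<union> {n + 2}"
        by (cases j) (auto simp: less_Suc_eq)
    qed auto
    then show ?thesis by (simp add: B_def image_image) blast
  qed
  then have "(s, ra, za, ya, rb, zb, yb, b) \<in> segments ps \<longleftrightarrow>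
      (s, ra, za, ya, rb, zb, yb, b) \<in> fZ ` segments (zone qs) \<or>
      (\<exists>k<n. (s, ra, za, ya, rb, zb, yb, b) \<in> fB k ` segments odd_block) \<or>
      (s, ra, za, ya, rb, zb, yb, b) \<in> segments rest \<or> (s, ra, za, ya, rb, zb, yb, b) \<in> fG ` segments (gap qs qe e)"
    unfolding ps_props(5) Z Bk G by blast
  moreover have "(s, ra, za, ya, rb, zb, yb, b) \<in> fZ ` segments (zone qs) \<longleftrightarrow>
     (\<exists>v. (v, ra, za) \<in> segments (zone qs) \<and> s = D * v \<and> ya = s \<and> rb = 4 - qs \<and> zb = 0 \<and> yb = s \<and> b = 180 * real j0 - 180)"
    by (force simp: fZ_def image_iff)
  moreover have "(s, ra, za, ya, rb, zb, yb, b) \<in> fB k ` segments odd_block \<longleftrightarrow>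
     (\<exists>s' r z y b'. (s', r, z, y, b') \<in> segments odd_block \<and> s = D + 200 * real k + s' \<and> b = 540 * real k + 180 * real j0 + b' \<and>
      (if aL k then ra = r \<and> za = z \<and> ya = D + 200 * real k + y \<and> rb = 3 - s' / 100 \<and> zb = 0 \<and> yb = s
       else ra = 3 - s' / 100 \<and> za = 0 \<and> ya = s \<and> rb = r \<and> zb = z \<and> yb = D + 200 * real k + y))" for k
    by (cases "aL k") (force simp: fB_def image_iff)+
  moreover have "(s, ra, za, ya, rb, zb, yb, b) \<in> fG ` segments (gap qs qe e) \<longleftrightarrow>
     (\<exists>v b'. (v, ra, rb, zb, b') \<in> segments (gap qs qe e) \<and> s = D * v \<and> za = 0 \<and> ya = s \<and> yb = s \<and> b = \<beta>e + b')"
    by (force simp: fG_def image_iff)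
  ultimately show ?thesis unfolding St_def P by simp
qed

definition q where "q = polyline ps"
definition "ra s = fst (q s)"
definition "za s = fst (snd (q s))"
definition "ya s = fst (snd (snd (q s)))"
definition "rb s = fst (snd (snd (snd (q s))))"
definition "zb s = fst (snd (snd (snd (snd (q s)))))"
definition "yb s = fst (snd (snd (snd (snd (snd (q s))))))"
definition "be s = snd (snd (snd (snd (snd (snd (q s))))))"

lemmas comp_defs = ra_def za_def ya_def rb_def zb_def yb_def be_def

lemma q_eq: "q s = (ra s, za s, ya s, rb s, zb s, yb s, be s)"
  by (simp add: comp_defs)

lemma cont: "continuous_on S ra" "continuous_on S za" "continuous_on S ya" "continuous_on S rb"
    "continuous_on S zb" "continuous_on S yb" "continuous_on S be"
proof -
  have "continuous_on S q" unfolding q_def by (rule continuous_on_polyline)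
  then show "continuous_on S ra" "continuous_on S za" "continuous_on S ya" "continuous_on S rb"
    "continuous_on S zb" "continuous_on S yb" "continuous_on S be"
    unfolding ra_def[abs_def] za_def[abs_def] ya_def[abs_def] rb_def[abs_def] zb_def[abs_def] yb_def[abs_def] be_def[abs_def]
    by (intro continuous_intros; assumption)+
qed

lemma St_q: "s \<in> {0..8 * D} \<Longrightarrow> St s (ra s) (za s) (ya s) (rb s) (zb s) (yb s) (be s)"
proof -
  assume "s \<in> {0..8 * D}"
  then have "(s, q s) \<in> segments ps"
    unfolding polyline_graph[OF ps_props(1,2), symmetric] q_def using ps_props(3,4) by simp
  then show ?thesis unfolding q_eq segments_St .
qed

lemma q_St: "St s r0 z0 y0 r1 z1 y1 b \<Longrightarrow>
    s \<in> {0..8 * D} \<and> ra s = r0 \<and> za s = z0 \<and> ya s = y0 \<and> rb s = r1 \<and> zb s = z1 \<and> yb s = y1 \<and> be s = b"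
  unfolding segments_St[symmetric]
  using polyline_segments[OF ps_props(1,2)] ps_props(3,4) by (force simp: comp_defs q_def)

lemma q_ends: "ra 0 = 2" "za 0 = 5" "rb 0 = 4 - qs" "zb 0 = 0" "be 0 = 180 * real j0 - 180"
    "ra (8 * D) = 4 - qs" "za (8 * D) = 0" "rb (8 * D) = 2" "zb (8 * D) = 5" "be (8 * D) = \<beta>e + 180 * e"
proof -
  have "(0, 2, 5, 0, 4 - qs, 0, 0, 180 * real j0 - 180) \<in> segments ps"
    using segments_hd[OF ps_props(2)] unfolding ps_props(3) .
  then show "ra 0 = 2" "za 0 = 5" "rb 0 = 4 - qs" "zb 0 = 0" "be 0 = 180 * real j0 - 180"
    unfolding segments_St by (auto dest: q_St)
  have "(8 * D, 4 - qs, 0, 8 * D, 2, 5, 8 * D, \<beta>e + 180 * e) \<in> segments ps"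
    using segments_last[OF ps_props(2)] unfolding ps_props(4) .
  then show "ra (8 * D) = 4 - qs" "za (8 * D) = 0" "rb (8 * D) = 2" "zb (8 * D) = 5" "be (8 * D) = \<beta>e + 180 * e"
    unfolding segments_St by (auto dest: q_St)
qed

lemma St_cases:
  assumes "St s r0 z0 y0 r1 z1 y1 b"
  obtains (zone) v where "(v, r0, z0) \<in> segments (zone qs)" "s = D * v" "y0 = s" "r1 = 4 - qs" "z1 = 0" "y1 = s"
      "b = 180 * real j0 - 180"
  | (left) k s' y b' where "k < n" "aL k" "(s', r0, z0, y, b') \<in> segments odd_block" "s = D + 200 * real k + s'"
      "b = 540 * real k + 180 * real j0 + b'" "y0 = D + 200 * real k + y" "r1 = 3 - s' / 100" "z1 = 0" "y1 = s"
  | (right) k s' y b' where "k < n" "\<not> aL k" "(s', r1, z1, y, b') \<in> segments odd_block" "s = D + 200 * real k + s'"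
      "b = 540 * real k + 180 * real j0 + b'" "y1 = D + 200 * real k + y" "r0 = 3 - s' / 100" "z0 = 0" "y0 = s"
  | (rest) "D + 200 * real n \<le> s" "s \<le> 3 * D" "r0 = 4 - qe" "z0 = 0" "y0 = s" "r1 = qe" "z1 = 0" "y1 = s" "b = \<beta>e"
  | (gap) v b' where "(v, r0, r1, z1, b') \<in> segments (gap qs qe e)" "s = D * v" "z0 = 0" "y0 = s" "y1 = s" "b = \<beta>e + b'"
  using assms unfolding St_def by (elim disjE exE conjE) (auto split: if_splits)

lemma angle:
  "cos ((b + 180 * of_int j) * pi / 180) = (if even j then cos (b * pi / 180) else - cos (b * pi / 180))"
  "sin ((b + 180 * of_int j) * pi / 180) = (if even j then sin (b * pi / 180) else - sin (b * pi / 180))"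
proof -
  have "(b + 180 * of_int j) * pi / 180 = b * pi / 180 + pi * of_int j" by (simp add: field_simps)
  then show "cos ((b + 180 * of_int j) * pi / 180) = (if even j then cos (b * pi / 180) else - cos (b * pi / 180))"
    "sin ((b + 180 * of_int j) * pi / 180) = (if even j then sin (b * pi / 180) else - sin (b * pi / 180))"
    by (simp_all only: cos_add_pi_int sin_add_pi_int)
qed

lemma angle_zone: "cos ((180 * real j0 - 180) * pi / 180) = (if qs = 3 then 1 else -1)"
  using types by (auto simp: cos_degrees)

text \<open>With three half turns per block, the parity of \<open>3 * k + j0\<close> is that of
  \<open>k + j0\<close>, so the sign changes exactly when strand 1 is the one on
  \<open>odd_block\<close>.\<close>

lemma angle_block:
  "cos ((540 * real k + 180 * real j0 + b) * pi / 180) = (if aL k then cos (b * pi / 180) else - cos (b * pi / 180))"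
  "sin ((540 * real k + 180 * real j0 + b) * pi / 180) = (if aL k then sin (b * pi / 180) else - sin (b * pi / 180))"
proof -
  have *: "540 * real k + 180 * real j0 + b = b + 180 * of_int (int (3 * k + j0))" by simp
  show "cos ((540 * real k + 180 * real j0 + b) * pi / 180) = (if aL k then cos (b * pi / 180) else - cos (b * pi / 180))"
    "sin ((540 * real k + 180 * real j0 + b) * pi / 180) = (if aL k then sin (b * pi / 180) else - sin (b * pi / 180))"
    unfolding * angle aL_def by simp_all
qed

lemma angle_gap:
  "cos ((\<beta>e + b) * pi / 180) = (if e = 1 then cos (b * pi / 180) else - cos (b * pi / 180))"
  "sin ((\<beta>e + b) * pi / 180) = (if e = 1 then sin (b * pi / 180) else - sin (b * pi / 180))"
proof -
  have *: "\<beta>e + b = b + 180 * of_int (3 * int n + int j0 - 1)" by (simp add: \<beta>e_def)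
  have "even (3 * int n + int j0 - 1) \<longleftrightarrow> e = 1" using types by auto
  then show "cos ((\<beta>e + b) * pi / 180) = (if e = 1 then cos (b * pi / 180) else - cos (b * pi / 180))"
    "sin ((\<beta>e + b) * pi / 180) = (if e = 1 then sin (b * pi / 180) else - sin (b * pi / 180))"
    unfolding * angle by simp_all
qed

lemma angle_rest: "cos (\<beta>e * pi / 180) = (if e = 1 then 1 else -1)"
  using angle_gap(1)[of 0] by simp

lemma vertical:
  assumes "St s r0 z0 y0 r1 z1 y1 b" "cos (b * pi / 180) = 0"
  shows "z0 - z1 = - 2 * sin (b * pi / 180)"
  using assms(1)
proof (cases rule: St_cases)
  case zone
  then show ?thesis using assms(2) angle_zone by (simp split: if_splits)
next
  case left
  then show ?thesis using assms(2) odd_block_vertical[OF left(3)] by (simp only: left(5) angle_block) simp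
next
  case right
  then show ?thesis using assms(2) odd_block_vertical[OF right(3)] by (simp only: right(5) angle_block) simp
next
  case rest
  then show ?thesis using assms(2) angle_rest by (simp split: if_splits)
next
  case (gap v b')
  have "cos (b' * pi / 180) = 0" using assms(2) unfolding gap(6) angle_gap by (simp split: if_splits)
  from gap_vertical[OF ty gap(1) this] show ?thesis unfolding gap(3,6) angle_gap by simp
qed

text \<open>Outside the blocks equal heights occur only with cosine 1 or -1, where the ratio of the
  radii has to be 3 or 1/3; hence the radii 1 and 3.\<close>

lemma horizontal:
  assumes "St s r0 z0 y0 r1 z1 y1 b" "z0 = z1"
  shows "r0 * (2 - cos (b * pi / 180)) = r1 * (2 + cos (b * pi / 180))"
  using assms(1)
proof (cases rule: St_cases)
  case zone
  then have "r0 = qs" using zone_facts(8,12)[OF zone(1) q13(1)] assms(2) by simp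
  then show ?thesis unfolding zone(4,7) angle_zone using q13 by auto
next
  case left
  then show ?thesis using odd_block_horizontal[OF left(3)] assms(2) by (simp only: left(5) angle_block) simp
next
  case right
  then show ?thesis using odd_block_horizontal[OF right(3)] assms(2) by (simp only: right(5) angle_block) (simp add: algebra_simps)
next
  case rest
  show ?thesis unfolding rest(3,6,9) angle_rest using types by auto
next
  case (gap v b')
  have z: "z1 = 0" using assms(2) gap(3) by simp
  have "v = 3" "b' = 0" "r1 = qe" using gap_props(12,13,14)[OF ty gap(1) z] by auto
  moreover from this have "r0 = 4 - qe" using gap_props(6)[OF ty gap(1)] by simp
  ultimately show ?thesis unfolding gap(6) angle_gap using types by auto
qed

end

text \<open>Places in the half plane of radius and height through which undisplaced strands may
  pass; \<open>odd_block\<close> must have \<open>y = s\<close> wherever it meets them.\<close>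

definition far :: "real \<Rightarrow> real \<Rightarrow> bool" where
  "far r z \<longleftrightarrow> (\<exists>v q. (q = 1 \<or> q = 3) \<and> (v, r, z) \<in> segments (zone q)) \<or> (z = 0 \<and> 1 \<le> r \<and> r \<le> 3) \<or> 5 \<le> z"

lemma odd_block_twist_far:
  assumes "(s, r, z, y, b) \<in> segments odd_block" "far r z"
  shows "y = s"
proof -
  have "\<not> 5 \<le> z" using odd_block_height[OF assms(1)] by simp
  then consider v q where "q = 1 \<or> q = 3" "(v, r, z) \<in> segments (zone q)" | "z = 0" "1 \<le> r" "r \<le> 3"
    using assms(2) unfolding far_def by blast
  then show ?thesis
    using odd_block_twist_zone[OF assms(1)] odd_block_twist_partner[OF assms(1)] by cases blast+
qed

lemma odd_curve_cell: "(s, r, z, y, b) \<in> segments odd_block \<Longrightarrow> (r, z, y) \<in> odd_cell"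
  unfolding odd_cell_def odd_curve_def by force

lemma partner_cell:
  assumes "0 \<le> s" "s \<le> 200"
  shows "(3 - s / 100, 0, s) \<in> odd_cell"
proof -
  have "(3 - s / 100, 0::real, s) \<in> closed_segment (3, 0, 0) (1, 0, 200)"
    unfolding closed_segment_3 using assms by (intro exI[of _ "s / 200"]) simp
  then show ?thesis by (simp add: odd_cell_def)
qed

lemma odd_cell_y:
  assumes "(r, z, y) \<in> odd_cell"
  shows "3/4 \<le> r" "0 \<le> y" "y \<le> 200" "y = 200 \<Longrightarrow> z = 0" "y = 0 \<Longrightarrow> z = 0" "r = 2 \<Longrightarrow> y = 100"
  using odd_cell_bounds[OF assms] by blast+

lemma odd_cell_cases:
  assumes "(r, z, y) \<in> odd_cell"
  obtains (curve) s b where "(s, r, z, y, b) \<in> segments odd_block"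
    | (partner) "z = 0" "r = 3 - y / 100" "0 \<le> y" "y \<le> 200"
  using assms unfolding odd_cell_def odd_curve_def Un_iff
proof (elim disjE)
  assume "(r, z, y) \<in> closed_segment (3, 0, 0) (1, 0, 200)"
  then obtain u where "0 \<le> u" "u \<le> 1" "r = 3 + u * (1 - 3)" "z = 0 + u * (0 - 0)" "y = 0 + u * (200 - 0)"
    unfolding closed_segment_3 by blast
  then show thesis by (intro partner) simp_all
qed (auto intro: curve)

context odd_braid
begin

section \<open>Turning the chain and flipping the closing arc\<close>

definition "rr i s = (if i = 0 then ra s else rb s)" for i :: nat
definition "zz i s = (if i = 0 then za s else zb s)" for i :: nat
definition "yy i s = (if i = 0 then ya s else yb s)" for i :: nat
definition "\<omega> = 2 * pi / (8 * D)"

lemma \<omega>: "\<omega> > 0" "\<omega> * (8 * D) = 2 * pi" "\<omega> * (4 * D) = pi"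
  using D_pos by (simp_all add: \<omega>_def)

lemma radius_pos: "s \<in> {0..8 * D} \<Longrightarrow> rr i s > 0"
proof -
  assume s: "s \<in> {0..8 * D}"
  from St_q[OF s] have "ra s > 0 \<and> rb s > 0"
  proof (cases rule: St_cases)
    case zone then show ?thesis using zone_facts(3)[OF zone(1) q13(1)] q13 by auto
  next
    case left
    then show ?thesis using odd_cell_y(1)[OF odd_curve_cell[OF left(3)]] odd_block_height[OF left(3)] by simp
  next
    case right
    then show ?thesis using odd_cell_y(1)[OF odd_curve_cell[OF right(3)]] odd_block_height[OF right(3)] by simp
  next
    case rest then show ?thesis using q13 by auto
  next
    case (gap v b') then show ?thesis using gap_props(3,5)[OF ty gap(1)] by simp
  qed
  then show ?thesis by (simp add: rr_def)
qed

lemma strand_cases: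
  assumes "s \<in> {0..8 * D}"
  shows "(\<exists>k<n. \<exists>s' y b'. (s', rr i s, zz i s, y, b') \<in> segments odd_block \<and> s = D + 200 * real k + s' \<and>
      yy i s = D + 200 * real k + y) \<or> (yy i s = s \<and> far (rr i s) (zz i s))"
  using St_q[OF assms]
proof (cases rule: St_cases)
  case (zone v)
  then show ?thesis using q13 by (cases "i = 0") (auto simp: rr_def zz_def yy_def far_def)
next
  case (left k s' y b')
  show ?thesis
  proof (cases "i = 0")
    case True
    then show ?thesis using left by (auto simp: rr_def zz_def yy_def)
  next
    case False
    then have "yy i s = s \<and> far (rr i s) (zz i s)"
      using left odd_block_height[OF left(3)] by (simp add: rr_def zz_def yy_def far_def)
    then show ?thesis ..
  qed
next
  case (right k s' y b')
  show ?thesis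
  proof (cases "i = 0")
    case True
    then have "yy i s = s \<and> far (rr i s) (zz i s)"
      using right odd_block_height[OF right(3)] by (simp add: rr_def zz_def yy_def far_def)
    then show ?thesis ..
  next
    case False
    then show ?thesis using right by (auto simp: rr_def zz_def yy_def)
  qed
next
  case rest
  then show ?thesis using q13 by (cases "i = 0") (auto simp: rr_def zz_def yy_def far_def)
next
  case (gap v b')
  have "far (rb s) (zb s)"
  proof (cases "v \<le> 4")
    case True
    then show ?thesis unfolding far_def using gap_zone[OF ty gap(1)] q13(2) by blast
  next
    case False
    then show ?thesis unfolding far_def using gap_props(9)[OF ty gap(1)] by simp
  qed
  moreover have "far (ra s) (za s)" using gap_props(3,4)[OF ty gap(1)] gap(3) by (simp add: far_def)
  ultimately have "yy i s = s \<and> far (rr i s) (zz i s)" using gap by (simp add: rr_def zz_def yy_def)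
  then show ?thesis ..
qed

text \<open>At each time a strand is on \<open>odd_block\<close> or is undisplaced within
  \<open>far\<close>; only coincidences that involve \<open>odd_block\<close> need an
  argument.\<close>

lemma twist:
  assumes s: "s \<in> {0..8 * D}" "s' \<in> {0..8 * D}" and eq: "rr i s = rr j s'" "zz i s = zz j s'"
  shows "yy i s - s = yy j s' - s'"
  using strand_cases[OF s(1), of i] strand_cases[OF s(2), of j]
proof (elim disjE exE conjE)
  fix k k' u u' y y' b b'
  assume "(u, rr i s, zz i s, y, b) \<in> segments odd_block" "s = D + 200 * real k + u" "yy i s = D + 200 * real k + y"
    "(u', rr j s', zz j s', y', b') \<in> segments odd_block" "s' = D + 200 * real k' + u'" "yy j s' = D + 200 * real k' + y'"
  then show ?thesis using odd_block_twist[of u "rr i s" "zz i s" y b u' y' b'] eq by simp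
next
  fix k u y b
  assume "(u, rr i s, zz i s, y, b) \<in> segments odd_block" "s = D + 200 * real k + u" "yy i s = D + 200 * real k + y"
    "yy j s' = s'" "far (rr j s') (zz j s')"
  then show ?thesis using odd_block_twist_far[of u "rr i s" "zz i s" y b] eq by simp
next
  fix k u y b
  assume "(u, rr j s', zz j s', y, b) \<in> segments odd_block" "s' = D + 200 * real k + u" "yy j s' = D + 200 * real k + y"
    "yy i s = s" "far (rr i s) (zz i s)"
  then show ?thesis using odd_block_twist_far[of u "rr j s'" "zz j s'" y b] eq by simp
qed simp

lemma upper_strand:
  assumes "s \<in> {0..8 * D}" "4 * D \<le> s"
  obtains v b' where "(v, ra s, 2, zb s, b') \<in> segments (gap qs qe e)" "s = D * v" "4 \<le> v" "v \<le> 8"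
    "rb s = 2" "yb s = s" "za s = 0" "ya s = s"
  using St_q[OF assms(1)]
proof (cases rule: St_cases)
  case (zone v)
  then have "D * v \<le> D * 1" using zone_facts(2)[OF zone(1) q13(1)] D_pos by (intro mult_left_mono) auto
  then show thesis using zone(2) assms(2) D_pos by simp
next
  case (left k s' y b')
  then have "200 * real k + 200 \<le> 200 * real n" by linarith
  then show thesis using left(4) odd_block_height[OF left(3)] assms(2) D_pos by simp
next
  case (right k s' y b')
  then have "200 * real k + 200 \<le> 200 * real n" by linarith
  then show thesis using right(4) odd_block_height[OF right(3)] assms(2) D_pos by simp
next
  case rest
  then show thesis using assms(2) D_pos by simp
next
  case (gap v b')
  have "4 \<le> v" using gap(2) assms(2) D_pos by (simp add: mult.commute)
  then show thesis using that[of v b'] gap gap_props(2,8)[OF ty gap(1)] by simp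
qed

text \<open>Height above 5 singles out the open second half of strand 1, so the shear can move this
  arc and leave the rest in place.\<close>

lemma low_strand:
  assumes "s \<in> {0..8 * D}" "5 < zz i s"
  shows "i \<noteq> 0" "4 * D < s" "s < 8 * D"
proof -
  have "i \<noteq> 0 \<and> 4 * D < s \<and> s < 8 * D"
    using St_q[OF assms(1)]
  proof (cases rule: St_cases)
    case (zone v)
    then show ?thesis using zone_facts(5)[OF zone(1) q13(1)] assms(2) by (simp add: zz_def split: if_splits)
  next
    case (left k s' y b')
    then show ?thesis using odd_block_height[OF left(3)] assms(2) by (simp add: zz_def split: if_splits)
  next
    case (right k s' y b')
    then show ?thesis using odd_block_height[OF right(3)] assms(2) by (simp add: zz_def split: if_splits)
  next
    case rest
    then show ?thesis using assms(2) by (simp add: zz_def split: if_splits)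
  next
    case (gap v b')
    then have "i \<noteq> 0" "5 < zb s" using assms(2) by (auto simp: zz_def split: if_splits)
    moreover from this have "\<not> v \<le> 4" "v \<noteq> 8" using gap_props(16,19)[OF ty gap(1)] by auto
    then have "4 < v" "v < 8" using gap_props(2)[OF ty gap(1)] by auto
    ultimately show ?thesis using gap(2) D_pos by (simp add: mult.commute)
  qed
  then show "i \<noteq> 0" "4 * D < s" "s < 8 * D" by blast+
qed

lemma high_strand:
  assumes "4 * D < s" "s < 8 * D"
  shows "5 < zb s"
proof -
  from assms D_pos have "s \<in> {0..8 * D}" "4 * D \<le> s" by auto
  then obtain v b' where v: "(v, ra s, 2, zb s, b') \<in> segments (gap qs qe e)" "s = D * v" "4 \<le> v" "v \<le> 8"
    by (rule upper_strand)
  have "4 < v" "v < 8" using assms v(2) D_pos by (simp_all add: mult.commute)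
  then show ?thesis using gap_props(9,10)[OF ty v(1)] by force
qed

lemma t_odd: "odd t"
proof -
  from types consider "e = 0" "odd n" | "e = -1" "even n" | "e = 1" "even n" by blast
  then show ?thesis
  proof cases
    case 1
    then have "real t = real (3 * n)" using t by simp
    then show ?thesis using 1(2) by (simp only: of_nat_eq_iff) simp
  next
    case 2
    then have "real (t + 1) = real (3 * n)" using t by simp
    then have "t + 1 = 3 * n" by (simp only: of_nat_eq_iff)
    then have "even (t + 1)" using 2(2) by simp
    then show ?thesis by simp
  next
    case 3
    then have "real t = real (3 * n + 1)" using t by simp
    then show ?thesis using 3(2) by (simp only: of_nat_eq_iff) simp
  qed
qed

lemma \<omega>_div: "2 * pi / \<omega> = 8 * D" "pi / \<omega> = 4 * D"
  using D_pos(1) by (simp_all add: \<omega>_def)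

lemma time: "\<theta> \<in> {0..0 + 2 * pi} \<Longrightarrow> \<theta> / \<omega> \<in> {0..8 * D}"
  unfolding \<omega>_div[symmetric] using \<omega>(1) by (simp add: divide_right_mono)

lemma isotopic_chain:
  "isotopic {torus_point t \<theta> j | \<theta> j. True}
    ((\<lambda>(\<theta>, i). (of_real (rr i (\<theta> / \<omega>)) * cis (\<omega> * yy i (\<theta> / \<omega>)), zz i (\<theta> / \<omega>))) ` ({0..0 + 2 * pi} \<times> {..<2}))"
proof (rule braid_closed_isotopic[where \<beta> = "\<lambda>\<theta>. be (\<theta> / \<omega>) * pi / 180"])
  have end_time: "(0 + 2 * pi) / \<omega> = 8 * D" using \<omega> by (simp add: field_simps)
  show "continuous_on {0..0 + 2 * pi} (\<lambda>\<theta>. rr i (\<theta> / \<omega>))" "continuous_on {0..0 + 2 * pi} (\<lambda>\<theta>. zz i (\<theta> / \<omega>))"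
    "continuous_on {0..0 + 2 * pi} (\<lambda>\<theta>. \<omega> * yy i (\<theta> / \<omega>))" for i
    unfolding rr_def zz_def yy_def using \<omega>(1)
    by (cases "i = 0"; auto intro!: continuous_intros continuous_on_compose2[OF cont(1)] continuous_on_compose2[OF cont(2)]
        continuous_on_compose2[OF cont(3)] continuous_on_compose2[OF cont(4)] continuous_on_compose2[OF cont(5)]
        continuous_on_compose2[OF cont(6)])+
  show "continuous_on {0..0 + 2 * pi} (\<lambda>\<theta>. be (\<theta> / \<omega>) * pi / 180)"
    using \<omega>(1) by (auto intro!: continuous_intros continuous_on_compose2[OF cont(7)])
  show "rr i (\<theta> / \<omega>) > 0" if "\<theta> \<in> {0..0 + 2 * pi}" for i \<theta> using radius_pos[OF time[OF that]] .
  \<comment> \<open>The blocks contribute \<open>540 * n\<close> degrees and the closing part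
    \<open>180 * e\<close>, together \<open>180 * t\<close>.\<close>
  show "be ((0 + 2 * pi) / \<omega>) * pi / 180 = be (0 / \<omega>) * pi / 180 + t * pi"
    unfolding end_time div_0 q_ends \<beta>e_def using t by (simp add: field_simps)
  have m: "(i + t) mod 2 = 1 - i" if "i < 2" for i
  proof -
    have "i = 0 \<or> i = 1" using that by auto
    then show ?thesis using t_odd by (auto simp: odd_iff_mod_2_eq_one)
  qed
  show "rr i ((0 + 2 * pi) / \<omega>) = rr ((i + t) mod 2) (0 / \<omega>)" "zz i ((0 + 2 * pi) / \<omega>) = zz ((i + t) mod 2) (0 / \<omega>)"
    if "i < 2" for i
    unfolding end_time m[OF that] using that by (auto simp: rr_def zz_def q_ends less_2_cases_iff)
next
  fix \<theta> assume \<theta>: "\<theta> \<in> {0..0 + 2 * pi}"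
  note St = St_q[OF time[OF \<theta>]]
  show "zz 0 (\<theta> / \<omega>) - zz 1 (\<theta> / \<omega>) = - 2 * sin (be (\<theta> / \<omega>) * pi / 180)"
    if "cos (be (\<theta> / \<omega>) * pi / 180) = 0"
    using vertical[OF St that] by (simp add: zz_def)
  show "rr 0 (\<theta> / \<omega>) * (2 - cos (be (\<theta> / \<omega>) * pi / 180)) = rr 1 (\<theta> / \<omega>) * (2 + cos (be (\<theta> / \<omega>) * pi / 180))"
    if "zz 0 (\<theta> / \<omega>) = zz 1 (\<theta> / \<omega>)"
    using horizontal[OF St] that by (simp add: zz_def rr_def)
next
  fix i j :: nat and \<theta> \<theta>' :: real
  assume "\<theta> \<in> {0..0 + 2 * pi}" "\<theta>' \<in> {0..0 + 2 * pi}" "rr i (\<theta> / \<omega>) = rr j (\<theta>' / \<omega>)" "zz i (\<theta> / \<omega>) = zz j (\<theta>' / \<omega>)"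
  then have "yy i (\<theta> / \<omega>) - \<theta> / \<omega> = yy j (\<theta>' / \<omega>) - \<theta>' / \<omega>" by (intro twist time)
  then have "\<omega> * (yy i (\<theta> / \<omega>) - \<theta> / \<omega>) = \<omega> * (yy j (\<theta>' / \<omega>) - \<theta>' / \<omega>)" by simp
  then show "\<omega> * yy i (\<theta> / \<omega>) - \<theta> = \<omega> * yy j (\<theta>' / \<omega>) - \<theta>'" using \<omega>(1) by (simp add: right_diff_distrib)
qed

text \<open>At radius 2 the imaginary part is \<open>2 * sin \<theta>\<close>, so subtracting
  \<open>4 * sin \<theta>\<close> where the sine is negative mirrors the arc in the real line;
  \<open>min\<close> joins this continuously to the part that stays.\<close>

definition flip :: "real \<times> nat \<Rightarrow> real" where
  "flip = (\<lambda>(\<theta>, i). if i = 0 then 0 else - 4 * min 0 (sin \<theta>))"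

lemma flip_nonzero:
  assumes "\<theta> \<in> {0..0 + 2 * pi}" "flip (\<theta>, i) \<noteq> 0"
  shows "4 * D < \<theta> / \<omega>" "\<theta> / \<omega> < 8 * D" "5 < zz i (\<theta> / \<omega>)"
proof -
  have i: "i \<noteq> 0" and s: "sin \<theta> < 0" using assms(2) by (auto simp: flip_def split: if_splits)
  have "\<theta> > pi" using s assms(1) sin_ge_zero[of \<theta>] by force
  moreover have "\<theta> < 2 * pi" using s assms(1) by (cases "\<theta> = 2 * pi") auto
  ultimately show "4 * D < \<theta> / \<omega>" "\<theta> / \<omega> < 8 * D"
    unfolding \<omega>_div[symmetric] using \<omega>(1) by (simp_all add: divide_strict_right_mono)
  then show "5 < zz i (\<theta> / \<omega>)" using high_strand i by (simp add: zz_def)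
qed

text \<open>Above height 5 the link lies over the half circle of radius 2 with negative sine, where
  the real part determines the point and hence the shift.\<close>

lemma flip_wd:
  assumes th: "\<theta> \<in> {0..0 + 2 * pi}" "\<theta>' \<in> {0..0 + 2 * pi}" and nz: "flip (\<theta>, i) \<noteq> 0"
    and z: "zz i (\<theta> / \<omega>) = zz j (\<theta>' / \<omega>)"
    and Re: "rr i (\<theta> / \<omega>) * cos (\<omega> * yy i (\<theta> / \<omega>)) = rr j (\<theta>' / \<omega>) * cos (\<omega> * yy j (\<theta>' / \<omega>))"
  shows "flip (\<theta>, i) = flip (\<theta>', j)"
proof -
  note F = flip_nonzero[OF th(1) nz]
  have z5: "5 < zz j (\<theta>' / \<omega>)" using F(3) z by simp
  note G = low_strand[OF time[OF th(2)] z5]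
  have i: "i \<noteq> 0" using nz by (auto simp: flip_def split: if_splits)
  have "rr i (\<theta> / \<omega>) = 2 \<and> yy i (\<theta> / \<omega>) = \<theta> / \<omega>"
    by (rule upper_strand[OF time[OF th(1)]]) (use F i in \<open>auto simp: rr_def yy_def\<close>)
  moreover have "rr j (\<theta>' / \<omega>) = 2 \<and> yy j (\<theta>' / \<omega>) = \<theta>' / \<omega>"
    by (rule upper_strand[OF time[OF th(2)]]) (use G in \<open>auto simp: rr_def yy_def\<close>)
  ultimately have cos: "cos \<theta> = cos \<theta>'" using Re \<omega>(1) by simp
  have "\<theta>' > pi" "\<theta>' < 2 * pi" using G(2,3) \<omega>(1) unfolding \<omega>_div[symmetric] by (simp_all add: divide_less_cancel)
  then have "sin \<theta>' < 0" by (rule sin_lt_zero)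
  moreover have "sin \<theta> < 0" using nz by (auto simp: flip_def split: if_splits)
  moreover have "(sin \<theta>)\<^sup>2 = (sin \<theta>')\<^sup>2" using cos by (simp add: sin_squared_eq)
  ultimately have "sin \<theta> = sin \<theta>'" by (simp add: power2_eq_iff)
  then show ?thesis using i G(1) by (simp add: flip_def)
qed

lemma isotopic_flip:
  "isotopic {torus_point t \<theta> j | \<theta> j. True}
    ((\<lambda>(\<theta>, i). (of_real (rr i (\<theta> / \<omega>)) * cis (\<omega> * yy i (\<theta> / \<omega>)) + \<i> * of_real (flip (\<theta>, i)), zz i (\<theta> / \<omega>))) ` ({0..0 + 2 * pi} \<times> {..<2}))"
proof (rule isotopic_trans[OF isotopic_chain])
  let ?I = "{0..0 + 2 * pi} \<times> {..<2::nat}"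
  let ?p = "\<lambda>(\<theta>, i). of_real (rr i (\<theta> / \<omega>)) * cis (\<omega> * yy i (\<theta> / \<omega>))"
  have I: "compact ?I" by (intro compact_Times) (auto intro: finite_imp_compact)
  have c: "continuous_on {0..0 + 2 * pi} (\<lambda>\<theta>. rr i (\<theta> / \<omega>))" "continuous_on {0..0 + 2 * pi} (\<lambda>\<theta>. zz i (\<theta> / \<omega>))"
    "continuous_on {0..0 + 2 * pi} (\<lambda>\<theta>. \<omega> * yy i (\<theta> / \<omega>))" for i
    unfolding rr_def zz_def yy_def using \<omega>(1)
    by (cases "i = 0"; auto intro!: continuous_intros continuous_on_compose2[OF cont(1)] continuous_on_compose2[OF cont(2)]
        continuous_on_compose2[OF cont(3)] continuous_on_compose2[OF cont(4)] continuous_on_compose2[OF cont(5)]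
        continuous_on_compose2[OF cont(6)])+
  have "isotopic ((\<lambda>x. (?p x, (\<lambda>(\<theta>, i). zz i (\<theta> / \<omega>)) x)) ` ?I)
      ((\<lambda>x. (?p x + \<i> * of_real (flip x), (\<lambda>(\<theta>, i). zz i (\<theta> / \<omega>)) x)) ` ?I)"
  proof (rule isotopic_shear[OF I])
    show "continuous_on ?I ?p" by (intro continuous_on_two_strands continuous_intros c)
    show "continuous_on ?I (\<lambda>(\<theta>, i). zz i (\<theta> / \<omega>))" by (intro continuous_on_two_strands c)
    have "continuous_on {0..0 + 2 * pi} (\<lambda>\<theta>. if i = 0 then 0 else - 4 * min 0 (sin \<theta>))" for i :: nat
      by (cases "i = 0") (auto intro!: continuous_intros)
    then have "continuous_on ?I (\<lambda>(\<theta>, i). (if i = 0 then 0 else - 4 * min 0 (sin \<theta>)))"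
      by (rule continuous_on_two_strands)
    then show "continuous_on ?I flip" by (simp add: flip_def)
    fix x y assume xy: "x \<in> ?I" "y \<in> ?I" "Re (?p x) = Re (?p y)" "(\<lambda>(\<theta>, i). zz i (\<theta> / \<omega>)) x = (\<lambda>(\<theta>, i). zz i (\<theta> / \<omega>)) y"
    obtain \<theta> i \<theta>' j where e: "x = (\<theta>, i)" "y = (\<theta>', j)" by (cases x, cases y)
    have th: "\<theta> \<in> {0..0 + 2 * pi}" "\<theta>' \<in> {0..0 + 2 * pi}" using xy(1,2) by (auto simp: e)
    have z: "zz i (\<theta> / \<omega>) = zz j (\<theta>' / \<omega>)" using xy(4) by (simp add: e)
    have Re: "rr i (\<theta> / \<omega>) * cos (\<omega> * yy i (\<theta> / \<omega>)) = rr j (\<theta>' / \<omega>) * cos (\<omega> * yy j (\<theta>' / \<omega>))"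
      using xy(3) by (simp add: e)
    show "flip x = flip y"
      unfolding e using flip_wd[OF th _ z Re] flip_wd[OF th(2,1) _ z[symmetric] Re[symmetric]] by metis
  qed
  then show "isotopic ((\<lambda>(\<theta>, i). (of_real (rr i (\<theta> / \<omega>)) * cis (\<omega> * yy i (\<theta> / \<omega>)), zz i (\<theta> / \<omega>))) ` ?I)
    ((\<lambda>(\<theta>, i). (of_real (rr i (\<theta> / \<omega>)) * cis (\<omega> * yy i (\<theta> / \<omega>)) + \<i> * of_real (flip (\<theta>, i)), zz i (\<theta> / \<omega>))) ` ?I)"
    by (simp add: case_prod_unfold)
qed


text \<open>The flipped link in cylindrical coordinates; \<open>over\<close> is the flipped arc, which runs over the whole
  chain and supplies the fifth strand of each crossing.\<close>

inductive passage :: "real \<Rightarrow> real \<Rightarrow> real \<Rightarrow> bool" where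
  cell: "k < n \<Longrightarrow> (r, z, u) \<in> odd_cell \<Longrightarrow> passage (D + 200 * real k + u) r z"
| start: "(v, r, z) \<in> segments (zone qs) \<Longrightarrow> passage (D * v) r z"
| stop: "(v, r, z) \<in> segments (zone qe) \<Longrightarrow> passage (D * (4 - v)) r z"
| flat_start: "0 \<le> y \<Longrightarrow> y \<le> D \<Longrightarrow> passage y (4 - qs) 0"
| flat_rest: "D + 200 * real n \<le> y \<Longrightarrow> y \<le> 3 * D \<Longrightarrow> r = 1 \<or> r = 3 \<Longrightarrow> passage y r 0"
| flat_stop: "3 * D \<le> y \<Longrightarrow> y \<le> 4 * D \<Longrightarrow> passage y (4 - qe) 0"
| behind: "(v, r, 2, z, b) \<in> segments (gap qs qe e) \<Longrightarrow> 4 \<le> v \<Longrightarrow> passage (D * v) r 0"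
| over: "(v, r, 2, z, b) \<in> segments (gap qs qe e) \<Longrightarrow> 4 \<le> v \<Longrightarrow> passage (D * (8 - v)) 2 z"

lemma D_times: "D * v \<le> D * w \<longleftrightarrow> v \<le> w" "D * v = D * w \<longleftrightarrow> v = w"
  using D_pos(1) by simp_all

lemma D_times_numeral: "D * v \<le> D \<longleftrightarrow> v \<le> 1" "D \<le> D * v \<longleftrightarrow> 1 \<le> v" "0 \<le> D * v \<longleftrightarrow> 0 \<le> v"
    "D * v \<le> numeral k * D \<longleftrightarrow> v \<le> numeral k" "numeral k * D \<le> D * v \<longleftrightarrow> numeral k \<le> v"
  using D_times(1)[of v 1] D_times(1)[of 1 v] D_times(1)[of 0 v] D_times(1)[of v "numeral k"] D_times(1)[of "numeral k" v]
    D_pos(1)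
  by (simp_all add: mult.commute)

lemma St_zone: "(v, r, z) \<in> segments (zone qs) \<Longrightarrow> St (D * v) r z (D * v) (4 - qs) 0 (D * v) (180 * real j0 - 180)"
  unfolding St_def by blast

lemma St_left: "k < n \<Longrightarrow> aL k \<Longrightarrow> (s, r, z, y, b) \<in> segments odd_block \<Longrightarrow>
    St (D + 200 * real k + s) r z (D + 200 * real k + y) (3 - s / 100) 0 (D + 200 * real k + s) (540 * real k + 180 * real j0 + b)"
  unfolding St_def
  by (rule disjI2, rule disjI1, rule exI[of _ k], rule conjI, assumption, rule exI[of _ s], rule exI[of _ r],
      rule exI[of _ z], rule exI[of _ y], rule exI[of _ b]) simp

lemma St_right: "k < n \<Longrightarrow> \<not> aL k \<Longrightarrow> (s, r, z, y, b) \<in> segments odd_block \<Longrightarrow>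
    St (D + 200 * real k + s) (3 - s / 100) 0 (D + 200 * real k + s) r z (D + 200 * real k + y) (540 * real k + 180 * real j0 + b)"
  unfolding St_def
  by (rule disjI2, rule disjI1, rule exI[of _ k], rule conjI, assumption, rule exI[of _ s], rule exI[of _ r],
      rule exI[of _ z], rule exI[of _ y], rule exI[of _ b]) simp

lemma St_rest: "D + 200 * real n \<le> s \<Longrightarrow> s \<le> 3 * D \<Longrightarrow> St s (4 - qe) 0 s qe 0 s \<beta>e"
  unfolding St_def by blast

lemma St_gap: "(v, r0, r1, z1, b) \<in> segments (gap qs qe e) \<Longrightarrow> St (D * v) r0 0 (D * v) r1 z1 (D * v) (\<beta>e + b)"
  unfolding St_def by blast

lemma block_end: "k < n \<Longrightarrow> u \<le> 200 \<Longrightarrow> D + 200 * real k + u \<le> D + 200 * real n"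
proof -
  assume "k < n" "u \<le> 200"
  then have "real k + 1 \<le> real n" by linarith
  then show ?thesis using \<open>u \<le> 200\<close> by linarith
qed

lemma passage_strand:
  assumes s: "s \<in> {0..8 * D}" and i: "i = 0 \<or> s \<le> 4 * D"
  shows "passage (yy i s) (rr i s) (zz i s)"
  using St_q[OF s]
proof (cases rule: St_cases)
  case (zone v)
  then have "0 \<le> s" "s \<le> D" using zone_facts(1,2)[OF zone(1) q13(1)] by (simp_all add: D_times_numeral)
  then show ?thesis
    using start[OF zone(1)] flat_start[of s] zone by (cases "i = 0") (simp_all add: rr_def zz_def yy_def)
next
  case (left k s' y b')
  have "0 \<le> s'" "s' \<le> 200" using odd_block_height[OF left(3)] by simp_all
  then show ?thesis
    using cell[OF left(1) odd_curve_cell[OF left(3)]] cell[OF left(1) partner_cell[of s']] left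
    by (cases "i = 0") (simp_all add: rr_def zz_def yy_def)
next
  case (right k s' y b')
  have "0 \<le> s'" "s' \<le> 200" using odd_block_height[OF right(3)] by simp_all
  then show ?thesis
    using cell[OF right(1) odd_curve_cell[OF right(3)]] cell[OF right(1) partner_cell[of s']] right
    by (cases "i = 0") (simp_all add: rr_def zz_def yy_def)
next
  case rest
  then show ?thesis
    using flat_rest[of s qe] flat_rest[of s "4 - qe"] q13(2) by (cases "i = 0") (auto simp: rr_def zz_def yy_def)
next
  case (gap v b')
  show ?thesis
  proof (cases "v \<le> 4")
    case True
    then have "ra s = 4 - qe" "3 \<le> v" "(4 - v, rb s, zb s) \<in> segments (zone qe)"
      using gap_props(1,6)[OF ty gap(1)] gap_zone[OF ty gap(1)] by simp_all
    then show ?thesis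
      using stop[of "4 - v" "rb s" "zb s"] flat_stop[of s] gap True
      by (cases "i = 0") (simp_all add: rr_def zz_def yy_def D_times_numeral)
  next
    case False
    then have "i = 0" using i gap(2) by (auto simp: D_times_numeral)
    moreover have "rb s = 2" using gap_props(8)[OF ty gap(1)] False by simp
    ultimately show ?thesis
      using behind[of v "ra s" "zb s" b'] gap False by (simp add: rr_def zz_def yy_def)
  qed
qed

lemma passage_flipped:
  assumes "s \<in> {0..8 * D}" "4 * D \<le> s"
  shows "passage (8 * D - s) 2 (zb s)"
proof -
  obtain v b' where v: "(v, ra s, 2, zb s, b') \<in> segments (gap qs qe e)" "s = D * v" "4 \<le> v"
    using assms by (rule upper_strand)
  have "8 * D - s = D * (8 - v)" by (simp add: v(2) algebra_simps)
  then show ?thesis using over[OF v(1,3)] by simp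
qed

lemma strand_passage:
  assumes "passage y r z"
  shows "(\<exists>s i. s \<in> {0..8 * D} \<and> i < 2 \<and> (i = 0 \<or> s \<le> 4 * D) \<and> yy i s = y \<and> rr i s = r \<and> zz i s = z) \<or>
    (\<exists>s. s \<in> {0..8 * D} \<and> 4 * D \<le> s \<and> r = 2 \<and> y = 8 * D - s \<and> zb s = z)"
    (is "?S \<or> ?F")
proof -
  have left: ?S if "St s r z y r1 z1 y1 b" for s r1 z1 y1 b
    using q_St[OF that] by (intro exI[of _ s] exI[of _ 0]) (simp add: rr_def zz_def yy_def)
  have right: ?S if "St s r1 z1 y1 r z y b" "s \<le> 4 * D" for s r1 z1 y1 b
    using q_St[OF that(1)] that(2) by (intro exI[of _ s] exI[of _ 1]) (simp add: rr_def zz_def yy_def)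
  show ?thesis
    using assms
  proof cases
    case (cell k u)
    have early: "D + 200 * real k + s \<le> 4 * D" if "s \<le> 200" for s
      using block_end[OF cell(2) that] D_pos by linarith
    from cell(3) have ?S
    proof (cases rule: odd_cell_cases)
      case (curve s b)
      then have "s \<le> 200" using odd_block_height[OF curve] by simp
      then show ?thesis
        unfolding cell(1) using left[OF St_left[OF cell(2) _ curve, folded cell(1)]]
          right[OF St_right[OF cell(2) _ curve, folded cell(1)] early] cell(1) by blast
    next
      case partner
      obtain r' z' y' b where c: "(u, r', z', y', b) \<in> segments odd_block"
        using graph_exists[of odd_block u] partner by (auto simp: odd_block_def)
      have "St y r z y r' z' (D + 200 * real k + y') (540 * real k + 180 * real j0 + b)" if "\<not> aL k"
        using St_right[OF cell(2) that c] partner(1,2) cell(1) by simp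
      moreover have "St y r' z' (D + 200 * real k + y') r z y (540 * real k + 180 * real j0 + b)" if "aL k"
        using St_left[OF cell(2) that c] partner(1,2) cell(1) by simp
      ultimately show ?thesis using left right early[OF partner(4)] cell(1) by blast
    qed
    then show ?thesis ..
  next
    case (start v)
    then show ?thesis using left St_zone by blast
  next
    case (stop v)
    then obtain ra b where g: "(4 - v, ra, r, z, b) \<in> segments (gap qs qe e)" using zone_gap[OF ty] by blast
    have "D * (4 - v) \<le> 4 * D" using zone_facts(1)[OF stop(2) q13(2)] by (simp add: D_times_numeral)
    then show ?thesis using right[OF St_gap[OF g, folded stop(1)]] stop(1) by blast
  next
    case flat_start
    have "fst (hd (zone qs)) \<le> y / D" "y / D \<le> fst (last (zone qs))"
      using flat_start D_pos by (simp_all add: zone_def)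
    then obtain r' z' where c: "(y / D, r', z') \<in> segments (zone qs)"
      using graph_exists[of "zone qs" "y / D"] by (auto simp: zone_def)
    have "D * (y / D) = y" using D_pos by simp
    then have "St y r' z' y r z y (180 * real j0 - 180)" using St_zone[OF c] flat_start by simp
    then show ?thesis using right flat_start D_pos by force
  next
    case flat_rest
    then have "St y (4 - qe) 0 y qe 0 y \<beta>e" by (intro St_rest)
    moreover have "r = 4 - qe \<or> r = qe" using flat_rest q13(2) by auto
    ultimately show ?thesis using left right flat_rest D_pos by force
  next
    case flat_stop
    have v: "3 \<le> y / D" "y / D \<le> 4" using flat_stop D_pos by (simp_all add: field_simps)
    then obtain ra rb zb b where g: "(y / D, ra, rb, zb, b) \<in> segments (gap qs qe e)"
      using gap_exists[of "y / D" qs qe e] v by auto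
    have "D * (y / D) = y" using D_pos by simp
    then have "St y ra 0 y rb zb y (\<beta>e + b)" using St_gap[OF g] by simp
    moreover have "ra = 4 - qe" using gap_props(6)[OF ty g v(2)] .
    ultimately show ?thesis using left flat_stop by blast
  next
    case (behind v z' b)
    then show ?thesis using left St_gap by blast
  next
    case (over v r' b)
    have "D * v \<in> {0..8 * D} \<and> zb (D * v) = z" using q_St[OF St_gap[OF over(3)]] by simp
    moreover have "4 * D \<le> D * v" using over(4) by (simp add: D_times_numeral)
    moreover have "y = 8 * D - D * v" using over(1) by (simp add: algebra_simps)
    ultimately show ?thesis using over(2) by blast
  qed
qed

lemma flip_low: "s \<in> {0..8 * D} \<Longrightarrow> i = 0 \<or> s \<le> 4 * D \<Longrightarrow> flip (\<omega> * s, i) = 0"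
proof -
  assume s: "s \<in> {0..8 * D}" "i = 0 \<or> s \<le> 4 * D"
  have "0 \<le> sin (\<omega> * s)" if "s \<le> 4 * D"
  proof -
    have "\<omega> * s \<le> pi" unfolding \<omega>(3)[symmetric] using that \<omega>(1) by (intro mult_left_mono) simp_all
    then show ?thesis using s(1) \<omega>(1) by (intro sin_ge_zero) simp_all
  qed
  then show ?thesis using s(2) by (auto simp: flip_def)
qed

lemma flip_high:
  assumes s: "s \<in> {0..8 * D}" "4 * D \<le> s" and i: "i \<noteq> 0"
  shows "of_real (rr i s) * cis (\<omega> * yy i s) + \<i> * of_real (flip (\<omega> * s, i)) = of_real 2 * cis (\<omega> * (8 * D - s))"
proof -
  have "rr i s = 2 \<and> yy i s = s" by (rule upper_strand[OF s]) (use i in \<open>auto simp: rr_def yy_def\<close>)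
  moreover have "sin (\<omega> * s) \<le> 0"
  proof -
    have "pi \<le> \<omega> * s" unfolding \<omega>(3)[symmetric] using s \<omega>(1) by (intro mult_left_mono) simp_all
    moreover have "\<omega> * s \<le> 2 * pi" unfolding \<omega>(2)[symmetric] using s \<omega>(1) by (intro mult_left_mono) simp_all
    ultimately have "0 \<le> sin (\<omega> * s - pi)" by (intro sin_ge_zero) simp_all
    then show ?thesis by (simp add: sin_diff)
  qed
  moreover have "\<omega> * (8 * D - s) = 2 * pi - \<omega> * s" unfolding \<omega>(2)[symmetric] by (rule right_diff_distrib)
  ultimately show ?thesis using i by (simp add: complex_eq_iff flip_def cos_diff sin_diff)
qed

lemma flipped_link:
  "(\<lambda>(\<theta>, i). (of_real (rr i (\<theta> / \<omega>)) * cis (\<omega> * yy i (\<theta> / \<omega>)) + \<i> * of_real (flip (\<theta>, i)), zz i (\<theta> / \<omega>)))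
      ` ({0..0 + 2 * pi} \<times> {..<2}) = polar_link \<omega> passage"
  (is "?f ` _ = _")
proof (intro subset_antisym subsetI)
  fix p assume "p \<in> ?f ` ({0..0 + 2 * pi} \<times> {..<2})"
  then obtain \<theta> i where \<theta>: "\<theta> \<in> {0..0 + 2 * pi}" and p: "p = ?f (\<theta>, i)" by blast
  define s where "s = \<theta> / \<omega>"
  have s: "s \<in> {0..8 * D}" "\<theta> = \<omega> * s" using time[OF \<theta>] \<omega>(1) by (simp_all add: s_def)
  have p: "p = (of_real (rr i s) * cis (\<omega> * yy i s) + \<i> * of_real (flip (\<omega> * s, i)), zz i s)"
    using p \<omega>(1) by (simp add: s(2))
  show "p \<in> polar_link \<omega> passage"
  proof (cases "i = 0 \<or> s \<le> 4 * D")
    case True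
    have "p = (of_real (rr i s) * cis (\<omega> * yy i s), zz i s)" unfolding p flip_low[OF s(1) True] by simp
    then show ?thesis using passage_strand[OF s(1) True] unfolding polar_link_def by blast
  next
    case False
    then have h: "4 * D \<le> s" "i \<noteq> 0" by auto
    have "p = (of_real 2 * cis (\<omega> * (8 * D - s)), zb s)" unfolding p flip_high[OF s(1) h] using h by (simp add: zz_def)
    then show ?thesis using passage_flipped[OF s(1) h(1)] unfolding polar_link_def by blast
  qed
next
  fix p assume "p \<in> polar_link \<omega> passage"
  then obtain r y z where p: "passage y r z" "p = (of_real r * cis (\<omega> * y), z)" unfolding polar_link_def by blast
  have in_f: "(of_real (rr i s) * cis (\<omega> * yy i s) + \<i> * of_real (flip (\<omega> * s, i)), zz i s) \<in> ?f ` ({0..0 + 2 * pi} \<times> {..<2})"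
    if "s \<in> {0..8 * D}" "i < 2" for s i
  proof -
    have "\<omega> * s \<le> 2 * pi" unfolding \<omega>(2)[symmetric] using that(1) \<omega>(1) by (intro mult_left_mono) simp_all
    then have "(\<omega> * s, i) \<in> {0..0 + 2 * pi} \<times> {..<2}" using that \<omega>(1) by simp
    then show ?thesis using \<omega>(1) by (intro image_eqI[of _ _ "(\<omega> * s, i)"]) simp_all
  qed
  from strand_passage[OF p(1)] show "p \<in> ?f ` ({0..0 + 2 * pi} \<times> {..<2})"
  proof (elim disjE exE conjE)
    fix s i assume s: "s \<in> {0..8 * D}" "i < (2::nat)" and e: "yy i s = y" "rr i s = r" "zz i s = z"
    assume "i = 0"
    then show ?thesis using in_f[OF s] flip_low[OF s(1), of i] e p(2) by simp
  next
    fix s i assume s: "s \<in> {0..8 * D}" "i < (2::nat)" and e: "yy i s = y" "rr i s = r" "zz i s = z"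
    assume "s \<le> 4 * D"
    then show ?thesis using in_f[OF s] flip_low[OF s(1), of i] e p(2) by simp
  next
    fix s assume s: "s \<in> {0..8 * D}" "4 * D \<le> s" and e: "r = 2" "y = 8 * D - s" "zb s = z"
    have "(of_real 2 * cis (\<omega> * (8 * D - s)), zz 1 s) \<in> ?f ` ({0..0 + 2 * pi} \<times> {..<2})"
      using in_f[OF s(1), of 1] unfolding flip_high[OF s one_neq_zero] by simp
    then show ?thesis using e p(2) by (simp add: zz_def)
  qed
qed

section \<open>Multiple points of the flipped link\<close>

lemma passage_dest:
  assumes "passage y r z"
  obtains (cell) k u where "k < n" "(r, z, u) \<in> odd_cell" "y = D + 200 * real k + u" "D \<le> y" "y \<le> D + 200 * real n"
  | (start) v where "(v, r, z) \<in> segments (zone qs)" "y = D * v" "0 \<le> y" "y \<le> D"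
  | (stop) v where "(v, r, z) \<in> segments (zone qe)" "y = D * (4 - v)" "3 * D \<le> y" "y \<le> 4 * D"
  | (flat) "z = 0" "r = 1 \<or> r = 3" "0 \<le> y" "y \<le> 4 * D"
      "(y \<le> D \<and> r = 4 - qs) \<or> (D + 200 * real n \<le> y \<and> y \<le> 3 * D) \<or> (3 * D \<le> y \<and> r = 4 - qe)"
  | (behind) "z = 0" "1 \<le> r" "4 * D \<le> y" "y \<le> 8 * D" "y = 4 * D \<Longrightarrow> r = 4 - qe" "y = 8 * D \<Longrightarrow> r = 4 - qs"
  | (over) v ra b where "r = 2" "(v, ra, 2, z, b) \<in> segments (gap qs qe e)" "4 \<le> v" "y = D * (8 - v)" "0 \<le> y" "y \<le> 4 * D"
  using assms
proof cases
  case (cell k u)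
  then have "0 \<le> u" "u \<le> 200" using odd_cell_y[OF cell(3)] by simp_all
  then show thesis using that(1)[of k u] cell block_end[OF cell(2), of u] by simp
next
  case (start v)
  then show thesis using that(2)[of v] zone_facts(1,2)[OF start(2) q13(1)] by (simp add: D_times_numeral)
next
  case (stop v)
  then show thesis using that(3)[of v] zone_facts(1,2)[OF stop(2) q13(2)] by (simp add: D_times_numeral)
next
  case flat_start
  then show thesis using that(4) q13 D_pos by auto
next
  case flat_rest
  then show thesis using that(4) D_pos by auto
next
  case flat_stop
  then show thesis using that(4) q13 D_pos by auto
next
  case (behind v z' b)
  then show thesis using that(5) gap_props(2,3,6,7)[OF ty behind(3)] D_pos(1) by (auto simp: D_times_numeral)
next
  case (over v r' b)
  then show thesis using that(6)[of v r' b] gap_props(2)[OF ty over(3)] by (simp add: D_times_numeral)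
qed

definition centres :: "real set" where
  "centres = (\<lambda>k. D + 200 * real k + 100) ` {..<n}"

lemma cell_centre: "k < n \<Longrightarrow> (2, z, u) \<in> odd_cell \<Longrightarrow> D + 200 * real k + u \<in> centres"
  using odd_cell_y(6) by (auto simp: centres_def)

lemma zone_over:
  assumes "(v, 2, z) \<in> segments (zone q0)" "q0 = 1 \<or> q0 = 3"
  shows "v = 0" "z = 5"
  using zone_facts(7,10)[OF assms] by simp_all

text \<open>The bounds on \<open>u\<close> are strict because a position with \<open>u = 0\<close>
  or \<open>u = 200\<close> can belong to two neighbouring blocks.\<close>

lemma same_block:
  assumes "D + 200 * real k + u = D + 200 * real k' + u'" "0 < u" "u < 200" "0 \<le> u'" "u' \<le> 200"
  shows "k = k'" "u = u'"
proof -
  have "\<bar>real k - real k'\<bar> < 1" using assms by linarith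
  then show "k = k'" by linarith
  then show "u = u'" using assms(1) by simp
qed

text \<open>Of two different heights one is nonzero; assuming this of \<open>z\<close> removes the
  pieces at height 0 from the outer case distinction.\<close>

lemma passage_unique_aux:
  assumes R: "passage y r z" and R': "passage y r z'" and "z \<noteq> 0"
  shows "z = z' \<or> (y \<in> centres \<and> r = 2)"
  using R
proof (cases rule: passage_dest)
  case (cell k u)
  \<comment> \<open>At both ends of a cell the height is 0.\<close>
  have u: "0 < u" "u < 200" using odd_cell_y[OF cell(2)] \<open>z \<noteq> 0\<close> by (auto simp: order.order_iff_strict)
  have y: "D < y" "y < D + 200 * real n"
    using u block_end[OF cell(1), of 200] unfolding cell(3) by simp_all
  have "r = 2 \<Longrightarrow> y \<in> centres" using cell_centre[OF cell(1)] cell(2,3) by auto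
  from R' show ?thesis
  proof (cases rule: passage_dest)
    case c': (cell k' u')
    have "k = k'" "u = u'"
      using same_block[of k u k' u'] cell(3) c'(3) u odd_cell_y(2,3)[OF c'(2)] by simp_all
    then show ?thesis using odd_cell_planar[of r z u z'] cell(2) c'(2) \<open>r = 2 \<Longrightarrow> y \<in> centres\<close> by auto
  qed (use y D_pos \<open>r = 2 \<Longrightarrow> y \<in> centres\<close> in auto)
next
  case (start v)
  have "v \<noteq> 1" using zone_facts(9)[OF start(1) q13(1)] \<open>z \<noteq> 0\<close> by auto
  then have y: "y < D" using zone_facts(2)[OF start(1) q13(1)] start(2) D_times_numeral(2)[of v] by fastforce
  from R' show ?thesis
  proof (cases rule: passage_dest)
    case s': (start v')
    then have "v = v'" using start(2) D_times(2)[of v v'] by simp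
    then show ?thesis using zone_unique[OF start(1)] s'(1) q13(1) by auto
  next
    case o': (over v' ra b)
    then have "v = 0" "z = 5" using zone_over[OF _ q13(1)] start(1) by auto
    then have "D * (8 - v') = 0" using start(2) o'(4) by simp
    then have "v' = 8" using D_pos(1) by auto
    then show ?thesis using gap_props(16)[OF ty o'(2)] \<open>z = 5\<close> by simp
  qed (use y D_pos zone_facts(11)[OF start(1) q13(1)] in auto)
next
  case (stop v)
  have "v \<noteq> 1" using zone_facts(9)[OF stop(1) q13(2)] \<open>z \<noteq> 0\<close> by auto
  then have "3 < 4 - v" using zone_facts(2)[OF stop(1) q13(2)] by simp
  then have y: "3 * D < y" using stop(2) D_times_numeral(4)[of "4 - v" "num.Bit1 num.One"] by fastforce
  from R' show ?thesis
  proof (cases rule: passage_dest)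
    case s': (stop v')
    then have "4 - v = 4 - v'" using stop(2) D_times(2)[of "4 - v" "4 - v'"] by simp
    then show ?thesis using zone_unique[OF stop(1)] s'(1) q13(2) by auto
  next
    case b': behind
    then have "y = 4 * D" using stop(4) by simp
    then show ?thesis using b'(5) zone_facts(11)[OF stop(1) q13(2)] by simp
  next
    case o': (over v' ra b)
    then have v: "v = 0" "z = 5" using zone_over[OF _ q13(2)] stop(1) by auto
    then have "8 - v' = 4" using stop(2) o'(4) D_times(2)[of "8 - v'" 4] by simp
    then have "v' = 4" by simp
    then show ?thesis using gap_props(15)[OF ty o'(2)] v by simp
  qed (use y D_pos zone_facts(11)[OF stop(1) q13(2)] in auto)
next
  case (over v ra b)
  from R' show ?thesis
  proof (cases rule: passage_dest)
    case c': (cell k u)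
    then show ?thesis using cell_centre[OF c'(1)] over(1) by auto
  next
    case s': (start v')
    then have v: "v' = 0" "z' = 5" using zone_over[OF _ q13(1)] over(1) by auto
    then have "D * (8 - v) = 0" using s'(2) over(4) by simp
    then have "v = 8" using D_pos(1) by auto
    then show ?thesis using gap_props(16)[OF ty over(2)] v by simp
  next
    case s': (stop v')
    then have v: "v' = 0" "z' = 5" using zone_over[OF _ q13(2)] over(1) by auto
    then have "8 - v = 4" using s'(2) over(4) D_times(2)[of "8 - v" 4] by simp
    then have "v = 4" by simp
    then show ?thesis using gap_props(15)[OF ty over(2)] v by simp
  next
    case flat
    then show ?thesis using over(1) by simp
  next
    case b': behind
    then have "y = 4 * D" using over(6) by simp
    then show ?thesis using b'(5) over(1) q13(2) by auto
  next
    case o': (over v' ra' b')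
    then have "8 - v = 8 - v'" using over(4) D_times(2)[of "8 - v" "8 - v'"] by simp
    then show ?thesis using gap_unique[OF over(2)] o'(2) by auto
  qed
qed (use \<open>z \<noteq> 0\<close> in auto)

lemma passage_unique:
  assumes "passage y r z" "passage y r z'"
  shows "z = z' \<or> (y \<in> centres \<and> r = 2)"
  using passage_unique_aux[OF assms] passage_unique_aux[OF assms(2,1)] by (cases "z = 0"; cases "z' = 0") auto

lemma passage_ends:
  assumes "passage 0 r z" "passage (8 * D) r z'"
  shows "z = z'"
proof -
  \<comment> \<open>Position \<open>8 * D\<close> is reached only by \<open>behind\<close>, at
    radius \<open>4 - qs\<close> and height 0.\<close>
  have r: "r = 4 - qs \<and> z' = 0" using assms(2) by (cases rule: passage_dest) (use D_pos in auto)
  then have "r \<noteq> 2" using q13(1) by auto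
  from assms(1) have "z = 0"
  proof (cases rule: passage_dest)
    case (start v)
    then show ?thesis using zone_facts(11)[OF start(1) q13(1)] r by simp
  qed (use D_pos \<open>r \<noteq> 2\<close> in auto)
  then show ?thesis using r by simp
qed

text \<open>Positions over the chain lie between \<open>D\<close> and \<open>3 * D\<close>. On the
  flipped arc this means \<open>5 \<le> v\<close> and \<open>v \<le> 7\<close>, where its height is
  constantly 6.\<close>

lemma passage_local:
  assumes k: "k < n" and small: "\<bar>x\<bar> < 1/100" "\<bar>y\<bar> < 1/100"
  shows "passage (D + 200 * real k + 100 + y) (2 + x) z \<longleftrightarrow> (2 + x, z, 100 + y) \<in> odd_cell \<or> (x = 0 \<and> z = 6)"
    (is "passage ?y _ _ \<longleftrightarrow> ?R")
proof -
  have y: "D < ?y" "?y < D + 200 * real n" using block_end[OF k, of 200] small by linarith+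
  have u: "0 < 100 + y" "100 + y < 200" using small by linarith+
  show ?thesis
  proof
    assume "passage ?y (2 + x) z"
    then show ?R
    proof (cases rule: passage_dest)
      case (cell k' u')
      have "100 + y = u'"
        using same_block(2)[of k "100 + y" k' u'] cell(3) u odd_cell_y(2,3)[OF cell(2)] by simp
      then show ?thesis using cell(2) by simp
    next
      case flat
      then show ?thesis using small by auto
    next
      case (over v ra b)
      have "D \<le> D * (8 - v)" "D * (8 - v) \<le> 3 * D" using y D_pos(2) over(4) by linarith+
      then have "1 \<le> 8 - v" "8 - v \<le> 3" by (simp_all only: D_times_numeral)
      then have "z = 6" using gap_props(11)[OF ty over(2)] by simp
      then show ?thesis using over(1) by simp
    qed (use y D_pos in auto)
  next
    assume ?R
    then show "passage ?y (2 + x) z"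
    proof
      assume "(2 + x, z, 100 + y) \<in> odd_cell"
      from cell[OF k this] show ?thesis by (simp add: add.assoc)
    next
      assume xz: "x = 0 \<and> z = 6"
      define v where "v = 8 - ?y / D"
      have "?y / D \<le> 3" "1 \<le> ?y / D" using y D_pos by (simp_all add: divide_le_eq le_divide_eq)
      then have v: "5 \<le> v" "v \<le> 7" by (simp_all add: v_def)
      obtain ra rb zb b where g: "(v, ra, rb, zb, b) \<in> segments (gap qs qe e)"
        using gap_exists[of v qs qe e] v by auto
      have "rb = 2" "zb = 6" using gap_props(8,11)[OF ty g] v by simp_all
      then have "passage (D * (8 - v)) 2 6" using over[of v ra 6 b] g v by simp
      moreover have "D * (8 - v) = ?y" using D_pos by (simp add: v_def)
      ultimately show ?thesis using xz by simp
    qed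
  qed
qed

lemma crossing_number_le: "n_crossing_number 5 (torus_link2 t) \<le> enat n"
proof -
  define \<sigma> where "\<sigma> j = ([76, 4, -68, -100] :: real list) ! j" for j :: nat
  define h where "h m j = ([3, -3, 4, 0, 6] :: real list) ! j" for m :: real and j :: nat
  have cross: "n_crossing_projection 5 proj2 (cyl3 ` polar_link \<omega> passage) \<and>
    card (multiple_points proj2 (cyl3 ` polar_link \<omega> passage)) \<le> card centres"
  proof (rule polar_link_crossings[where Y = "8 * D" and \<epsilon> = "1/100" and \<sigma> = \<sigma> and h = h and M = centres])
    show "0 \<le> y \<and> y \<le> 8 * D \<and> 0 < r" if "passage y r z" for y r z
      using that
    proof (cases rule: passage_dest)
      case (cell k u)
      then show ?thesis using odd_cell_y(1)[OF cell(2)] D_pos by simp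
    next
      case (start v)
      then show ?thesis using zone_facts(3)[OF start(1) q13(1)] D_pos by simp
    next
      case (stop v)
      then show ?thesis using zone_facts(3)[OF stop(1) q13(2)] D_pos by simp
    qed (use D_pos in auto)
  next
    fix m x y z :: real assume "m \<in> centres" and small: "\<bar>x\<bar> < 1/100" "\<bar>y\<bar> < 1/100"
    then obtain k where k: "k < n" "m = D + 200 * real k + 100" by (auto simp: centres_def)
    have "\<bar>x\<bar> < 1/2" using small by simp
    then show "passage (m + y) (2 + x) z \<longleftrightarrow> (\<exists>j<4. y = \<sigma> j * x \<and> z = h m j) \<or> (x = 0 \<and> z = h m 4)"
      unfolding k(2) passage_local[OF k(1) small] ex_less_4 by (simp add: odd_cell_crossing \<sigma>_def h_def)
  next
    show "1/100 \<le> m \<and> m \<le> 8 * D - 1/100" if m: "m \<in> centres" for m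
    proof -
      obtain k where k: "k < n" "m = D + 200 * real k + 100" using m by (auto simp: centres_def)
      then show ?thesis using block_end[OF k(1), of 200] D_pos by simp
    qed
    show "finite centres" by (simp add: centres_def)
    show "inj_on (h m) {..<5}" for m by (simp add: lessThan_4_5 h_def)
    show "inj_on \<sigma> {..<4}" by (simp add: lessThan_4_5 \<sigma>_def)
  qed (use \<omega> passage_unique passage_ends in simp_all)
  have "inj_on (\<lambda>k. D + 200 * real k + 100) {..<n}" by (auto simp: inj_on_def)
  then have "card centres = n" unfolding centres_def by (simp add: card_image)
  moreover have "t > 0" using t_odd by (cases t) auto
  ultimately show ?thesis
    using crossing_number_torus_link2_le[OF _ isotopic_flip[unfolded flipped_link]] cross by simp
qed

end

theorem theorem17:
  fixes t :: nat
  assumes "t > 0"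
  shows "n_crossing_number 5 (torus_link2 t) \<le>
    (if even t then enat (nat \<lceil>real t / 4\<rceil>) else enat (nat \<lfloor>(real t + 1) / 3\<rfloor>))"
proof (cases "even t")
  case True
  define n where "n = nat \<lceil>real t / 4\<rceil>"
  \<comment> \<open>For even \<open>t\<close> rounding up leaves these two values; the second is
    served by the special last block.\<close>
  have n: "t = 4 * n \<or> t = 4 * n - 2" "n > 0"
  proof -
    have "real t / 4 \<le> real n" "real n < real t / 4 + 1" using assms unfolding n_def by linarith+
    then have "t \<le> 4 * n" "4 * n < t + 4" by linarith+
    then show "t = 4 * n \<or> t = 4 * n - 2" "n > 0" using True assms by presburger+
  qed
  then show ?thesis
    using even_case[of t n False] even_case[of t n True] True by (auto simp: n_def)
next
  case False
  have floor: "nat \<lfloor>(real t + 1) / 3\<rfloor> = n" if "3 * n \<le> t + 1" "t + 1 < 3 * n + 3" for n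
  proof -
    have "real (3 * n) \<le> real (t + 1)" "real (t + 1) < real (3 * n + 3)"
      using that by (simp_all only: of_nat_le_iff of_nat_less_iff)
    then have "\<lfloor>(real t + 1) / 3\<rfloor> = int n" by (intro floor_unique) simp_all
    then show ?thesis by simp
  qed
  define m where "m = t div 6"
  \<comment> \<open>The residue modulo 3 selects \<open>e\<close>, and the oddness of
    \<open>t\<close> then fixes the parity of the number of blocks; hence residues modulo 6.\<close>
  have "t = 6 * m + 1 \<or> t = 6 * m + 3 \<or> t = 6 * m + 5" using False unfolding m_def by presburger
  then consider (1) "t = 6 * m + 1" | (3) "t = 6 * m + 3" | (5) "t = 6 * m + 5" by blast
  then show ?thesis
  proof cases
    \<comment> \<open>For \<open>m = 0\<close> the chain is empty: the unknot without
      crossings.\<close>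
    case 1
    have "odd_braid 3 1 1 (200 * (real (2 * m) + 1)) (2 * m) t 1"
      by standard (simp_all add: 1 gap_type_def)
    from odd_braid.crossing_number_le[OF this] show ?thesis
      using False floor[of "2 * m"] 1 by simp
  next
    case 3
    have "odd_braid 3 3 0 (200 * (real (2 * m + 1) + 1)) (2 * m + 1) t 1"
      by standard (simp_all add: 3 gap_type_def)
    from odd_braid.crossing_number_le[OF this] show ?thesis
      using False floor[of "2 * m + 1"] 3 by simp
  next
    case 5
    have "odd_braid 1 3 (-1) (200 * (real (2 * m + 2) + 1)) (2 * m + 2) t 0"
      by standard (simp_all add: 5 gap_type_def)
    from odd_braid.crossing_number_le[OF this] show ?thesis
      using False floor[of "2 * m + 2"] 5 by simp
  qed
qed

end
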